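(* Let $K\subset\mathbb{R}^D$ be a connected nested fractal with $\mathrm{diam}(K)=1$, let $d$ be the Euclidean metric restricted to $K$, let $\alpha=\dim_H(K)$, and let $\mu$ be the $\alpha$-dimensional Hausdorff measure on $K$. Let $1<p<\infty$ and let $\sigma_p^{\#}$ be the $p$-critical exponent of $(K,d,\mu)$. Then property (NE) holds with $\sigma=\sigma_p^{\#}$, that is, there exists a constant $C>0$ such that for all $u\in KS_{p,\infty}^{\sigma_p^{\#}}$, $$\sup_{r\in(0,\mathrm{diam}(K))}\Phi_u^{\sigma_p^{\#}}(r)\le C\liminf_{r\to 0}\Phi_u^{\sigma_p^{\#}}(r).$$
   Context: **Self-similar set.** Consider an iterated function system (IFS) $\{F_i\}_{i=1}^N$ on $\mathbb{R}^D$ that is homogeneous, i.e. $F_i(x)=\rho(x-b_i)+b_i$ for $1\le i\le N$, with a common contraction ratio $\rho\in(0,1)$ and $b_i\in\mathbb{R}^D$. Let $K$ be its attractor. Let $W_n$ be the set of words of length $n$ over $\{1,\dots,N\}$; for $w=w_1\cdots w_n\in W_n$ put $F_w=F_{w_1}\circ\cdots\circ F_{w_n}$ and $K_w=F_w(K)$, called an $n$-cell of $K$. **Nested fractal.** Let $F$ be the set of fixed points of the maps $F_1,\dots,F_N$. A point $x\in F$ is an essential fixed point if there exist $y\in F$, $y\ne x$, and $i,j\in\{1,\dots,N\}$ with $F_i(x)=F_j(y)$. Let $F^{(0)}$ be the set of essential fixed points. $K$ is called a nested fractal if: (i) the IFS is homogeneous and satisfies the open set condition; (ii) (connectivity) for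 any $1$-cells $K_i,K_j$ there is a chain $a_0=i,a_1,\dots,a_n=j$ in $\{1,\dots,N\}$ with $K_{a_k}\cap K_{a_{k+1}}\neq\emptyset$ for $0\le k<n$; (iii) (symmetry) for $x\ne y$ in $\mathbb{R}^D$ let $H_{xy}=\{z\in\mathbb{R}^D:|z-x|=|z-y|\}$ and let $U_{xy}$ be the reflection in $H_{xy}$; for any $n\ge1$ and any $x_0\neq y_0\in F^{(0)}$, $U_{x_0y_0}$ maps $n$-cells to $n$-cells, and maps any $n$-cell containing points on both sides of $H_{x_0y_0}$ to itself; (iv) (nesting) for any $n\ge1$ and $w\neq v$ in $W_n$, $K_w\cap K_v=F_w(F^{(0)})\cap F_v(F^{(0)})$. By the open set condition, $\alpha=\dim_H(K)=-\log N/\log\rho$ and $\mu$ is $\alpha$-regular: $C^{-1}r^\alpha\le\mu(B(x,r))\le Cr^\alpha$ for all $x\in K$, $0<r\le1$, where $B(x,r)=\{y\in K:d(x,y)<r\}$. **Function spaces.** For $p>1$, $\sigma>0$, $u\in L^p(K,\mu)$ and $r>0$, $$\Phi_u^\sigma(r)=\frac1{r^{p\sigma}}\int_K\frac1{\mu(B(x,r))}\int_{B(x,r)}|u(x)-u(y)|^p\,d\mu(y)\,d\mu(x).$$ The Korevaar-Schoen space is $KS_{p,\infty}^\sigma=\{u\in L^p(K,\mu):\limsup_{r\to0}\Phi_u^\sigma(r)<\infty\}$. The Besov space is $B_{p,\infty}^\sigma=\{u\in L^p(K,\mu):\sup_{r\in(0,1)}\Phi_u^\sigma(r)<\infty\}$;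 the two spaces coincide. The $p$-critical exponent is $$\sigma_p^{\#}=\sup\{\sigma>0:B_{p,\infty}^\sigma\text{ contains non-constant functions}\}.$$ *)

theory Defs
  imports "HOL-Analysis.Analysis"
begin

section \<open>Hausdorff measure and dimension\<close>

text \<open>
  The term \<open>diam(A)^s\<close> of the Hausdorff sums, with the convention \<open>0^0 = 1\<close> for nonempty sets
  (in HOL, \<open>0 powr 0 = 0\<close>), so that \<open>s = 0\<close> gives counting measure.
\<close>
definition hausdorff_gauge :: "real \<Rightarrow> 'a::metric_space set \<Rightarrow> ennreal" where
  "hausdorff_gauge s A =
     (if A = {} then 0 else if s = 0 then 1 else ennreal (diameter A powr s))"

text \<open>
  Boundedness of the covering sets is required separately because \<^const>\<open>diameter\<close> is
  unspecified on unbounded sets.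
\<close>
definition hausdorff_premeasure :: "real \<Rightarrow> real \<Rightarrow> 'a::metric_space set \<Rightarrow> ennreal" where
  "hausdorff_premeasure s \<delta> E =
     (INF A\<in>{A::nat \<Rightarrow> 'a set. E \<subseteq> (\<Union>i. A i) \<and> (\<forall>i. bounded (A i) \<and> diameter (A i) \<le> \<delta>)}.
        (\<Sum>i. hausdorff_gauge s (A i)))"

definition hausdorff_outer :: "real \<Rightarrow> 'a::metric_space set \<Rightarrow> ennreal" where
  "hausdorff_outer s E = (SUP \<delta>\<in>{0<..}. hausdorff_premeasure s \<delta> E)"

text \<open>
  The Hausdorff measure on the Borel sets, without a normalising constant. The theorem
  \<open>emeasure_hausdorff_measure\<close> below shows that its values are those of the outer measure.
\<close>
definition hausdorff_measure :: "real \<Rightarrow> 'a::metric_space measure" where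
  "hausdorff_measure s = measure_of UNIV (sets borel) (hausdorff_outer s)"

text \<open>
  A real number by definition. On subsets of a Euclidean space of dimension \<open>D\<close> the set below
  contains every \<open>s > D\<close>, so this is the usual Hausdorff dimension there.
\<close>
definition hausdorff_dim :: "'a::metric_space set \<Rightarrow> real" where
  "hausdorff_dim E = Inf {s. 0 \<le> s \<and> hausdorff_outer s E = 0}"

lemma hausdorff_gauge_empty [simp]: "hausdorff_gauge s {} = 0"
  by (simp add: hausdorff_gauge_def)

lemma hausdorff_premeasure_le:
  assumes "E \<subseteq> (\<Union>i. A i)" "\<And>i. bounded (A i)" "\<And>i. diameter (A i) \<le> \<delta>"
  shows "hausdorff_premeasure s \<delta> E \<le> (\<Sum>i. hausdorff_gauge s (A i))"
  unfolding hausdorff_premeasure_def using assms by (intro INF_lower) auto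

lemma hausdorff_premeasure_cover:
  assumes "hausdorff_premeasure s \<delta> E < c"
  obtains A where "E \<subseteq> (\<Union>i. A i)" "\<And>i. bounded (A i)" "\<And>i. diameter (A i) \<le> \<delta>"
    "(\<Sum>i. hausdorff_gauge s (A i)) < c"
  using assms unfolding hausdorff_premeasure_def INF_less_iff by auto

lemma hausdorff_premeasure_antimono:
  "\<delta> \<le> \<delta>' \<Longrightarrow> hausdorff_premeasure s \<delta>' E \<le> hausdorff_premeasure s \<delta> E"
  unfolding hausdorff_premeasure_def by (intro INF_superset_mono) (auto intro: order_trans)

lemma hausdorff_premeasure_mono:
  "E \<subseteq> E' \<Longrightarrow> hausdorff_premeasure s \<delta> E \<le> hausdorff_premeasure s \<delta> E'"
  unfolding hausdorff_premeasure_def by (intro INF_superset_mono) auto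

lemma hausdorff_premeasure_le_outer:
  "0 < \<delta> \<Longrightarrow> hausdorff_premeasure s \<delta> E \<le> hausdorff_outer s E"
  unfolding hausdorff_outer_def by (intro SUP_upper) auto

lemma hausdorff_outer_mono: "E \<subseteq> E' \<Longrightarrow> hausdorff_outer s E \<le> hausdorff_outer s E'"
  unfolding hausdorff_outer_def by (intro SUP_mono) (auto intro: hausdorff_premeasure_mono)

lemma hausdorff_outer_empty [simp]: "hausdorff_outer s {} = 0"
proof -
  have "hausdorff_premeasure s \<delta> {} = 0" if "\<delta> > 0" for \<delta>
    using hausdorff_premeasure_le[of "{}" "\<lambda>_. {}" \<delta> s] that by simp
  then show ?thesis
    unfolding hausdorff_outer_def by (intro antisym SUP_least) auto
qed

lemma hausdorff_premeasure_subadditive: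
  "hausdorff_premeasure s \<delta> (\<Union>n. E n) \<le> (\<Sum>n. hausdorff_premeasure s \<delta> (E n))"
proof (rule ennreal_le_epsilon)
  fix e :: real
  assume fin: "(\<Sum>n. hausdorff_premeasure s \<delta> (E n)) < top" and e: "0 < e"
  have "hausdorff_premeasure s \<delta> (E n) < top" for n
    using ennreal_suminf_lessD[OF fin] .
  then have "hausdorff_premeasure s \<delta> (E n)
      < hausdorff_premeasure s \<delta> (E n) + ennreal e * ennreal ((1/2) ^ Suc n)" for n
    using e by (simp add: ennreal_mult[symmetric] less_top ennreal_zero_less_mult_iff)
  then have "\<exists>A. E n \<subseteq> (\<Union>i. A i) \<and> (\<forall>i. bounded (A i)) \<and> (\<forall>i. diameter (A i) \<le> \<delta>) \<and>
      (\<Sum>i. hausdorff_gauge s (A i))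
        < hausdorff_premeasure s \<delta> (E n) + ennreal e * ennreal ((1/2) ^ Suc n)" for n
    by (rule hausdorff_premeasure_cover) blast
  then obtain A where A: "\<And>n. E n \<subseteq> (\<Union>i. A n i)" "\<And>n i. bounded (A n i)"
      "\<And>n i. diameter (A n i) \<le> \<delta>"
      and lt: "\<And>n. (\<Sum>i. hausdorff_gauge s (A n i))
        < hausdorff_premeasure s \<delta> (E n) + ennreal e * ennreal ((1/2) ^ Suc n)"
    by metis
  let ?B = "\<lambda>k. case_prod A (prod_decode k)"
  have "x \<in> (\<Union>k. ?B k)" if x: "x \<in> E n" for x n
  proof -
    obtain i where "x \<in> A n i" using A(1) x by blast
    then have "x \<in> ?B (prod_encode (n, i))" by simp
    then show ?thesis by (rule UN_I[OF UNIV_I])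
  qed
  then have cov: "(\<Union>n. E n) \<subseteq> (\<Union>k. ?B k)"
    by (intro UN_least subsetI)
  have "hausdorff_premeasure s \<delta> (\<Union>n. E n) \<le> (\<Sum>k. hausdorff_gauge s (?B k))"
    using A by (intro hausdorff_premeasure_le cov) (simp_all split: prod.split)
  also have "\<dots> = (\<Sum>k. (\<lambda>(n, i). hausdorff_gauge s (A n i)) (prod_decode k))"
    by (intro arg_cong[where f = suminf]) (auto split: prod.split)
  also have "\<dots> = (\<Sum>n. \<Sum>i. hausdorff_gauge s (A n i))"
    by (intro suminf_ennreal_2dimen) auto
  also have "\<dots> \<le> (\<Sum>n. hausdorff_premeasure s \<delta> (E n) + ennreal e * ennreal ((1/2) ^ Suc n))"
    using lt by (intro suminf_le) (auto intro: less_imp_le)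
  also have "\<dots> = (\<Sum>n. hausdorff_premeasure s \<delta> (E n)) + (\<Sum>n. ennreal e * ennreal ((1/2) ^ Suc n))"
    by (rule suminf_add[symmetric]) auto
  also have "(\<Sum>n. ennreal e * ennreal ((1/2) ^ Suc n)) = ennreal e"
    unfolding ennreal_suminf_cmult
    by (subst suminf_ennreal_eq[OF zero_le_power power_half_series]) auto
  finally show "hausdorff_premeasure s \<delta> (\<Union>n. E n)
      \<le> (\<Sum>n. hausdorff_premeasure s \<delta> (E n)) + ennreal e" .
qed

lemma hausdorff_outer_countably_subadditive:
  "hausdorff_outer s (\<Union>n. E n) \<le> (\<Sum>n. hausdorff_outer s (E n))"
proof -
  have "hausdorff_premeasure s \<delta> (\<Union>n. E n) \<le> (\<Sum>n. hausdorff_outer s (E n))" if "\<delta> > 0" for \<delta>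
    using that
    by (intro order_trans[OF hausdorff_premeasure_subadditive] suminf_le
        hausdorff_premeasure_le_outer) auto
  then show ?thesis
    unfolding hausdorff_outer_def[of s "\<Union>n. E n"] by (intro SUP_least) auto
qed

lemma outer_measure_space_hausdorff: "outer_measure_space (Pow UNIV) (hausdorff_outer s)"
  unfolding outer_measure_space_def positive_def increasing_def countably_subadditive_def
  by (auto intro: hausdorff_outer_mono hausdorff_outer_countably_subadditive)

lemma hausdorff_outer_Un: "hausdorff_outer s (A \<union> B) \<le> hausdorff_outer s A + hausdorff_outer s B"
proof -
  have "hausdorff_outer s (\<Union>n. binaryset A B n) \<le> (\<Sum>n. hausdorff_outer s (binaryset A B n))"
    by (rule hausdorff_outer_countably_subadditive)
  then show ?thesis
    by (simp add: UN_binaryset_eq suminf_binaryset_eq)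
qed

lemma hausdorff_premeasure_separated:
  assumes "\<delta> < d" and sep: "\<And>x y. x \<in> A \<Longrightarrow> y \<in> B \<Longrightarrow> d \<le> dist x y"
  shows "hausdorff_premeasure s \<delta> A + hausdorff_premeasure s \<delta> B \<le> hausdorff_premeasure s \<delta> (A \<union> B)"
  unfolding hausdorff_premeasure_def[of s \<delta> "A \<union> B"]
proof (intro INF_greatest; clarify)
  fix C :: "nat \<Rightarrow> 'a set"
  assume cov: "A \<union> B \<subseteq> (\<Union>i. C i)" and C: "\<forall>i. bounded (C i) \<and> diameter (C i) \<le> \<delta>"
  define CA where "CA i = (if C i \<inter> A = {} then {} else C i)" for i
  define CB where "CB i = (if C i \<inter> B = {} then {} else C i)" for i
  have one: "C i \<inter> A = {} \<or> C i \<inter> B = {}" for i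
  proof (rule ccontr)
    assume "\<not> ?thesis"
    then obtain x y where "x \<in> C i" "x \<in> A" "y \<in> C i" "y \<in> B" by blast
    then have "d \<le> dist x y" "dist x y \<le> \<delta>"
      using sep C diameter_bounded_bound[of "C i" x y] by (auto intro: order_trans)
    with \<open>\<delta> < d\<close> show False by simp
  qed
  have d0: "0 \<le> \<delta>"
    using C diameter_ge_0[of "C 0"] by (meson order_trans)
  have covA: "A \<subseteq> (\<Union>i. CA i)" and covB: "B \<subseteq> (\<Union>i. CB i)"
    using cov by (fastforce simp: CA_def CB_def)+
  have "hausdorff_premeasure s \<delta> A \<le> (\<Sum>i. hausdorff_gauge s (CA i))"
    using covA C d0 by (intro hausdorff_premeasure_le) (auto simp: CA_def)
  moreover have "hausdorff_premeasure s \<delta> B \<le> (\<Sum>i. hausdorff_gauge s (CB i))"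
    using covB C d0 by (intro hausdorff_premeasure_le) (auto simp: CB_def)
  ultimately have "hausdorff_premeasure s \<delta> A + hausdorff_premeasure s \<delta> B
      \<le> (\<Sum>i. hausdorff_gauge s (CA i)) + (\<Sum>i. hausdorff_gauge s (CB i))"
    by (rule add_mono)
  also have "\<dots> = (\<Sum>i. hausdorff_gauge s (CA i) + hausdorff_gauge s (CB i))"
    by (simp add: suminf_add)
  also have "\<dots> \<le> (\<Sum>i. hausdorff_gauge s (C i))"
    using one by (intro suminf_le) (auto simp: CA_def CB_def)
  finally show "hausdorff_premeasure s \<delta> A + hausdorff_premeasure s \<delta> B
      \<le> (\<Sum>i. hausdorff_gauge s (C i))" .
qed

lemma hausdorff_outer_separated:
  assumes "0 < d" and sep: "\<And>x y. x \<in> A \<Longrightarrow> y \<in> B \<Longrightarrow> d \<le> dist x y"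
  shows "hausdorff_outer s (A \<union> B) = hausdorff_outer s A + hausdorff_outer s B"
proof (rule antisym[OF hausdorff_outer_Un])
  have "hausdorff_premeasure s \<delta> A + hausdorff_premeasure s \<delta>' B \<le> hausdorff_outer s (A \<union> B)"
    if "\<delta> > 0" "\<delta>' > 0" for \<delta> \<delta>'
  proof -
    define e where "e = min (min \<delta> \<delta>') (d / 2)"
    have e: "e \<le> \<delta>" "e \<le> \<delta>'" "e < d" "0 < e" using that \<open>0 < d\<close> by (auto simp: e_def)
    have "hausdorff_premeasure s \<delta> A + hausdorff_premeasure s \<delta>' B
        \<le> hausdorff_premeasure s e A + hausdorff_premeasure s e B"
      using e by (intro add_mono hausdorff_premeasure_antimono)
    also have "\<dots> \<le> hausdorff_premeasure s e (A \<union> B)"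
      using e sep by (intro hausdorff_premeasure_separated)
    also have "\<dots> \<le> hausdorff_outer s (A \<union> B)"
      using e by (intro hausdorff_premeasure_le_outer)
    finally show ?thesis .
  qed
  then show "hausdorff_outer s A + hausdorff_outer s B \<le> hausdorff_outer s (A \<union> B)"
    unfolding hausdorff_outer_def[of s A] hausdorff_outer_def[of s B]
    by (subst ennreal_SUP_add_left[symmetric], simp,
        intro SUP_least, subst ennreal_SUP_add_right, simp, intro SUP_least) auto
qed

lemma hausdorff_outer_annuli:
  fixes f :: "'a::metric_space \<Rightarrow> real" and a b :: "nat \<Rightarrow> real"
  assumes lip: "\<And>x y. f x \<le> f y + dist x y"
    and gap: "\<And>k. b (Suc k) < a k" and ab: "\<And>k. a k \<le> b k"
  shows "(\<Sum>k<n. hausdorff_outer s {x\<in>X. a k \<le> f x \<and> f x \<le> b k}) \<le> hausdorff_outer s X"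
proof -
  let ?R = "\<lambda>k. {x\<in>X. a k \<le> f x \<and> f x \<le> b k}"
  have mono: "a m \<le> a k" if "k \<le> m" for k m
    using that
  proof (induction rule: dec_induct)
    case (step m)
    show ?case using step.IH gap[of m] ab[of "Suc m"] by linarith
  qed simp
  have "(\<Sum>k<n. hausdorff_outer s (?R k)) = hausdorff_outer s (\<Union>k<n. ?R k)"
  proof (induction n)
    case (Suc n)
    show ?case
    proof (cases n)
      case 0
      then show ?thesis by (simp add: lessThan_Suc)
    next
      case n: (Suc m)
      have "hausdorff_outer s ((\<Union>k<n. ?R k) \<union> ?R n)
          = hausdorff_outer s (\<Union>k<n. ?R k) + hausdorff_outer s (?R n)"
      proof (rule hausdorff_outer_separated)
        show "0 < a m - b n" using gap[of m] n by simp
        fix x y assume "x \<in> (\<Union>k<n. ?R k)" and y: "y \<in> ?R n"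
        then obtain k where "k \<le> m" "a k \<le> f x" using n by (auto simp: less_Suc_eq_le)
        then have "a m \<le> f x" using mono by force
        with y show "a m - b n \<le> dist x y" using lip[of x y] by simp
      qed
      with Suc show ?thesis by (simp add: lessThan_Suc Un_commute)
    qed
  qed simp
  also have "\<dots> \<le> hausdorff_outer s X"
    by (intro hausdorff_outer_mono) auto
  finally show ?thesis .
qed

lemma hausdorff_outer_closed_split:
  fixes C :: "'a::metric_space set"
  assumes "closed C"
  shows "hausdorff_outer s (X \<inter> C) + hausdorff_outer s (X - C) = hausdorff_outer s X"
proof (cases "C = {} \<or> hausdorff_outer s X = top")
  case True
  then show ?thesis
  proof
    assume "hausdorff_outer s X = top"
    then show ?thesis
      using hausdorff_outer_Un[of s "X \<inter> C" "X - C"] by (simp add: Int_Diff_Un top_unique)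
  qed simp
next
  case False
  then have ne: "C \<noteq> {}" and fin: "hausdorff_outer s X < top" by (auto simp: less_top)
  let ?f = "\<lambda>x. infdist x C"
  let ?h = "hausdorff_outer s"
  have lip: "?f x \<le> ?f y + dist x y" for x y by (rule infdist_triangle)
  define q where "q k = inverse (real (Suc k))" for k
  have q_less: "q m < q k" if "k < m" for k m using that by (simp add: q_def)
  have q_le: "q m \<le> q k" if "k \<le> m" for k m using that by (simp add: q_def)
  have q0: "0 < q k" for k by (simp add: q_def)
  define P where "P n = {x\<in>X. q n \<le> ?f x}" for n
  define R where "R k = {x\<in>X. q (Suc k) \<le> ?f x \<and> ?f x \<le> q k}" for k
  have even: "(\<Sum>k<n. ?h (R (2*k))) \<le> ?h X" for n
    unfolding R_def
    by (rule hausdorff_outer_annuli[of ?f "\<lambda>k. q (2*k)" "\<lambda>k. q (Suc (2*k))"])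
       (auto intro: lip q_less q_le)
  have odd: "(\<Sum>k<n. ?h (R (Suc (2*k)))) \<le> ?h X" for n
    unfolding R_def
    by (rule hausdorff_outer_annuli[of ?f "\<lambda>k. q (Suc (2*k))" "\<lambda>k. q (Suc (Suc (2*k)))"])
       (auto intro: lip q_less q_le)
  have sum_split: "(\<Sum>k<2*n. ?h (R k)) = (\<Sum>k<n. ?h (R (2*k))) + (\<Sum>k<n. ?h (R (Suc (2*k))))" for n
    by (induction n) (auto simp: algebra_simps)
  have "(\<Sum>k<n. ?h (R k)) \<le> ?h X + ?h X" for n
  proof -
    have "(\<Sum>k<n. ?h (R k)) \<le> (\<Sum>k<2*n. ?h (R k))" by (intro sum_mono2) auto
    then show ?thesis using add_mono[OF even odd, of n n] sum_split[of n] by auto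
  qed
  then have "(\<Sum>k. ?h (R k)) \<le> ?h X + ?h X"
    by (intro suminf_le_const) auto
  then have sum_fin: "(\<Sum>k. ?h (R k)) \<noteq> top"
    using fin by (metis ennreal_add_eq_top less_top top.extremum_unique)
  have tail: "(\<lambda>n. \<Sum>k. ?h (R (k + n))) \<longlonglongrightarrow> 0"
  proof -
    have "(\<lambda>n. (\<Sum>k. ?h (R k)) - (\<Sum>k<n. ?h (R k))) \<longlonglongrightarrow> (\<Sum>k. ?h (R k)) - (\<Sum>k. ?h (R k))"
      using sum_fin by (intro tendsto_diff_ennreal tendsto_const summable_LIMSEQ) auto
    moreover have "(\<Sum>k. ?h (R k)) - (\<Sum>k<n. ?h (R k)) = (\<Sum>k. ?h (R (k + n)))" for n
    proof -
      have "(\<Sum>k. ?h (R k)) = (\<Sum>k. ?h (R (k + n))) + (\<Sum>k<n. ?h (R k))"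
        by (rule suminf_offset) simp
      moreover have "(\<Sum>k<n. ?h (R k)) \<noteq> top"
        using sum_fin calculation by auto
      ultimately show ?thesis by simp
    qed
    ultimately show ?thesis using sum_fin by simp
  qed
  have le: "?h (X \<inter> C) + ?h (X - C) \<le> ?h X + (\<Sum>k. ?h (R (k + n)))" for n
  proof -
    have sub: "X - C \<subseteq> P n \<union> (\<Union>k. R (k + n))"
    proof
      fix x assume x: "x \<in> X - C"
      then have pos: "0 < ?f x" using infdist_pos_not_in_closed[OF \<open>closed C\<close> ne] by auto
      show "x \<in> P n \<union> (\<Union>k. R (k + n))"
      proof (cases "q n \<le> ?f x")
        case True
        then show ?thesis using x by (auto simp: P_def)
      next
        case False
        obtain m where "q m < ?f x" using reals_Archimedean[OF pos] by (auto simp: q_def)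
        define l where "l = (LEAST m. q m < ?f x)"
        have l: "q l < ?f x" unfolding l_def using \<open>q m < ?f x\<close> by (rule LeastI)
        have "n < l" using l False q_le[of l n] by (meson linorder_not_le order_less_imp_le order_trans)
        then obtain j where j: "l = Suc (j + n)" by (metis add.commute less_imp_Suc_add)
        have "\<not> q (j + n) < ?f x" using not_less_Least[of "j + n" "\<lambda>m. q m < ?f x"] j
          unfolding l_def by simp
        then have "x \<in> R (j + n)" using x l j by (simp add: R_def)
        then show ?thesis by blast
      qed
    qed
    have "?h (X - C) \<le> ?h (P n) + ?h (\<Union>k. R (k + n))"
      by (rule order_trans[OF hausdorff_outer_mono[OF sub] hausdorff_outer_Un])
    also have "\<dots> \<le> ?h (P n) + (\<Sum>k. ?h (R (k + n)))"
      by (intro add_mono hausdorff_outer_countably_subadditive) simp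
    finally have "?h (X \<inter> C) + ?h (X - C) \<le> ?h (X \<inter> C) + (?h (P n) + (\<Sum>k. ?h (R (k + n))))"
      by (intro add_mono) simp
    also have "\<dots> = (?h (X \<inter> C) + ?h (P n)) + (\<Sum>k. ?h (R (k + n)))"
      by (simp add: add.assoc)
    also have "?h (X \<inter> C) + ?h (P n) = ?h ((X \<inter> C) \<union> P n)"
    proof (rule hausdorff_outer_separated[symmetric])
      show "0 < q n" by (rule q0)
      fix x y assume "x \<in> X \<inter> C" "y \<in> P n"
      then show "q n \<le> dist x y"
        using lip[of y x] by (simp add: P_def dist_commute)
    qed
    also have "\<dots> \<le> ?h X" by (intro hausdorff_outer_mono) (auto simp: P_def)
    finally show ?thesis by (simp add: add_mono)
  qed
  have "(\<lambda>n. ?h X + (\<Sum>k. ?h (R (k + n)))) \<longlonglongrightarrow> ?h X + 0"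
    by (intro tendsto_add tendsto_const tail)
  then have "?h (X \<inter> C) + ?h (X - C) \<le> ?h X"
    using le by (intro LIMSEQ_le_const[of _ "?h X"]) auto
  moreover have "?h X \<le> ?h (X \<inter> C) + ?h (X - C)"
    using hausdorff_outer_Un[of s "X \<inter> C" "X - C"] by (simp add: Int_Diff_Un)
  ultimately show ?thesis by (rule antisym)
qed

lemma sets_hausdorff_measure [simp, measurable_cong]: "sets (hausdorff_measure s) = sets borel"
  unfolding hausdorff_measure_def by (metis sets.sets_measure_of_eq space_borel)

lemma space_hausdorff_measure [simp]: "space (hausdorff_measure s) = UNIV"
  unfolding hausdorff_measure_def by (simp add: space_measure_of_conv)

theorem emeasure_hausdorff_measure:
  fixes A :: "'a::metric_space set"
  assumes "A \<in> sets borel"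
  shows "emeasure (hausdorff_measure s) A = hausdorff_outer s A"
proof -
  interpret P: sigma_algebra "UNIV :: 'a set" "Pow UNIV" by (rule sigma_algebra_Pow)
  define L where "L = lambda_system (UNIV :: 'a set) (Pow UNIV) (hausdorff_outer s)"
  have ms: "measure_space UNIV L (hausdorff_outer s)"
    unfolding L_def by (rule P.caratheodory_lemma[OF outer_measure_space_hausdorff])
  then have L: "sigma_algebra UNIV L" and ca: "countably_additive L (hausdorff_outer s)"
    and pos: "positive L (hausdorff_outer s)"
    by (auto simp: measure_space_def)
  have "Collect closed \<subseteq> L"
    using hausdorff_outer_closed_split unfolding L_def P.lambda_system_eq by blast
  then have "sigma_sets UNIV (Collect closed) \<subseteq> L"
    using sigma_algebra.sigma_sets_subset[OF L] by blast
  then have borel: "sets (borel :: 'a measure) \<subseteq> L"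
    by (simp add: borel_eq_closed)
  show ?thesis
    unfolding hausdorff_measure_def
  proof (rule emeasure_measure_of_sigma)
    show "sigma_algebra UNIV (sets (borel :: 'a measure))"
      by (metis sets.sigma_algebra_axioms space_borel)
    show "positive (sets (borel :: 'a measure)) (hausdorff_outer s)"
      by (simp add: positive_def)
    show "countably_additive (sets (borel :: 'a measure)) (hausdorff_outer s)"
    proof (rule countably_additiveI)
      fix B :: "nat \<Rightarrow> 'a set"
      assume "range B \<subseteq> sets borel" "disjoint_family B" "(\<Union>i. B i) \<in> sets borel"
      with borel have "range B \<subseteq> L" "disjoint_family B" "(\<Union>i. B i) \<in> L" by (auto simp: subset_iff)
      with ca show "(\<Sum>i. hausdorff_outer s (B i)) = hausdorff_outer s (\<Union>i. B i)"
        unfolding countably_additive_def by simp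
    qed
  qed (rule assms)
qed


section \<open>Nested fractals\<close>

text \<open>
  An iterated function system is a family \<open>F\<close> of self-maps of the ambient space, of which only
  the maps with index in \<open>{1..N}\<close> matter.
\<close>
definition homogeneous_ifs :: "nat \<Rightarrow> (nat \<Rightarrow> 'a::euclidean_space \<Rightarrow> 'a) \<Rightarrow> bool" where
  "homogeneous_ifs N F \<longleftrightarrow>
     (\<exists>\<rho> b. 0 < \<rho> \<and> \<rho> < 1 \<and> (\<forall>i\<in>{1..N}. \<forall>x. F i x = \<rho> *\<^sub>R (x - b i) + b i))"

definition ifs_attractor :: "nat \<Rightarrow> (nat \<Rightarrow> 'a::euclidean_space \<Rightarrow> 'a) \<Rightarrow> 'a set \<Rightarrow> bool" where
  "ifs_attractor N F K \<longleftrightarrow> K \<noteq> {} \<and> compact K \<and> K = (\<Union>i\<in>{1..N}. F i ` K)"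

definition open_set_condition :: "nat \<Rightarrow> (nat \<Rightarrow> 'a::euclidean_space \<Rightarrow> 'a) \<Rightarrow> bool" where
  "open_set_condition N F \<longleftrightarrow>
     (\<exists>V. open V \<and> V \<noteq> {} \<and> (\<forall>i\<in>{1..N}. F i ` V \<subseteq> V) \<and>
        (\<forall>i\<in>{1..N}. \<forall>j\<in>{1..N}. i \<noteq> j \<longrightarrow> F i ` V \<inter> F j ` V = {}))"

definition words :: "nat \<Rightarrow> nat \<Rightarrow> nat list set" where
  "words N n = {w. length w = n \<and> set w \<subseteq> {1..N}}"

definition word_map :: "(nat \<Rightarrow> 'a \<Rightarrow> 'a) \<Rightarrow> nat list \<Rightarrow> 'a \<Rightarrow> 'a" where
  "word_map F w = foldr (\<lambda>i g. F i \<circ> g) w id"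

definition cell :: "(nat \<Rightarrow> 'a \<Rightarrow> 'a) \<Rightarrow> 'a set \<Rightarrow> nat list \<Rightarrow> 'a set" where
  "cell F K w = word_map F w ` K"

definition ifs_fixed_points :: "nat \<Rightarrow> (nat \<Rightarrow> 'a \<Rightarrow> 'a) \<Rightarrow> 'a set" where
  "ifs_fixed_points N F = {x. \<exists>i\<in>{1..N}. F i x = x}"

definition essential_fixed_points :: "nat \<Rightarrow> (nat \<Rightarrow> 'a \<Rightarrow> 'a) \<Rightarrow> 'a set" where
  "essential_fixed_points N F =
     {x \<in> ifs_fixed_points N F.
        \<exists>y\<in>ifs_fixed_points N F. y \<noteq> x \<and> (\<exists>i\<in>{1..N}. \<exists>j\<in>{1..N}. F i x = F j y)}"

definition nf_connectivity :: "nat \<Rightarrow> (nat \<Rightarrow> 'a \<Rightarrow> 'a) \<Rightarrow> 'a set \<Rightarrow> bool" where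
  "nf_connectivity N F K \<longleftrightarrow>
     (\<forall>i\<in>{1..N}. \<forall>j\<in>{1..N}. \<exists>n (a :: nat \<Rightarrow> nat).
        a 0 = i \<and> a n = j \<and> (\<forall>k\<le>n. a k \<in> {1..N}) \<and>
        (\<forall>k<n. F (a k) ` K \<inter> F (a (Suc k)) ` K \<noteq> {}))"

text \<open>
  The reflection in the bisecting hyperplane \<open>{z. dist z x = dist z y}\<close>, which passes through
  \<open>midpoint x y\<close> and is orthogonal to \<open>y - x\<close>.
\<close>
definition bisector_reflection :: "'a::euclidean_space \<Rightarrow> 'a \<Rightarrow> 'a \<Rightarrow> 'a" where
  "bisector_reflection x y z =
     z - (2 * ((z - midpoint x y) \<bullet> (y - x)) / ((y - x) \<bullet> (y - x))) *\<^sub>R (y - x)"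

definition meets_both_sides :: "'a::euclidean_space \<Rightarrow> 'a \<Rightarrow> 'a set \<Rightarrow> bool" where
  "meets_both_sides x y S \<longleftrightarrow>
     (\<exists>z\<in>S. dist z x < dist z y) \<and> (\<exists>z\<in>S. dist z y < dist z x)"

definition nf_symmetry :: "nat \<Rightarrow> (nat \<Rightarrow> 'a::euclidean_space \<Rightarrow> 'a) \<Rightarrow> 'a set \<Rightarrow> bool" where
  "nf_symmetry N F K \<longleftrightarrow>
     (\<forall>n\<ge>1. \<forall>x\<in>essential_fixed_points N F. \<forall>y\<in>essential_fixed_points N F. x \<noteq> y \<longrightarrow>
        (\<forall>w\<in>words N n.
           (\<exists>v\<in>words N n. bisector_reflection x y ` cell F K w = cell F K v) \<and>
           (meets_both_sides x y (cell F K w) \<longrightarrow>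
              bisector_reflection x y ` cell F K w = cell F K w)))"

definition nf_nesting :: "nat \<Rightarrow> (nat \<Rightarrow> 'a \<Rightarrow> 'a) \<Rightarrow> 'a set \<Rightarrow> bool" where
  "nf_nesting N F K \<longleftrightarrow>
     (\<forall>n\<ge>1. \<forall>w\<in>words N n. \<forall>v\<in>words N n. w \<noteq> v \<longrightarrow>
        cell F K w \<inter> cell F K v =
          word_map F w ` essential_fixed_points N F \<inter> word_map F v ` essential_fixed_points N F)"

definition nested_fractal :: "nat \<Rightarrow> (nat \<Rightarrow> 'a::euclidean_space \<Rightarrow> 'a) \<Rightarrow> 'a set \<Rightarrow> bool" where
  "nested_fractal N F K \<longleftrightarrow>
     ifs_attractor N F K \<and> homogeneous_ifs N F \<and> open_set_condition N F \<and>
     nf_connectivity N F K \<and> nf_symmetry N F K \<and> nf_nesting N F K"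


section \<open>Korevaar-Schoen and Besov spaces\<close>

text \<open>
  In this section the metric measure space is the underlying set \<^term>\<open>space M\<close> of a measure \<open>M\<close>,
  with the metric of the ambient type. Functions are considered up to null sets, so
  \<open>L\<^sup>p\<close> is represented by measurable functions and ``constant'' means constant almost everywhere.
\<close>
definition mball_in :: "'a::metric_space measure \<Rightarrow> 'a \<Rightarrow> real \<Rightarrow> 'a set" where
  "mball_in M x r = {y \<in> space M. dist x y < r}"

definition Lp_functions :: "real \<Rightarrow> 'a measure \<Rightarrow> ('a \<Rightarrow> real) set" where
  "Lp_functions p M =
     {u \<in> borel_measurable M. (\<integral>\<^sup>+x. ennreal (\<bar>u x\<bar> powr p) \<partial>M) < \<infinity>}"

definition Phi :: "'a::metric_space measure \<Rightarrow> real \<Rightarrow> real \<Rightarrow> ('a \<Rightarrow> real) \<Rightarrow> real \<Rightarrow> ennreal" where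
  "Phi M p \<sigma> u r =
     (\<integral>\<^sup>+x. (\<integral>\<^sup>+y\<in>mball_in M x r. ennreal (\<bar>u x - u y\<bar> powr p) \<partial>M)
              / emeasure M (mball_in M x r) \<partial>M) / ennreal (r powr (p * \<sigma>))"

definition KS_space :: "'a::metric_space measure \<Rightarrow> real \<Rightarrow> real \<Rightarrow> ('a \<Rightarrow> real) set" where
  "KS_space M p \<sigma> = {u \<in> Lp_functions p M. Limsup (at_right 0) (Phi M p \<sigma> u) < \<infinity>}"

definition Besov_space :: "'a::metric_space measure \<Rightarrow> real \<Rightarrow> real \<Rightarrow> ('a \<Rightarrow> real) set" where
  "Besov_space M p \<sigma> = {u \<in> Lp_functions p M. (SUP r\<in>{0<..<1}. Phi M p \<sigma> u r) < \<infinity>}"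

definition ae_constant :: "'a measure \<Rightarrow> ('a \<Rightarrow> real) \<Rightarrow> bool" where
  "ae_constant M u \<longleftrightarrow> (\<exists>c. AE x in M. u x = c)"

text \<open>A real supremum, hence meaningful when the set of exponents is nonempty and bounded.\<close>
definition critical_exponent :: "'a::metric_space measure \<Rightarrow> real \<Rightarrow> real" where
  "critical_exponent M p = Sup {\<sigma>. 0 < \<sigma> \<and> (\<exists>u\<in>Besov_space M p \<sigma>. \<not> ae_constant M u)}"

definition property_NE :: "'a::metric_space measure \<Rightarrow> real \<Rightarrow> real \<Rightarrow> bool" where
  "property_NE M p \<sigma> \<longleftrightarrow>
     (\<exists>C>0. \<forall>u\<in>KS_space M p \<sigma>.
        (SUP r\<in>{0<..<diameter (space M)}. Phi M p \<sigma> u r)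
          \<le> ennreal C * Liminf (at_right 0) (Phi M p \<sigma> u))"

end

theory Submission
  imports Defs "HOL-Probability.Probability"
begin

text \<open>
  Write \<open>E\<^sub>m f\<close> for the sum of \<open>\<bar>f w - f v\<bar>\<^sup>p\<close> over the pairs of meeting \<open>m\<close>-cells \<open>w, v\<close>, where \<open>f\<close> is a
  function on the \<open>m\<close>-cells, and \<open>R\<^sub>m\<close> for the largest effective resistance
  \<open>\<bar>f x - f y\<bar>\<^sup>p / E\<^sub>m f\<close> between cells at two boundary points \<open>x, y \<in> V\<^sub>0\<close>. Sampling \<open>f\<close> at one corner
  of each cell gives \<open>E\<^sub>n \<lesssim> R\<^sub>m E\<^sub>n\<^sub>+\<^sub>m\<close> and \<open>R\<^sub>n\<^sub>+\<^sub>m \<lesssim> R\<^sub>n R\<^sub>m\<close>.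

  The symmetry axiom makes all pairs of boundary points comparable: reflections carry nearest
  neighbours of \<open>V\<^sub>0\<close> to nearest neighbours, folding along a bisector shows that the resistance from \<open>x\<close>
  is almost monotone in the distance, and \<open>V\<^sub>0\<close> is connected by steps of minimal length. Hence there are
  bumps, equal to \<open>1\<close> at one boundary point and \<open>0\<close> at the others, of energy \<open>\<lesssim> 1 / R\<^sub>m\<close>;
  interpolating with them yields \<open>R\<^sub>n R\<^sub>m \<lesssim> R\<^sub>n\<^sub>+\<^sub>m\<close>, so \<open>R\<^sub>m \<asymp> \<theta>\<^sup>m\<close> for some \<open>\<theta> \<ge> 1\<close>. A
  Poincare inequality with constant \<open>\<theta>\<^sup>m\<close> follows by induction on the level.

  Let \<open>D\<^sub>n u\<close> be the sum of the mean \<open>p\<close>-oscillations of \<open>u\<close> over pairs of meeting \<open>n\<close>-cells. Points at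
  distance less than \<open>c \<rho>\<^sup>n\<close> lie in meeting \<open>n\<close>-cells, so \<open>\<Phi>\<^sub>u\<^sup>\<sigma>(\<rho>\<^sup>n)\<close> is comparable to
  \<open>(N \<rho>\<^sup>p\<^sup>\<sigma>)\<^sup>-\<^sup>n D\<^sub>n u\<close>. The Poincare inequality, applied to cell averages, gives
  \<open>D\<^sub>n u \<lesssim> \<theta>\<^sup>k D\<^sub>n\<^sub>+\<^sub>k u\<close>; this is property (NE) for the exponent with \<open>N \<rho>\<^sup>p\<^sup>\<sigma> = 1 / \<theta>\<close>, and
  it shows that functions of higher Besov regularity are constant. At that exponent a nonconstant
  function exists: the indicator of a \<open>1\<close>-cell if \<open>\<theta> = 1\<close>, a limit of nearly optimal discrete functions
  if \<open>\<theta> > 1\<close>.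
\<close>

section \<open>Words and cells\<close>

text \<open>Property (NE) is claimed exactly at a supremum of exponents, so knowing the resistances
  up to subexponential factors would not be enough: the constant relating levels n and n + k must
  not depend on k. This is why the growth rate is pinned down by two opposite multiplicative
  inequalities, each with one fixed constant. The super-multiplicative one is the hard half: it
  needs a bump of the same optimal order at every boundary point, and the symmetry axiom enters only
  through these bumps. Boundary values are imposed on all cells containing a boundary point
  (\<open>star\<close>), a condition that reflections visibly transport, whereas the single word
  \<open>corner m x\<close> refers to a choice of index. No limiting energy form is constructed.
  Passages between K and words use that cell masses are comparable to N^-n and that n-cells which do
  not meet are at distance at least \<open>gap\<close> * \<rho>^n. The estimate
  \<open>ex_osc_energy_le\<close> serves twice: with f the cell averages it leads to (NE), with f a
  limit of discrete functions it puts a nonconstant function into the critical space.\<close>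

locale connected_nested_fractal =
  fixes N :: nat and F :: "nat \<Rightarrow> 'a::euclidean_space \<Rightarrow> 'a" and K :: "'a set"
    and \<rho> :: real and b :: "nat \<Rightarrow> 'a"
  assumes attractor: "ifs_attractor N F K"
    and rho: "0 < \<rho>" "\<rho> < 1"
    and F_eq: "i \<in> {1..N} \<Longrightarrow> F i x = \<rho> *\<^sub>R (x - b i) + b i"
    and osc: "open_set_condition N F"
    and chains: "nf_connectivity N F K"
    and symmetry: "nf_symmetry N F K"
    and nesting: "nf_nesting N F K"
    and conn: "connected K"
    and diam: "diameter K = 1"
begin

abbreviation W :: "nat \<Rightarrow> nat list set" where "W \<equiv> words N"
abbreviation kcell :: "nat list \<Rightarrow> 'a set" where "kcell \<equiv> cell F K"
abbreviation V0 :: "'a set" where "V0 \<equiv> essential_fixed_points N F"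

text \<open>All maps share the linear part \<rho>, so a word of length n acts as z -> \<rho>^n z +
  \<open>shift w\<close>, and cells of one level are translates of each other.\<close>

definition shift :: "nat list \<Rightarrow> 'a" where "shift w = word_map F w 0"
text \<open>Reflexive by design: the diagonal contributes nothing to \<open>energy\<close>, but in
  \<open>osc_energy\<close> it supplies the oscillation inside a single cell.\<close>

definition adj :: "nat list \<Rightarrow> nat list \<Rightarrow> bool" where
  "adj w v \<longleftrightarrow> kcell w \<inter> kcell v \<noteq> {}"

lemma compact_K: "compact K" and K_ne: "K \<noteq> {}" and K_eq: "K = (\<Union>i\<in>{1..N}. F i ` K)"
  using attractor unfolding ifs_attractor_def by auto

lemma F_in_K: "i \<in> {1..N} \<Longrightarrow> x \<in> K \<Longrightarrow> F i x \<in> K"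
  by (subst K_eq) blast

lemma bounded_K: "bounded K" using compact_K by (rule compact_imp_bounded)

lemma dist_K: "x \<in> K \<Longrightarrow> y \<in> K \<Longrightarrow> dist x y \<le> 1"
  using diameter_bounded_bound[OF bounded_K] diam by auto

lemma words_append: "w \<in> W n \<Longrightarrow> v \<in> W m \<Longrightarrow> w @ v \<in> W (n + m)"
  by (auto simp: words_def)

lemma finite_words: "finite (W n)"
proof -
  have "W n \<subseteq> {w. set w \<subseteq> {1..N} \<and> length w = n}" by (auto simp: words_def)
  then show ?thesis by (rule finite_subset) (rule finite_lists_length_eq, simp)
qed

lemma card_words: "card (W n) = N ^ n"
proof -
  have "W n = {w. set w \<subseteq> {1..N} \<and> length w = n}" by (auto simp: words_def)
  then show ?thesis by (simp add: card_lists_length_eq)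
qed

lemma words_0 [simp]: "W 0 = {[]}" by (auto simp: words_def)

lemma take_words: "w \<in> W m \<Longrightarrow> n \<le> m \<Longrightarrow> take n w \<in> W n"
  by (auto simp: words_def dest: in_set_takeD)

lemma drop_words: "w \<in> W m \<Longrightarrow> drop n w \<in> W (m - n)"
  by (auto simp: words_def dest: in_set_dropD)

lemma words_set: "w \<in> W n \<Longrightarrow> set w \<subseteq> {1..N}" and words_length: "w \<in> W n \<Longrightarrow> length w = n"
  by (auto simp: words_def)

lemma word_map_Nil [simp]: "word_map F [] = id"
  by (simp add: word_map_def)

lemma word_map_Cons: "word_map F (i # w) x = F i (word_map F w x)"
  by (simp add: word_map_def)

lemma word_map_append: "word_map F (w @ v) x = word_map F w (word_map F v x)"
  by (induction w) (simp_all add: word_map_Cons)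

lemma word_map_eq: "set w \<subseteq> {1..N} \<Longrightarrow> word_map F w x = \<rho> ^ length w *\<^sub>R x + shift w"
proof (induction w arbitrary: x)
  case (Cons i w)
  have "word_map F w y = \<rho> ^ length w *\<^sub>R y + shift w" for y
    using Cons by simp
  then show ?case using Cons.prems
    by (simp add: shift_def[of "i # w"] word_map_Cons F_eq algebra_simps)
qed (simp add: shift_def)

lemma word_map_words: "w \<in> W n \<Longrightarrow> word_map F w x = \<rho> ^ n *\<^sub>R x + shift w"
  using word_map_eq[of w x] by (auto simp: words_def)

lemma inj_word_map: "w \<in> W n \<Longrightarrow> inj (word_map F w)"
  using rho by (auto simp: inj_on_def word_map_words)

lemma word_map_inject: "w \<in> W n \<Longrightarrow> word_map F w x = word_map F w y \<longleftrightarrow> x = y"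
  using inj_word_map by (auto simp: inj_on_def)

lemma dist_word_map: "w \<in> W n \<Longrightarrow> dist (word_map F w x) (word_map F w y) = \<rho> ^ n * dist x y"
proof -
  assume w: "w \<in> W n"
  have "dist (word_map F w x) (word_map F w y) = norm (\<rho> ^ n *\<^sub>R (x - y))"
    by (simp add: word_map_words[OF w] dist_norm scaleR_diff_right)
  then show ?thesis using rho by (simp add: dist_norm)
qed

lemma cell_Nil [simp]: "kcell [] = K"
  by (simp add: cell_def)

lemma cell_append: "kcell (w @ v) = word_map F w ` kcell v"
  by (simp add: cell_def image_image word_map_append)

lemma cell_mono: assumes "set v \<subseteq> {1..N}" shows "kcell (w @ v) \<subseteq> kcell w"
proof -
  have "kcell v \<subseteq> K" using assms
  proof (induction v)
    case (Cons i v)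
    then have "kcell (i # v) \<subseteq> F i ` K" by (auto simp: cell_def word_map_Cons)
    also have "\<dots> \<subseteq> K" using Cons.prems F_in_K by auto
    finally show ?case .
  qed simp
  then show ?thesis by (auto simp: cell_append) (auto simp: cell_def)
qed

lemma cell_take: "w \<in> W m \<Longrightarrow> kcell w \<subseteq> kcell (take n w)"
  using cell_mono[of "drop n w" "take n w"] by (auto simp: words_def dest: in_set_dropD)

lemma cell_subset_K: "w \<in> W n \<Longrightarrow> kcell w \<subseteq> K"
  using cell_take[of w n 0] by simp

lemma K_cells: "K = (\<Union>w\<in>W n. kcell w)"
proof (induction n)
  case (Suc n)
  have W: "W (Suc n) = (\<lambda>(i, w). i # w) ` ({1..N} \<times> W n)"
  proof (intro set_eqI iffI)
    fix w assume "w \<in> W (Suc n)"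
    then show "w \<in> (\<lambda>(i, w). i # w) ` ({1..N} \<times> W n)"
      by (cases w) (auto simp: words_def)
  qed (auto simp: words_def)
  have "(\<Union>w\<in>W (Suc n). kcell w) = (\<Union>i\<in>{1..N}. F i ` (\<Union>w\<in>W n. kcell w))"
    unfolding W by (auto 4 4 simp: cell_def word_map_Cons image_iff)
  also have "\<dots> = (\<Union>i\<in>{1..N}. F i ` K)" by (simp only: Suc[symmetric])
  finally show ?case by (intro trans[OF K_eq sym])
qed simp

lemma ex_cell: "x \<in> K \<Longrightarrow> \<exists>w\<in>W n. x \<in> kcell w"
  using K_cells[of n] by auto

lemma cell_cells: "w \<in> W n \<Longrightarrow> kcell w = (\<Union>v\<in>W m. kcell (w @ v))"
proof -
  assume w: "w \<in> W n"
  have "kcell w = word_map F w ` (\<Union>v\<in>W m. kcell v)" using K_cells[of m] by (simp add: cell_def)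
  then show ?thesis by (auto simp: cell_append)
qed

lemma cell_ne: "kcell w \<noteq> {}" using K_ne by (simp add: cell_def)

lemma compact_cell: "w \<in> W n \<Longrightarrow> compact (kcell w)"
proof -
  assume w: "w \<in> W n"
  have "kcell w = (\<lambda>x. \<rho> ^ n *\<^sub>R x + shift w) ` K"
    by (simp add: cell_def word_map_words[OF w])
  then show ?thesis using compact_K
    by (simp only:) (intro compact_continuous_image continuous_intros)
qed

lemma dist_cell: "w \<in> W n \<Longrightarrow> x \<in> kcell w \<Longrightarrow> y \<in> kcell w \<Longrightarrow> dist x y \<le> \<rho> ^ n"
proof -
  assume w: "w \<in> W n" and "x \<in> kcell w" "y \<in> kcell w"
  then obtain a c where "a \<in> K" "c \<in> K" "x = word_map F w a" "y = word_map F w c"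
    by (auto simp: cell_def)
  then show ?thesis using dist_word_map[OF w] dist_K[of a c] rho
    by (simp add: mult_left_le)
qed

lemma adj_refl [simp]: "adj w w" using cell_ne by (simp add: adj_def)
lemma adj_sym: "adj w v \<longleftrightarrow> adj v w" by (auto simp: adj_def)
lemma adjI: "x \<in> kcell w \<Longrightarrow> x \<in> kcell v \<Longrightarrow> adj w v" by (auto simp: adj_def)

lemma adj_append_same: "w \<in> W n \<Longrightarrow> adj (w @ v) (w @ v') \<longleftrightarrow> adj v v'"
  using inj_word_map[of w n] by (auto simp: adj_def cell_append image_Int[symmetric])

lemma infinite_K: "infinite K"
proof
  assume "finite K"
  then have "\<exists>x. K = {x}" using connected_finite_iff_sing[OF conn] K_ne by auto
  then show False using diam by auto
qed

text \<open>With N = 1 the set K would be a copy of itself shrunk by \<rho>, against diameter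
  1.\<close>

lemma N_ge_2: "2 \<le> N"
proof (rule ccontr)
  assume "\<not> 2 \<le> N"
  then consider "N = 0" | "N = 1" by linarith
  then show False
  proof cases
    case 1 then show False using K_ne by (subst (asm) K_eq) simp
  next
    case 2
    obtain x y where xy: "x \<in> K" "y \<in> K" "dist x y = 1"
      using diameter_compact_attained[OF compact_K K_ne] diam by auto
    have "K = kcell (replicate 1 1)" by (subst K_eq) (simp add: 2 cell_def word_map_def)
    then have "dist x y \<le> \<rho> ^ 1" using xy dist_cell[of "replicate 1 1" 1 x y] 2
      by (auto simp: words_def)
    then show False using xy rho by simp
  qed
qed

section \<open>Boundary points and the cells at them\<close>

lemma finite_V0: "finite V0"
proof -
  have "ifs_fixed_points N F \<subseteq> b ` {1..N}"
  proof
    fix x assume "x \<in> ifs_fixed_points N F"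
    then obtain i where i: "i \<in> {1..N}" "F i x = x" by (auto simp: ifs_fixed_points_def)
    then have "\<rho> *\<^sub>R (x - b i) = x - b i" by (metis F_eq add_diff_cancel_right')
    then have "(\<rho> - 1) *\<^sub>R (x - b i) = 0" by (simp add: scaleR_diff_left)
    then have "x = b i" using rho by simp
    then show "x \<in> b ` {1..N}" using i by auto
  qed
  moreover have "V0 \<subseteq> ifs_fixed_points N F" by (auto simp: essential_fixed_points_def)
  ultimately show ?thesis by (meson finite_atLeastAtMost finite_imageI finite_subset)
qed

definition ix :: "'a \<Rightarrow> nat" where "ix x = (SOME i. i \<in> {1..N} \<and> F i x = x)"
text \<open>A constant word on an index whose map fixes x. It is compatible with concatenation, and
  its word map fixes x.\<close>

definition corner :: "nat \<Rightarrow> 'a \<Rightarrow> nat list" where "corner m x = replicate m (ix x)"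

lemma ix: "x \<in> V0 \<Longrightarrow> ix x \<in> {1..N}" "x \<in> V0 \<Longrightarrow> F (ix x) x = x"
proof -
  assume "x \<in> V0"
  then have "\<exists>i. i \<in> {1..N} \<and> F i x = x"
    by (auto simp: essential_fixed_points_def ifs_fixed_points_def)
  then have "ix x \<in> {1..N} \<and> F (ix x) x = x" unfolding ix_def by (rule someI_ex)
  then show "ix x \<in> {1..N}" "F (ix x) x = x" by auto
qed

lemma corner_words: "x \<in> V0 \<Longrightarrow> corner m x \<in> W m"
  using ix(1) by (auto simp: corner_def words_def)

lemma corner_append: "corner (n + m) x = corner n x @ corner m x"
  by (simp add: corner_def replicate_add)

lemma corner_0 [simp]: "corner 0 x = []" by (simp add: corner_def)

lemma word_map_corner: "x \<in> V0 \<Longrightarrow> word_map F (corner m x) x = x"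
  by (induction m) (simp_all add: corner_def word_map_Cons ix)

text \<open>The point x attracts the orbit of any point of K under the map that fixes x, and K is
  closed.\<close>

lemma V0_subset_K: "V0 \<subseteq> K"
proof
  fix x assume x: "x \<in> V0"
  obtain y where y: "y \<in> K" using K_ne by auto
  have lim: "(\<lambda>m. word_map F (corner m x) y) \<longlonglongrightarrow> x"
  proof (rule metric_LIMSEQ_I)
    fix e :: real assume "0 < e"
    have "dist (word_map F (corner m x) y) x = \<rho> ^ m * dist y x" for m
      using dist_word_map[OF corner_words[OF x], of m y x] by (simp add: word_map_corner[OF x])
    moreover have "(\<lambda>m. \<rho> ^ m * dist y x) \<longlonglongrightarrow> 0 * dist y x"
      using rho by (intro tendsto_mult LIMSEQ_power_zero) auto
    ultimately show "\<exists>no. \<forall>n\<ge>no. dist (word_map F (corner n x) y) x < e"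
      using order_tendstoD(2)[of "\<lambda>m. \<rho> ^ m * dist y x" 0 sequentially e] \<open>0 < e\<close>
      by (simp add: eventually_sequentially)
  qed
  have "word_map F (corner m x) y \<in> K" for m
    using cell_subset_K[OF corner_words[OF x], of m] y by (auto simp: cell_def)
  then show "x \<in> K"
    using closed_sequentially[OF compact_imp_closed[OF compact_K] _ lim] by blast
qed

lemma corner_mem: "x \<in> V0 \<Longrightarrow> x \<in> kcell (corner m x)"
  using V0_subset_K word_map_corner[of x m] by (force simp: cell_def)

text \<open>A shared vertex of two cells is also shared by their subcells at that vertex, at every
  depth.\<close>

lemma corner_adj: assumes "x \<in> V0" "y \<in> V0" "word_map F w x = word_map F v y"
  shows "adj (w @ corner m x) (v @ corner m y)"
proof (rule adjI)
  show "word_map F w x \<in> kcell (w @ corner m x)"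
    using corner_mem[OF assms(1)] by (auto simp: cell_append)
  show "word_map F w x \<in> kcell (v @ corner m y)"
    using corner_mem[OF assms(2)] assms(3) by (auto simp: cell_append)
qed

lemma cell_Int: assumes "w \<in> W n" "v \<in> W n" "w \<noteq> v"
  shows "kcell w \<inter> kcell v = word_map F w ` V0 \<inter> word_map F v ` V0"
proof -
  \<comment> \<open>Level 0 has only the empty word, so two distinct words force a level covered by
    the nesting axiom.\<close>
  have "n \<ge> 1" using assms by (cases n) auto
  then show ?thesis using nesting assms unfolding nf_nesting_def by blast
qed

lemma finite_cell_Int: "w \<in> W n \<Longrightarrow> v \<in> W n \<Longrightarrow> w \<noteq> v \<Longrightarrow> finite (kcell w \<inter> kcell v)"
  using finite_V0 by (simp add: cell_Int)

lemma infinite_cell: "w \<in> W n \<Longrightarrow> infinite (kcell w)"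
  using infinite_K inj_word_map[of w n] unfolding cell_def
  by (meson finite_imageD inj_on_subset subset_UNIV)

text \<open>Distinct cells of one level meet in a finite set, but every cell is infinite.\<close>

lemma cell_inject: "w \<in> W n \<Longrightarrow> v \<in> W n \<Longrightarrow> kcell w = kcell v \<longleftrightarrow> w = v"
  using finite_cell_Int infinite_cell by fastforce

lemma adj_vertices: assumes "w \<in> W n" "v \<in> W n" "w \<noteq> v" "adj w v"
  obtains x y where "x \<in> V0" "y \<in> V0" "word_map F w x = word_map F v y"
proof -
  obtain z where "z \<in> word_map F w ` V0 \<inter> word_map F v ` V0"
    using assms(4) unfolding adj_def cell_Int[OF assms(1-3)] by auto
  then show ?thesis using that by auto
qed

text \<open>A chain of meeting 1-cells from index 1 to index 2 changes its index somewhere; by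
  nesting, the common point there is an image of an element of \<open>V0\<close>.\<close>

lemma V0_ne: "V0 \<noteq> {}"
proof -
  obtain n a where a: "a (0::nat) = (1::nat)" "a n = 2" "\<forall>k\<le>n. a k \<in> {1..N}"
      "\<forall>k<n. F (a k) ` K \<inter> F (a (Suc k)) ` K \<noteq> {}"
  proof -
    have "1 \<in> {1..N}" "2 \<in> {1..N}" using N_ge_2 by auto
    then show thesis using chains that unfolding nf_connectivity_def by blast
  qed
  have "\<exists>k<n. a k \<noteq> a (Suc k)"
  proof (rule ccontr)
    assume c: "\<not> ?thesis"
    have "k \<le> n \<Longrightarrow> a k = 1" for k using a(1) c by (induction k) auto
    then show False using a(2) by force
  qed
  then obtain k where k: "k < n" "a k \<noteq> a (Suc k)" by auto
  have "adj [a k] [a (Suc k)]" using a(4) k by (simp add: adj_def cell_def word_map_def)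
  moreover have "[a k] \<in> W 1" "[a (Suc k)] \<in> W 1" using a(3) k by (auto simp: words_def Suc_le_eq)
  ultimately show ?thesis using adj_vertices[of "[a k]" 1 "[a (Suc k)]"] k(2)
    by (metis empty_iff list.inject)
qed

text \<open>Essentiality is witnessed by a pair with F_i x = F_j y. This condition is symmetric in
  the pair, so the partner is essential as well.\<close>

lemma V0_other: assumes "x \<in> V0" shows "\<exists>y\<in>V0. y \<noteq> x"
proof -
  obtain y i j where y: "y \<in> ifs_fixed_points N F" "y \<noteq> x" and ij: "i \<in> {1..N}" "j \<in> {1..N}"
      "F i x = F j y" and x: "x \<in> ifs_fixed_points N F"
    using assms by (auto simp: essential_fixed_points_def)
  then have "y \<in> V0" unfolding essential_fixed_points_def
    by (intro CollectI conjI y bexI[of _ x] bexI[of _ j] bexI[of _ i]) auto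
  then show ?thesis using y by blast
qed

end

section \<open>Reflections and the geometry of cells\<close>

lemma bisector_reflection_swap: "bisector_reflection x y x = y" "bisector_reflection x y y = x"
proof -
  have "x - midpoint x y = (-1/2) *\<^sub>R (y - x)" "y - midpoint x y = (1/2) *\<^sub>R (y - x)"
    by (simp_all add: midpoint_def algebra_simps flip: scaleR_left_distrib)
  then have *: "(x - midpoint x y) \<bullet> (y - x) = (-1/2) * ((y - x) \<bullet> (y - x))"
    "(y - midpoint x y) \<bullet> (y - x) = (1/2) * ((y - x) \<bullet> (y - x))"
    by simp_all
  show "bisector_reflection x y x = y" "bisector_reflection x y y = x"
    unfolding bisector_reflection_def * by (cases "x = y"; simp)+
qed

text \<open>Affinity in the form needed below: the reflection composed with a homothety of ratio r
  is a homothety of the same ratio composed with the reflection.\<close>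

lemma bisector_reflection_add:
  "bisector_reflection x y (r *\<^sub>R z + t)
     = r *\<^sub>R bisector_reflection x y z + (bisector_reflection x y t - r *\<^sub>R bisector_reflection x y 0)"
proof -
  have "(r *\<^sub>R z + t - midpoint x y) \<bullet> (y - x) = r * ((z - midpoint x y) \<bullet> (y - x))
      + ((t - midpoint x y) \<bullet> (y - x)) - r * ((0 - midpoint x y) \<bullet> (y - x))"
    by (simp add: algebra_simps inner_simps)
  then show ?thesis
    unfolding bisector_reflection_def by (simp add: algebra_simps add_divide_distrib diff_divide_distrib)
qed

lemma dist_bisector_reflection:
  "dist (bisector_reflection x y z) (bisector_reflection x y w) = dist z w"
proof (cases "x = y")
  case True then show ?thesis by (simp add: bisector_reflection_def)
next
  case False
  define d where "d = y - x"
  have d: "d \<bullet> d \<noteq> 0" using False by (simp add: d_def)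
  define k where "k = 2 * ((z - w) \<bullet> d) / (d \<bullet> d)"
  have "bisector_reflection x y z - bisector_reflection x y w = (z - w) - k *\<^sub>R d"
  proof -
    have "(z - w) \<bullet> d = (z - midpoint x y) \<bullet> d - (w - midpoint x y) \<bullet> d"
      by (simp add: inner_diff_left)
    then have "k = 2 * ((z - midpoint x y) \<bullet> d) / (d \<bullet> d) - 2 * ((w - midpoint x y) \<bullet> d) / (d \<bullet> d)"
      by (simp add: k_def diff_divide_distrib)
    then show ?thesis
      unfolding bisector_reflection_def d_def[symmetric] by (simp add: scaleR_diff_left)
  qed
  moreover have "((z - w) - k *\<^sub>R d) \<bullet> ((z - w) - k *\<^sub>R d) = (z - w) \<bullet> (z - w)"
  proof -
    have "((z - w) - k *\<^sub>R d) \<bullet> ((z - w) - k *\<^sub>R d)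
        = (z - w) \<bullet> (z - w) - 2 * k * ((z - w) \<bullet> d) + k * (k * (d \<bullet> d))"
      by (simp add: inner_diff_left inner_diff_right inner_commute algebra_simps)
    also have "k * (d \<bullet> d) = 2 * ((z - w) \<bullet> d)" using d by (simp add: k_def)
    finally show ?thesis by simp
  qed
  ultimately show ?thesis by (simp add: dist_norm norm_eq_sqrt_inner)
qed

lemma dist_bisector_diff:
  "(dist z y)\<^sup>2 - (dist z x)\<^sup>2 = - 2 * ((z - midpoint x y) \<bullet> (y - x))"
proof -
  have "(z - midpoint x y) \<bullet> (y - x) = z \<bullet> (y - x) - (1/2) * ((x + y) \<bullet> (y - x))"
    by (simp add: midpoint_def inner_diff_left)
  then show ?thesis
    by (simp add: dist_norm power2_norm_eq_inner inner_simps inner_commute algebra_simps)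
qed

lemma bisector_reflection_eq_self: "dist z x = dist z y \<Longrightarrow> bisector_reflection x y z = z"
  using dist_bisector_diff[of z y x] by (simp add: bisector_reflection_def)

lemma bisector_reflection_inverse:
  "bisector_reflection x y (bisector_reflection x y z) = z"
proof (cases "x = y")
  case True then show ?thesis by (simp add: bisector_reflection_def)
next
  case False
  define d where "d = y - x"
  have d: "d \<bullet> d \<noteq> 0" using False by (simp add: d_def)
  define k where "k = ((z - midpoint x y) \<bullet> d) / (d \<bullet> d)"
  have R: "bisector_reflection x y z = z - (2 * k) *\<^sub>R d"
    by (simp add: bisector_reflection_def k_def d_def)
  have "(z - (2 * k) *\<^sub>R d - midpoint x y) \<bullet> d = (z - midpoint x y) \<bullet> d - 2 * (k * (d \<bullet> d))"
    by (simp add: inner_simps algebra_simps)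
  also have "\<dots> = - (k * (d \<bullet> d))" using d by (simp add: k_def)
  finally have "bisector_reflection x y (z - (2 * k) *\<^sub>R d) = (z - (2 * k) *\<^sub>R d) - (- 2 * k) *\<^sub>R d"
    using d by (simp add: bisector_reflection_def flip: d_def)
  then show ?thesis by (simp add: R flip: scaleR_left_distrib)
qed

text \<open>Ptolemy's theorem for the isosceles trapezoid \<open>x, z, bisector_reflection x y z, y\<close>.\<close>
lemma bisector_reflection_ptolemy:
  assumes "dist z x \<le> dist z y"
  shows "(dist z y)\<^sup>2 - (dist z x)\<^sup>2 = dist z (bisector_reflection x y z) * dist x y"
proof (cases "x = y")
  case False
  define d where "d = y - x"
  have d: "norm d \<noteq> 0" using False by (simp add: d_def)
  define s where "s = (z - midpoint x y) \<bullet> d"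
  have s: "(dist z y)\<^sup>2 - (dist z x)\<^sup>2 = - 2 * s" using dist_bisector_diff[of z y x] by (simp add: s_def d_def)
  moreover have "(dist z x)\<^sup>2 \<le> (dist z y)\<^sup>2" using assms by (intro power_mono) auto
  ultimately have "s \<le> 0" by linarith
  have "dist z (bisector_reflection x y z) = norm ((2 * s / (d \<bullet> d)) *\<^sub>R d)"
    by (simp add: bisector_reflection_def dist_norm s_def d_def)
  also have "\<dots> = \<bar>2 * s\<bar> / (norm d)\<^sup>2 * norm d" by (simp add: power2_norm_eq_inner)
  also have "\<dots> = - 2 * s / norm d" using d \<open>s \<le> 0\<close> by (simp add: power2_eq_square)
  finally have "dist z (bisector_reflection x y z) * norm d = - 2 * s" using d by simp
  moreover have "dist x y = norm d" by (simp add: d_def dist_norm norm_minus_commute)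
  ultimately show ?thesis using s by simp
qed simp

text \<open>A maximiser over A of the inner product with c would be beaten by its own translate
  unless c = 0.\<close>

lemma bounded_translate_self:
  fixes A :: "'a::euclidean_space set"
  assumes "compact A" "A \<noteq> {}" "(\<lambda>x. x + c) ` A \<subseteq> A"
  shows "c = 0"
proof -
  have "continuous_on A (\<lambda>x. x \<bullet> c)" by (intro continuous_intros)
  then obtain x where x: "x \<in> A" "\<And>y. y \<in> A \<Longrightarrow> y \<bullet> c \<le> x \<bullet> c"
    using continuous_attains_sup[OF assms(1,2)] by blast
  then have "(x + c) \<bullet> c \<le> x \<bullet> c" using assms(3) by blast
  then have "c \<bullet> c \<le> 0" by (simp add: inner_add_left)
  then show ?thesis by (metis inner_ge_zero inner_eq_zero_iff order_antisym)
qed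

lemma finite_pos_choice:
  assumes "finite S" "\<And>s. s \<in> S \<Longrightarrow> \<exists>c>0. P s c" "\<And>s c c'. P s c \<Longrightarrow> 0 < c' \<Longrightarrow> c' \<le> (c::real) \<Longrightarrow> P s c'"
  shows "\<exists>c>0. \<forall>s\<in>S. P s c"
  using assms(1,2)
proof (induction S rule: finite_induct)
  case empty show ?case by (intro exI[of _ 1]) simp
next
  case (insert s S)
  obtain c where c: "c > 0" "\<forall>s\<in>S. P s c" using insert by auto
  obtain c' where c': "c' > 0" "P s c'" using insert.prems by auto
  show ?case
    using c c' assms(3) by (intro exI[of _ "min c c'"]) (auto intro: assms(3)[of _ _ "min c c'"])
qed

context connected_nested_fractal
begin

section \<open>Action of the reflections on words and on the boundary points\<close>

abbreviation U :: "'a \<Rightarrow> 'a \<Rightarrow> 'a \<Rightarrow> 'a" where "U \<equiv> bisector_reflection"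

text \<open>The choice is unique because cells of one level determine their words
  (\<open>cell_inject\<close>). For distinct x, y in \<open>V0\<close> it is an involution of
  \<open>W n\<close> that preserves \<open>adj\<close>.\<close>

definition rword :: "'a \<Rightarrow> 'a \<Rightarrow> nat list \<Rightarrow> nat list" where
  "rword x y w = (SOME v. v \<in> W (length w) \<and> kcell v = U x y ` kcell w)"

lemma U_image_U: "U x y ` U x y ` A = A"
  by (simp add: image_image bisector_reflection_inverse)

lemma inj_U: "inj (U x y)"
  by (metis bisector_reflection_inverse injI)

lemma U_K_subset:
  assumes "x \<in> V0" "y \<in> V0" "x \<noteq> y"
  shows "U x y ` K \<subseteq> K"
proof
  fix z assume "z \<in> U x y ` K"
  then obtain z' where z': "z' \<in> K" "z = U x y z'" by auto
  then obtain w where w: "w \<in> W 1" "z \<in> U x y ` kcell w" using ex_cell[of z' 1] by blast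
  then obtain v where "v \<in> W 1" "U x y ` kcell w = kcell v"
    using symmetry assms unfolding nf_symmetry_def by blast
  then show "z \<in> K" using w cell_subset_K by blast
qed

lemma U_K: assumes "x \<in> V0" "y \<in> V0" "x \<noteq> y" shows "U x y ` K = K"
proof (rule antisym[OF U_K_subset[OF assms]])
  have "U x y ` U x y ` K \<subseteq> U x y ` K" by (intro image_mono U_K_subset assms)
  then show "K \<subseteq> U x y ` K" by (simp only: U_image_U)
qed

lemma rword:
  assumes "x \<in> V0" "y \<in> V0" "x \<noteq> y" "w \<in> W n"
  shows "rword x y w \<in> W n" "kcell (rword x y w) = U x y ` kcell w"
proof -
  have "\<exists>v. v \<in> W n \<and> kcell v = U x y ` kcell w"
  proof (cases "n = 0")
    \<comment> \<open>The symmetry axiom speaks of levels n \<ge> 1 only; at level 0 the invariance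
      of K is used, which was derived from level 1.\<close>
    case True then show ?thesis using assms U_K by simp
  next
    case False
    then have "1 \<le> n" by simp
    then obtain v where "v \<in> words N n" "U x y ` cell F K w = cell F K v"
      using symmetry assms unfolding nf_symmetry_def by blast
    then show ?thesis by metis
  qed
  then have "rword x y w \<in> W n \<and> kcell (rword x y w) = U x y ` kcell w"
    unfolding rword_def words_length[OF assms(4)] by (rule someI_ex)
  then show "rword x y w \<in> W n" "kcell (rword x y w) = U x y ` kcell w" by auto
qed

lemma rword_rword:
  assumes "x \<in> V0" "y \<in> V0" "x \<noteq> y" "w \<in> W n"
  shows "rword x y (rword x y w) = w"
proof -
  have w: "rword x y w \<in> W n" "rword x y (rword x y w) \<in> W n"
    using rword(1)[OF assms(1-3)] assms(4) by auto
  have "kcell (rword x y (rword x y w)) = U x y ` U x y ` kcell w"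
    by (simp only: rword(2)[OF assms(1-3) w(1)] rword(2)[OF assms])
  then show ?thesis using cell_inject[OF w(2) assms(4)] by (simp only: U_image_U)
qed

lemma rword_adj:
  assumes "x \<in> V0" "y \<in> V0" "x \<noteq> y" "w \<in> W n" "v \<in> W n"
  shows "adj (rword x y w) (rword x y v) \<longleftrightarrow> adj w v"
  by (simp only: adj_def rword(2)[OF assms(1-4)] rword(2)[OF assms(1-3,5)]
      image_Int[OF inj_U, symmetric] image_is_empty)

lemma rword_straddle:
  assumes "x \<in> V0" "y \<in> V0" "x \<noteq> y" "w \<in> W n" "meets_both_sides x y (kcell w)"
  shows "rword x y w = w"
proof (cases "n = 0")
  case True then show ?thesis using rword[OF assms(1-4)] assms(4) by simp
next
  case False
  then have "1 \<le> n" by simp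
  then have "U x y ` kcell w = kcell w"
    using symmetry assms unfolding nf_symmetry_def by blast
  then show ?thesis using rword[OF assms(1-4)] cell_inject[OF rword(1)[OF assms(1-4)] assms(4)] by simp
qed

text \<open>
  \<open>U x y\<close> and the map it induces on the cells have the same linear part, so they can differ
  only by a translation of the compact set \<open>K\<close> into itself.
\<close>
lemma U_word_map:
  assumes "x \<in> V0" "y \<in> V0" "x \<noteq> y" "w \<in> W n"
  shows "U x y (word_map F w z) = word_map F (rword x y w) (U x y z)"
proof -
  let ?v = "rword x y w"
  define c where "c = U x y (shift w) - \<rho> ^ n *\<^sub>R U x y 0 - shift ?v"
  have eq: "U x y (word_map F w z) = word_map F ?v (U x y z) + c" for z
    unfolding word_map_words[OF assms(4)] word_map_words[OF rword(1)[OF assms]]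
      bisector_reflection_add[of x y "\<rho> ^ n" z "shift w"]
    by (simp add: c_def)
  have "(\<lambda>a. a + c) ` kcell ?v = (\<lambda>z. word_map F ?v z + c) ` U x y ` K"
    by (simp add: cell_def U_K[OF assms(1-3)] image_image)
  also have "\<dots> = U x y ` kcell w" by (simp add: cell_def image_image eq)
  also have "\<dots> = kcell ?v" using rword(2)[OF assms] by simp
  finally have "c = 0"
    using bounded_translate_self[OF compact_cell[OF rword(1)[OF assms]] cell_ne] by blast
  then show ?thesis using eq by simp
qed

text \<open>Reflect the coincidence F_i z = F_j t that makes z essential. The two reflected 1-cells
  are still distinct and share the reflected point, so nesting places that point in the image of
  \<open>V0\<close>, and injectivity of the word map gives U x y z itself.\<close>

lemma U_V0:
  assumes "x \<in> V0" "y \<in> V0" "x \<noteq> y" "z \<in> V0"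
  shows "U x y z \<in> V0"
proof -
  obtain t i j where t: "t \<in> ifs_fixed_points N F" "t \<noteq> z" and ij: "i \<in> {1..N}" "j \<in> {1..N}"
      "F i z = F j t" and z: "z \<in> ifs_fixed_points N F"
    using assms(4) by (auto simp: essential_fixed_points_def)
  have tV: "t \<in> V0" unfolding essential_fixed_points_def
    using t ij z by (intro CollectI conjI t bexI[of _ z] bexI[of _ j] bexI[of _ i]) auto
  have w: "[i] \<in> W 1" "[j] \<in> W 1" using ij by (auto simp: words_def)
  have eq: "word_map F [i] z = word_map F [j] t" using ij by (simp add: word_map_def)
  have "i \<noteq> j" using eq word_map_inject[OF w(1)] t(2) by auto
  let ?w = "rword x y [i]" and ?v = "rword x y [j]"
  have w': "?w \<in> W 1" "?v \<in> W 1" using rword(1)[OF assms(1-3)] w by auto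
  have ne: "?w \<noteq> ?v" using rword_rword[OF assms(1-3)] w \<open>i \<noteq> j\<close> by (metis list.inject)
  have "word_map F ?w (U x y z) = word_map F ?v (U x y t)"
    using U_word_map[OF assms(1-3)] w eq by metis
  moreover have "U x y z \<in> K" "U x y t \<in> K"
    using U_K[OF assms(1-3)] V0_subset_K tV assms(4) by blast+
  ultimately have "word_map F ?w (U x y z) \<in> kcell ?w \<inter> kcell ?v"
    unfolding cell_def by (metis IntI imageI)
  then have "word_map F ?w (U x y z) \<in> word_map F ?w ` V0"
    using cell_Int[OF w' ne] by blast
  then show ?thesis using word_map_inject[OF w'(1)] by auto
qed

section \<open>Shortest edges between boundary points\<close>

definition vgap :: real where
  "vgap = Min ((\<lambda>(x, y). dist x y) ` {(x, y). x \<in> V0 \<and> y \<in> V0 \<and> x \<noteq> y})"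

lemma finite_V0_pairs: "finite {(x, y). x \<in> V0 \<and> y \<in> V0 \<and> P x y}"
  by (rule finite_subset[of _ "V0 \<times> V0"]) (auto simp: finite_V0)

lemma vgap_le: "x \<in> V0 \<Longrightarrow> y \<in> V0 \<Longrightarrow> x \<noteq> y \<Longrightarrow> vgap \<le> dist x y"
  unfolding vgap_def using finite_V0_pairs by (intro Min_le finite_imageI) auto

lemma vgap_attained: obtains x y where "x \<in> V0" "y \<in> V0" "x \<noteq> y" "dist x y = vgap"
proof -
  have "vgap \<in> (\<lambda>(x, y). dist x y) ` {(x, y). x \<in> V0 \<and> y \<in> V0 \<and> x \<noteq> y}"
    unfolding vgap_def using finite_V0_pairs V0_ne V0_other
    by (intro Min_in finite_imageI) fast+
  then show ?thesis using that by auto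
qed

lemma vgap_pos: "0 < vgap"
proof -
  obtain x y where "x \<in> V0" "y \<in> V0" "x \<noteq> y" "dist x y = vgap" by (rule vgap_attained)
  then show ?thesis using zero_less_dist_iff[of x y] by simp
qed

definition short_edges :: "('a \<times> 'a) set" where
  "short_edges = {(x, y). x \<in> V0 \<and> y \<in> V0 \<and> dist x y = vgap}"

lemma short_edge_U:
  "x \<in> V0 \<Longrightarrow> y \<in> V0 \<Longrightarrow> x \<noteq> y \<Longrightarrow> (a, c) \<in> short_edges \<Longrightarrow> (U x y a, U x y c) \<in> short_edges"
  by (auto simp: short_edges_def dist_bisector_reflection U_V0)

text \<open>The reflection exchanging a and x carries a shortest edge at a to one at x.\<close>

lemma ex_short_edge: assumes "x \<in> V0" shows "\<exists>y. (x, y) \<in> short_edges"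
proof -
  obtain a c where ac: "a \<in> V0" "c \<in> V0" "a \<noteq> c" "dist a c = vgap" by (rule vgap_attained)
  then have e: "(a, c) \<in> short_edges" by (simp add: short_edges_def)
  show ?thesis
  proof (cases "x = a")
    case False
    then show ?thesis using short_edge_U[OF ac(1) assms _ e] by (auto simp: bisector_reflection_swap)
  qed (use e in auto)
qed

text \<open>Take a disconnected pair (a, z) at minimal distance m and a shortest edge (a, a').
  Reflecting this edge in the bisector of a' and z gives a shortest edge ending at z, whose other
  end is the image of a. Hence a and its image are disconnected, and so are a' and z, and both
  distances are at least m. By Ptolemy their product is m^2 - \<open>vgap\<close>^2, a
  contradiction.\<close>

lemma short_edges_connected:
  assumes "x \<in> V0" "y \<in> V0" shows "(x, y) \<in> short_edges\<^sup>*"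
proof (rule ccontr)
  assume c: "(x, y) \<notin> short_edges\<^sup>*"
  define S where "S = {(x, y). x \<in> V0 \<and> y \<in> V0 \<and> (x, y) \<notin> short_edges\<^sup>*}"
  define m where "m = Min ((\<lambda>(x, y). dist x y) ` S)"
  have S: "finite S" "S \<noteq> {}" using finite_V0_pairs c assms by (auto simp: S_def)
  have m_le: "m \<le> dist p q" if "p \<in> V0" "q \<in> V0" "(p, q) \<notin> short_edges\<^sup>*" for p q
  proof -
    have "(p, q) \<in> S" using that by (simp add: S_def)
    then have "(\<lambda>(x, y). dist x y) (p, q) \<in> (\<lambda>(x, y). dist x y) ` S" by (rule imageI)
    then show ?thesis unfolding m_def using S by (intro Min_le) auto
  qed
  have "m \<in> (\<lambda>(x, y). dist x y) ` S" unfolding m_def using S by (intro Min_in) auto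
  then obtain a z where az: "a \<in> V0" "z \<in> V0" "(a, z) \<notin> short_edges\<^sup>*" "dist a z = m"
    by (auto simp: S_def)
  obtain a' where a': "(a, a') \<in> short_edges" using ex_short_edge az by blast
  then have a'V: "a' \<in> V0" "dist a a' = vgap" by (auto simp: short_edges_def)
  have n1: "(a', z) \<notin> short_edges\<^sup>*" using a' az by (meson converse_rtrancl_into_rtrancl)
  then have "a' \<noteq> z" by auto
  let ?a = "U a' z a"
  have "(?a, z) \<in> short_edges"
    using short_edge_U[OF a'V(1) az(2) \<open>a' \<noteq> z\<close> a'] by (simp add: bisector_reflection_swap)
  then have "(a, ?a) \<notin> short_edges\<^sup>*" using az by (meson rtrancl.rtrancl_into_rtrancl)
  then have m1: "m \<le> dist a ?a" using m_le az U_V0[OF a'V(1) az(2) \<open>a' \<noteq> z\<close>] by blast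
  have m2: "m \<le> dist a' z" using m_le a'V az n1 by blast
  have "a \<noteq> z" using az by auto
  then have le: "dist a a' \<le> dist a z" using vgap_le az a'V by auto
  have "m * m \<le> dist a ?a * dist a' z" using m1 m2 az(4) by (intro mult_mono) auto
  also have "\<dots> = m\<^sup>2 - vgap\<^sup>2"
    using bisector_reflection_ptolemy[OF le] a'V(2) az(4) by simp
  finally show False using vgap_pos by (simp add: power2_eq_square mult_less_0_iff mult_le_0_iff)
qed

section \<open>Bounded overlap and separation of cells\<close>

lemma ex_shift_gap:
  "\<exists>e>0. \<forall>n. \<forall>w\<in>W n. \<forall>v\<in>W n. w \<noteq> v \<longrightarrow> e * \<rho> ^ n \<le> dist (shift w) (shift v)"
proof -
  obtain V where "open V \<and> V \<noteq> {} \<and> (\<forall>i\<in>{1..N}. F i ` V \<subseteq> V) \<and>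
      (\<forall>i\<in>{1..N}. \<forall>j\<in>{1..N}. i \<noteq> j \<longrightarrow> F i ` V \<inter> F j ` V = {})"
    using osc unfolding open_set_condition_def by (rule exE)
  then have V: "open V" "V \<noteq> {}" "\<And>i. i \<in> {1..N} \<Longrightarrow> F i ` V \<subseteq> V"
      "\<And>i j. i \<in> {1..N} \<Longrightarrow> j \<in> {1..N} \<Longrightarrow> i \<noteq> j \<Longrightarrow> F i ` V \<inter> F j ` V = {}"
    by simp_all
  have sub: "word_map F w ` V \<subseteq> V" if "set w \<subseteq> {1..N}" for w
    using that
  proof (induction w)
    case (Cons i w)
    have "word_map F (i # w) ` V = F i ` word_map F w ` V" by (auto simp: word_map_Cons)
    also have "\<dots> \<subseteq> F i ` V" using Cons by (intro image_mono) simp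
    also have "\<dots> \<subseteq> V" using V(3)[of i] Cons.prems by simp
    finally show ?case .
  qed simp
  \<comment> \<open>Different first letters are separated by the open set condition itself, equal
    ones by injectivity of F_i and induction.\<close>
  have disj: "word_map F w ` V \<inter> word_map F v ` V = {}"
    if "w \<in> W n" "v \<in> W n" "w \<noteq> v" for n w v
    using that
  proof (induction n arbitrary: w v)
    case (Suc n)
    obtain i w' where w: "w = i # w'" "w' \<in> W n" "i \<in> {1..N}"
      using Suc.prems(1) by (cases w) (auto simp: words_def)
    obtain j v' where v: "v = j # v'" "v' \<in> W n" "j \<in> {1..N}"
      using Suc.prems(2) by (cases v) (auto simp: words_def)
    have im: "word_map F w ` V = F i ` word_map F w' ` V" "word_map F v ` V = F j ` word_map F v' ` V"
      by (auto simp: w v word_map_Cons image_image)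
    show ?case
    proof (cases "i = j")
      case True
      have "inj (F i)" using inj_word_map[of "[i]" 1] w(3) by (simp add: words_def word_map_def)
      then show ?thesis
        using Suc.IH[OF w(2) v(2)] Suc.prems(3) True w v im by (simp add: image_Int[symmetric])
    next
      case False
      have "word_map F w' ` V \<subseteq> V" "word_map F v' ` V \<subseteq> V"
        using sub words_set[OF w(2)] words_set[OF v(2)] by auto
      then have "F i ` word_map F w' ` V \<subseteq> F i ` V" "F j ` word_map F v' ` V \<subseteq> F j ` V"
        by (simp_all only: image_mono)
      then show ?thesis using V(4)[OF w(3) v(3) False] unfolding im by blast
    qed
  qed simp
  obtain z where z: "z \<in> V" using V(2) by blast
  obtain e where ze: "e > 0" "ball z e \<subseteq> V" using openE[OF V(1) z] .
  show ?thesis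
  proof (intro exI[of _ e] conjI allI ballI impI)
    fix n w v assume wv: "w \<in> W n" "v \<in> W n" "w \<noteq> v"
    show "e * \<rho> ^ n \<le> dist (shift w) (shift v)"
    proof (rule ccontr)
      assume c: "\<not> ?thesis"
      \<comment> \<open>If the shifts were closer than e * \<rho>^n, this point would lie in the
        ball about z inside V, and F_w q = F_v z would contradict the disjointness of the two images
        of V.\<close>
      define q where "q = z + (1 / \<rho> ^ n) *\<^sub>R (shift v - shift w)"
      have r: "\<rho> ^ n > 0" using rho by simp
      have "dist z q = dist (shift w) (shift v) / \<rho> ^ n"
        using r by (simp add: q_def dist_norm norm_minus_commute)
      also have "\<dots> < e" using c r by (simp add: divide_less_eq)
      finally have "q \<in> V" using ze by (auto simp: subset_iff)
      moreover have "word_map F w q = word_map F v z"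
        using rho by (simp add: word_map_words[OF wv(1)] word_map_words[OF wv(2)] q_def scaleR_add_right)
      ultimately show False using disj[OF wv] z by (metis disjoint_iff imageI)
    qed
  qed (use ze in auto)
qed

text \<open>Blown up by \<rho>^-n about x, base points of these cells lie in a fixed ball and are
  separated by e. So each ball of radius e / 2 in a fixed finite cover contains at most one of
  them.\<close>

lemma ex_multiplicity:
  "\<exists>M::nat. \<forall>n x. card {w \<in> W n. \<exists>y\<in>kcell w. dist x y \<le> A * \<rho> ^ n} \<le> M"
proof -
  obtain e where "e > 0 \<and>
      (\<forall>n. \<forall>w\<in>W n. \<forall>v\<in>W n. w \<noteq> v \<longrightarrow> e * \<rho> ^ n \<le> dist (shift w) (shift v))"
    using ex_shift_gap by (rule exE)
  then have e: "e > 0"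
      "\<And>n w v. w \<in> W n \<Longrightarrow> v \<in> W n \<Longrightarrow> w \<noteq> v \<Longrightarrow> e * \<rho> ^ n \<le> dist (shift w) (shift v)"
    by simp_all
  obtain T where T: "finite T" "cball (0::'a) (A + 1) \<subseteq> (\<Union>t\<in>T. ball t (e / 2))"
  proof -
    have "cball (0::'a) (A + 1) \<subseteq> \<Union> ((\<lambda>t. ball t (e / 2)) ` UNIV)"
      using e(1) by (intro subsetI, rule_tac a = x in UN_I) simp_all
    then obtain T where "finite T" "cball (0::'a) (A + 1) \<subseteq> \<Union> ((\<lambda>t. ball t (e / 2)) ` T)"
      by (rule compactE_image[OF compact_cball, rotated]) auto
    then show ?thesis using that by blast
  qed
  obtain k0 where k0: "k0 \<in> K" using K_ne by auto
  have "card {w \<in> W n. \<exists>y\<in>kcell w. dist x y \<le> A * \<rho> ^ n} \<le> card T" (is "card ?S \<le> _") for n x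
  proof -
    have r: "\<rho> ^ n > 0" using rho by simp
    define g where "g w = (1 / \<rho> ^ n) *\<^sub>R (word_map F w k0 - x)" for w
    have "\<exists>t\<in>T. g w \<in> ball t (e / 2)" if w: "w \<in> ?S" for w
    proof -
      obtain y where y: "y \<in> kcell w" "dist x y \<le> A * \<rho> ^ n" and wW: "w \<in> W n" using w by auto
      have "dist (word_map F w k0) y \<le> \<rho> ^ n" using dist_cell[OF wW _ y(1)] k0 by (simp add: cell_def)
      then have "dist (word_map F w k0) x \<le> (A + 1) * \<rho> ^ n"
        using y(2) dist_triangle2[of "word_map F w k0" x y] by (simp add: algebra_simps)
      then have "dist (word_map F w k0) x / \<rho> ^ n \<le> A + 1" using r by (simp add: divide_le_eq)
      then have "norm (g w) \<le> A + 1" using r by (simp add: g_def dist_norm)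
      then have "g w \<in> cball 0 (A + 1)" by simp
      then show ?thesis using T(2) by blast
    qed
    then have "\<forall>w\<in>?S. \<exists>t. t \<in> T \<and> g w \<in> ball t (e / 2)" by blast
    then obtain t where "\<forall>w\<in>?S. t w \<in> T \<and> g w \<in> ball (t w) (e / 2)" by (rule bchoice[THEN exE])
    then have t: "\<And>w. w \<in> ?S \<Longrightarrow> t w \<in> T" "\<And>w. w \<in> ?S \<Longrightarrow> g w \<in> ball (t w) (e / 2)"
      by simp_all
    have "inj_on t ?S"
    proof (rule inj_onI, rule ccontr)
      fix w v assume wv: "w \<in> ?S" "v \<in> ?S" "t w = t v" "w \<noteq> v"
      have "dist (g w) (g v) < e"
        using t(2)[OF wv(1)] t(2)[OF wv(2)] wv(3) dist_triangle_half_r[of "t w" "g w" e "g v"]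
        by (simp add: dist_commute)
      moreover have "g w - g v = (1 / \<rho> ^ n) *\<^sub>R (shift w - shift v)"
        using wv by (auto simp: g_def word_map_words simp flip: scaleR_diff_right)
      ultimately have "dist (shift w) (shift v) / \<rho> ^ n < e" using r by (simp add: dist_norm)
      then have "dist (shift w) (shift v) < e * \<rho> ^ n" using r by (simp add: divide_less_eq)
      then show False using e(2)[of w n v] wv by auto
    qed
    then show ?thesis using t(1) T(1) by (intro card_inj_on_le[of t]) auto
  qed
  then show ?thesis by blast
qed

definition mult :: nat where
  "mult = (SOME M. M \<ge> 1 \<and> (\<forall>n. \<forall>w\<in>W n. card {v \<in> W n. adj w v} \<le> M))"

lemma mult: "1 \<le> mult" "w \<in> W n \<Longrightarrow> card {v \<in> W n. adj w v} \<le> mult"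
proof -
  obtain M where M: "\<And>n x. card {w \<in> W n. \<exists>y\<in>kcell w. dist x y \<le> 1 * \<rho> ^ n} \<le> M"
    using ex_multiplicity[of 1] by blast
  have "card {v \<in> W n. adj w v} \<le> max M 1" if w: "w \<in> W n" for n w
  proof -
    obtain x where x: "x \<in> kcell w" using cell_ne by blast
    have "{v \<in> W n. adj w v} \<subseteq> {w \<in> W n. \<exists>y\<in>kcell w. dist x y \<le> 1 * \<rho> ^ n}"
      using dist_cell[OF w x] by (fastforce simp: adj_def)
    then have "card {v \<in> W n. adj w v} \<le> card {w \<in> W n. \<exists>y\<in>kcell w. dist x y \<le> 1 * \<rho> ^ n}"
      by (intro card_mono) (auto simp: finite_words)
    then show ?thesis using M[of n x] by linarith
  qed
  then have "\<exists>M. M \<ge> 1 \<and> (\<forall>n. \<forall>w\<in>W n. card {v \<in> W n. adj w v} \<le> M)"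
    by (intro exI[of _ "max M 1"]) auto
  then have *: "mult \<ge> 1 \<and> (\<forall>n. \<forall>w\<in>W n. card {v \<in> W n. adj w v} \<le> mult)"
    unfolding mult_def by (rule someI_ex)
  then show "1 \<le> mult" "w \<in> W n \<Longrightarrow> card {v \<in> W n. adj w v} \<le> mult" by auto
qed

text \<open>
  Two meeting cells \<open>kcell w\<close>, \<open>kcell v\<close> share a point \<open>F\<^sub>w a = F\<^sub>v c\<close> with \<open>a, c\<close> in the finite
  set \<open>V0\<close>, so up to scaling there are only finitely many relative positions.
\<close>
lemma ex_child_gap:
  "\<exists>c>0. \<forall>n. \<forall>w\<in>W n. \<forall>v\<in>W n. \<forall>i\<in>{1..N}. \<forall>j\<in>{1..N}. adj w v \<longrightarrow> \<not> adj (w @ [i]) (v @ [j]) \<longrightarrow>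
     (\<forall>x\<in>kcell (w @ [i]). \<forall>y\<in>kcell (v @ [j]). c * \<rho> ^ n \<le> dist x y)"
proof -
  define D where "D = insert 0 ((\<lambda>(a, c). a - c) ` (V0 \<times> V0))"
  define P where "P = (\<lambda>(e, i, j) c. kcell [i] \<inter> (\<lambda>z. z + e) ` kcell [j] = {} \<longrightarrow>
      (\<forall>x\<in>kcell [i]. \<forall>y\<in>kcell [j]. (c::real) \<le> dist x (y + e)))"
  have "\<exists>c>0. \<forall>s\<in>D \<times> {1..N} \<times> {1..N}. P s c"
  proof (rule finite_pos_choice)
    show "finite (D \<times> {1..N} \<times> {1..N})" by (simp add: D_def finite_V0)
    fix s assume "s \<in> D \<times> {1..N} \<times> {1..N}"
    then obtain e i j where s: "s = (e, i, j)" "i \<in> {1..N}" "j \<in> {1..N}" by auto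
    have ij: "[i] \<in> W 1" "[j] \<in> W 1" using s by (auto simp: words_def)
    show "\<exists>c>0. P s c"
    proof (cases "kcell [i] \<inter> (\<lambda>z. z + e) ` kcell [j] = {}")
      case True
      have "compact ((\<lambda>z. z + e) ` kcell [j])"
        using compact_cell[OF ij(2)] by (intro compact_continuous_image continuous_intros)
      then have "\<exists>d>0. \<forall>x\<in>kcell [i]. \<forall>y\<in>(\<lambda>z. z + e) ` kcell [j]. d \<le> dist x y"
        using separate_compact_closed[OF compact_cell[OF ij(1)] compact_imp_closed] True by blast
      then show ?thesis unfolding s(1) P_def by auto
    next
      case False then show ?thesis unfolding s(1) P_def by (intro exI[of _ 1]) auto
    qed
  next
    fix s c c' assume "P s c" "0 < c'" "c' \<le> (c::real)"
    then show "P s c'" by (cases s) (fastforce simp: P_def)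
  qed
  then obtain c where c: "c > 0" "\<And>e i j. e \<in> D \<Longrightarrow> i \<in> {1..N} \<Longrightarrow> j \<in> {1..N} \<Longrightarrow> P (e, i, j) c"
    by blast
  show ?thesis
  proof (intro exI[of _ c] conjI allI ballI impI)
    fix n w v i j x y
    assume wv: "w \<in> W n" "v \<in> W n" and ij: "i \<in> {1..N}" "j \<in> {1..N}" and a: "adj w v"
      and na: "\<not> adj (w @ [i]) (v @ [j])" and x: "x \<in> kcell (w @ [i])" and y: "y \<in> kcell (v @ [j])"
    \<comment> \<open>The rescaled position of v relative to w: F_v is F_w preceded by the
      translation by e. The value 0 in D accounts for w = v.\<close>
    define e where "e = (1 / \<rho> ^ n) *\<^sub>R (shift v - shift w)"
    have r: "\<rho> ^ n > 0" using rho by simp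
    have Fv: "word_map F v z = word_map F w (z + e)" for z
    proof -
      have "\<rho> ^ n *\<^sub>R e = shift v - shift w" using rho by (simp add: e_def)
      then show ?thesis
        by (simp add: word_map_words[OF wv(1)] word_map_words[OF wv(2)] scaleR_add_right)
    qed
    have "e \<in> D"
    proof (cases "w = v")
      case False
      obtain p q where pq: "p \<in> V0" "q \<in> V0" "word_map F w p = word_map F v q"
        using adj_vertices[OF wv False a] .
      then have "p = q + e" unfolding Fv using word_map_inject[OF wv(1)] by simp
      then have "e = p - q" by simp
      then show ?thesis using pq by (auto simp: D_def)
    qed (simp add: e_def D_def)
    obtain x' where x': "x' \<in> kcell [i]" "x = word_map F w x'" using x by (auto simp: cell_append)
    obtain y' where y': "y' \<in> kcell [j]" "y = word_map F w (y' + e)"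
      using y by (auto simp: cell_append Fv)
    have "kcell [i] \<inter> (\<lambda>z. z + e) ` kcell [j] = {}"
    proof (rule ccontr)
      assume "\<not> ?thesis"
      then obtain z where "z + e \<in> kcell [i]" "z \<in> kcell [j]" by auto
      then have "word_map F w (z + e) \<in> kcell (w @ [i])" "word_map F v z \<in> kcell (v @ [j])"
        by (auto simp: cell_append)
      then show False using na Fv adjI by metis
    qed
    then have "c \<le> dist x' (y' + e)" using c(2)[OF \<open>e \<in> D\<close> ij] x' y' by (simp add: P_def)
    then show "c * \<rho> ^ n \<le> dist x y" using r by (simp add: x' y' dist_word_map[OF wv(1)])
  qed (rule c)
qed

definition gap :: real where
  "gap = (SOME c. 0 < c \<and> c \<le> 1 \<and> (\<forall>n. \<forall>w\<in>W n. \<forall>v\<in>W n. \<not> adj w v \<longrightarrow>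
     (\<forall>x\<in>kcell w. \<forall>y\<in>kcell v. c * \<rho> ^ n \<le> dist x y)))"

text \<open>Pass to the ancestors of two disjoint cells. At the last level where the ancestors still
  meet, \<open>ex_child_gap\<close> separates their children at the scale of that level, which is
  coarser than \<rho>^n.\<close>

lemma gap: "0 < gap" "gap \<le> 1"
  "w \<in> W n \<Longrightarrow> v \<in> W n \<Longrightarrow> x \<in> kcell w \<Longrightarrow> y \<in> kcell v \<Longrightarrow> dist x y < gap * \<rho> ^ n \<Longrightarrow> adj w v"
proof -
  obtain c where "c > 0 \<and> (\<forall>n. \<forall>w\<in>W n. \<forall>v\<in>W n. \<forall>i\<in>{1..N}. \<forall>j\<in>{1..N}. adj w v \<longrightarrow>
      \<not> adj (w @ [i]) (v @ [j]) \<longrightarrow>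
      (\<forall>x\<in>kcell (w @ [i]). \<forall>y\<in>kcell (v @ [j]). c * \<rho> ^ n \<le> dist x y))"
    using ex_child_gap by (rule exE)
  then have c: "c > 0" "\<And>n w v i j x y. w \<in> W n \<Longrightarrow> v \<in> W n \<Longrightarrow> i \<in> {1..N} \<Longrightarrow> j \<in> {1..N} \<Longrightarrow> adj w v
      \<Longrightarrow> \<not> adj (w @ [i]) (v @ [j]) \<Longrightarrow> x \<in> kcell (w @ [i]) \<Longrightarrow> y \<in> kcell (v @ [j]) \<Longrightarrow> c * \<rho> ^ n \<le> dist x y"
    by simp_all
  define c0 where "c0 = min c 1"
  have c0: "0 < c0" "c0 \<le> c" "c0 \<le> 1" using c(1) by (auto simp: c0_def)
  have "c0 * \<rho> ^ n \<le> dist x y"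
    if "w \<in> W n" "v \<in> W n" "\<not> adj w v" "x \<in> kcell w" "y \<in> kcell v" for n w v x y
    using that
  proof (induction n arbitrary: w v)
    case (Suc n)
    define w' where "w' = take n w"
    define v' where "v' = take n v"
    have wv': "w' \<in> W n" "v' \<in> W n" using take_words Suc.prems by (auto simp: w'_def v'_def)
    have w: "w = w' @ [last w]" "last w \<in> {1..N}"
      using Suc.prems(1) words_length[OF Suc.prems(1)] words_set[OF Suc.prems(1)]
      by (cases w rule: rev_cases; auto simp: w'_def)+
    have v: "v = v' @ [last v]" "last v \<in> {1..N}"
      using Suc.prems(2) words_length[OF Suc.prems(2)] words_set[OF Suc.prems(2)]
      by (cases v rule: rev_cases; auto simp: v'_def)+
    have "c0 * \<rho> ^ n \<le> dist x y"
    proof (cases "adj w' v'")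
      case True
      have "c * \<rho> ^ n \<le> dist x y"
        using Suc.prems(3-5) by (intro c(2)[OF wv' w(2) v(2) True]) (simp_all only: w(1)[symmetric] v(1)[symmetric] not_False_eq_True)
      moreover have "c0 * \<rho> ^ n \<le> c * \<rho> ^ n" using c0 rho by (intro mult_right_mono) auto
      ultimately show ?thesis by simp
    next
      case False
      have "x \<in> kcell w'" "y \<in> kcell v'"
        using cell_take Suc.prems unfolding w'_def v'_def by blast+
      then show ?thesis using Suc.IH[OF wv' False] by blast
    qed
    moreover have "c0 * \<rho> ^ Suc n \<le> c0 * \<rho> ^ n" using c0 rho
      by (intro mult_left_mono power_decreasing) auto
    ultimately show ?case by simp
  qed simp
  then have "\<exists>c. 0 < c \<and> c \<le> 1 \<and> (\<forall>n. \<forall>w\<in>W n. \<forall>v\<in>W n. \<not> adj w v \<longrightarrow>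
     (\<forall>x\<in>kcell w. \<forall>y\<in>kcell v. c * \<rho> ^ n \<le> dist x y))"
    using c0 by blast
  then have *: "0 < gap \<and> gap \<le> 1 \<and> (\<forall>n. \<forall>w\<in>W n. \<forall>v\<in>W n. \<not> adj w v \<longrightarrow>
     (\<forall>x\<in>kcell w. \<forall>y\<in>kcell v. gap * \<rho> ^ n \<le> dist x y))"
    unfolding gap_def by (rule someI_ex)
  then show "0 < gap" "gap \<le> 1" by auto
  show "w \<in> W n \<Longrightarrow> v \<in> W n \<Longrightarrow> x \<in> kcell w \<Longrightarrow> y \<in> kcell v \<Longrightarrow> dist x y < gap * \<rho> ^ n \<Longrightarrow> adj w v"
    using * by fastforce
qed

end

section \<open>Discrete energies and resistances\<close>

lemma powr_add3_le:
  fixes a b c p :: real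
  assumes "0 \<le> a" "0 \<le> b" "0 \<le> c" "0 \<le> p"
  shows "(a + b + c) powr p \<le> 3 powr p * (a powr p + b powr p + c powr p)"
proof -
  define M where "M = max a (max b c)"
  have "(a + b + c) powr p \<le> (3 * M) powr p" using assms by (intro powr_mono2) (auto simp: M_def)
  also have "\<dots> = 3 powr p * M powr p" using assms by (simp add: powr_mult M_def)
  also have "M powr p \<le> a powr p + b powr p + c powr p" by (auto simp: M_def max_def)
  finally show ?thesis by (simp add: mult_left_mono)
qed

lemma abs_diff3_powr_le:
  fixes a b c d p :: real
  assumes "0 \<le> p"
  shows "\<bar>a - d\<bar> powr p \<le> 3 powr p * (\<bar>a - b\<bar> powr p + \<bar>b - c\<bar> powr p + \<bar>c - d\<bar> powr p)"
proof -
  have "\<bar>a - d\<bar> powr p \<le> (\<bar>a - b\<bar> + \<bar>b - c\<bar> + \<bar>c - d\<bar>) powr p" using assms by (intro powr_mono2) auto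
  also have "\<dots> \<le> 3 powr p * (\<bar>a - b\<bar> powr p + \<bar>b - c\<bar> powr p + \<bar>c - d\<bar> powr p)"
    using assms by (intro powr_add3_le) auto
  finally show ?thesis .
qed

lemma member_le_double_sum:
  fixes g :: "'b \<Rightarrow> 'c \<Rightarrow> real"
  assumes "finite A" "finite B" "a \<in> A" "b \<in> B" "\<And>x y. 0 \<le> g x y"
  shows "g a b \<le> (\<Sum>x\<in>A. \<Sum>y\<in>B. g x y)"
proof -
  have "g a b \<le> (\<Sum>y\<in>B. g a y)" using assms by (intro member_le_sum) auto
  also have "\<dots> \<le> (\<Sum>x\<in>A. \<Sum>y\<in>B. g x y)"
    using assms by (intro member_le_sum[of a A "\<lambda>x. \<Sum>y\<in>B. g x y"]) (auto intro: sum_nonneg)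
  finally show ?thesis .
qed

lemma finite_bound_choice:
  assumes "finite S" "\<And>s. s \<in> S \<Longrightarrow> \<exists>c. P s c" "\<And>s c c'. P s c \<Longrightarrow> c \<le> (c'::real) \<Longrightarrow> P s c'"
  shows "\<exists>c\<ge>1. \<forall>s\<in>S. P s c"
  using assms(1,2)
proof (induction S rule: finite_induct)
  case empty show ?case by (intro exI[of _ 1]) simp
next
  case (insert s S)
  obtain c where c: "c \<ge> 1" "\<forall>s\<in>S. P s c" using insert by auto
  obtain c' where c': "P s c'" using insert.prems by auto
  have "P s (max c c')" "\<forall>s\<in>S. P s (max c c')" using c c' assms(3)[of _ _ "max c c'"] by auto
  then show ?case using c(1) by (intro exI[of _ "max c c'"]) auto
qed

text \<open>Fekete's lemma, with multiplicative constants and both inequalities.\<close>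
lemma almost_multiplicative_growth:
  fixes R :: "nat \<Rightarrow> real"
  assumes R1: "\<And>n. 1 \<le> R n" and C1: "1 \<le> C"
    and sub: "\<And>n m. R (n + m) \<le> C * (R n * R m)"
    and sup: "\<And>n m. k \<le> n \<Longrightarrow> k \<le> m \<Longrightarrow> R n * R m \<le> C * R (n + m)"
  shows "\<exists>\<theta>\<ge>1. \<exists>D\<ge>1. \<forall>n. R n \<le> D * \<theta> ^ n \<and> \<theta> ^ n \<le> D * R n"
proof -
  define k1 where "k1 = max k 1"
  \<comment> \<open>The constant is absorbed by rescaling: T is super-multiplicative beyond k1, S is
    sub-multiplicative, and T \<le> S because C \<ge> 1.\<close>
  define T where "T n = R n / C" for n
  define S where "S n = C * R n" for n
  have pos: "0 < R n" for n using R1[of n] by simp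
  have Tpos: "0 < T n" "0 < S n" for n using pos C1 by (auto simp: T_def S_def)
  have TS: "T n \<le> S n" for n
  proof -
    have "R n \<le> C * C * R n" using C1 pos[of n] mult_mono[of 1 C 1 C] by (simp add: mult_le_cancel_right1)
    then show ?thesis using C1 by (simp add: T_def S_def divide_le_eq mult.commute mult.left_commute)
  qed
  have T_sup: "T n * T m \<le> T (n + m)" if "k1 \<le> n" "k1 \<le> m" for n m
    using sup[of n m] that C1 by (simp add: T_def k1_def field_simps)
  have S_sub: "S (n + m) \<le> S n * S m" for n m
    using sub[of n m] C1 by (simp add: S_def mult_left_mono ac_simps)
  have T_pow: "T n ^ Suc j \<le> T (n * Suc j)" if "k1 \<le> n" for n j
  proof (induction j)
    case (Suc j)
    have "T n ^ Suc (Suc j) \<le> T n * T (n * Suc j)" using Suc Tpos[of n] by simp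
    also have "\<dots> \<le> T (n + n * Suc j)" using that by (intro T_sup) auto
    finally show ?case by (simp add: ac_simps)
  qed simp
  have S_pow: "S (n * Suc j) \<le> S n ^ Suc j" for n j
  proof (induction j)
    case (Suc j)
    have "S (n * Suc (Suc j)) \<le> S n * S (n * Suc j)" using S_sub[of n "n * Suc j"] by (simp add: ac_simps)
    also have "\<dots> \<le> S n * S n ^ Suc j" using Suc Tpos[of n] by (intro mult_left_mono) auto
    finally show ?case by simp
  qed simp
  \<comment> \<open>T n ^ m \<le> T (n m) \<le> S (n m) \<le> S m ^ n. So every lower rate is below
    every upper rate, and the supremum L of the lower rates fits between them.\<close>
  have key: "ln (T n) / n \<le> ln (S m) / m" if nm: "k1 \<le> n" "k1 \<le> m" for n m
  proof -
    have n0: "0 < n" "0 < m" using nm by (auto simp: k1_def)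
    then obtain i j where ij: "n = Suc i" "m = Suc j" by (metis gr0_conv_Suc)
    have "T n ^ m \<le> T (n * m)" "S (m * n) \<le> S m ^ n"
      using T_pow[OF nm(1), of j] S_pow[of m i] by (simp_all only: ij)
    then have "T n ^ m \<le> S m ^ n"
      using TS[of "n * m"] unfolding mult.commute[of m n] by (meson order_trans)
    then have "ln (T n ^ m) \<le> ln (S m ^ n)" using Tpos[of n] by (intro ln_mono) auto
    then have "m * ln (T n) \<le> n * ln (S m)" using Tpos[of n] Tpos[of m] by (simp add: ln_realpow)
    then show ?thesis using n0 by (simp add: field_simps)
  qed
  define L where "L = (SUP n\<in>{k1..}. ln (T n) / n)"
  have bdd: "bdd_above ((\<lambda>n. ln (T n) / n) ` {k1..})"
    by (rule bdd_aboveI[of _ "ln (S k1) / k1"]) (auto intro: key)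
  have L1: "ln (T n) / n \<le> L" if "k1 \<le> n" for n
    unfolding L_def using bdd that by (intro cSUP_upper) auto
  have L2: "L \<le> ln (S m) / m" if "k1 \<le> m" for m
    unfolding L_def using key that by (intro cSUP_least) auto
  \<comment> \<open>R \<ge> 1 keeps T above 1 / C, so its exponential rate cannot be
    negative.\<close>
  have L0: "0 \<le> L"
  proof (rule ccontr)
    assume neg: "\<not> 0 \<le> L"
    obtain n0 where "ln C / (- L) < real n0" using reals_Archimedean2 by blast
    then have n0: "ln C < real n0 * (- L)" using neg by (subst (asm) pos_divide_less_eq) auto
    define n where "n = max k1 (max n0 1)"
    have n: "k1 \<le> n" "0 < n" "n0 \<le> n" by (auto simp: n_def)
    have "real n0 * (- L) \<le> real n * (- L)" using n neg by (intro mult_right_mono) auto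
    then have "ln C < real n * (- L)" using n0 by linarith
    moreover have "ln (T n) \<le> L * n" using L1[OF n(1)] n(2) by (simp add: divide_le_eq)
    moreover have "- ln C \<le> ln (T n)"
      using R1[of n] C1 pos[of n] by (simp add: T_def ln_div)
    ultimately show False by (simp add: mult.commute)
  qed
  define \<theta> where "\<theta> = exp L"
  have th1: "1 \<le> \<theta>" using L0 by (simp add: \<theta>_def)
  have th: "\<theta> ^ n = exp (L * n)" for n by (simp add: \<theta>_def exp_of_nat_mult[symmetric] mult.commute)
  have up: "R n \<le> C * \<theta> ^ n" if "k1 \<le> n" for n
  proof -
    have "ln (T n) \<le> L * n" using L1[OF that] that by (simp add: divide_le_eq k1_def)
    then have "T n \<le> \<theta> ^ n" using Tpos[of n] th[of n] by (metis exp_le_cancel_iff exp_ln)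
    then show ?thesis using C1 by (simp add: T_def divide_le_eq mult.commute)
  qed
  have lo: "\<theta> ^ n \<le> C * R n" if "k1 \<le> n" for n
  proof -
    have "L * n \<le> ln (S n)" using L2[OF that] that by (simp add: le_divide_eq k1_def)
    then show ?thesis using Tpos[of n] th[of n] by (metis exp_le_cancel_iff exp_ln S_def)
  qed
  \<comment> \<open>The finitely many n up to k1 are absorbed into the constant.\<close>
  define D where "D = Max (insert C (insert (\<theta> ^ k1) (R ` {..k1})))"
  have D: "C \<le> D" "\<theta> ^ k1 \<le> D" "\<And>n. n \<le> k1 \<Longrightarrow> R n \<le> D"
    unfolding D_def by (intro Max_ge; simp)+
  have "R n \<le> D * \<theta> ^ n \<and> \<theta> ^ n \<le> D * R n" for n
  proof (cases "k1 \<le> n")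
    case True
    have "C * \<theta> ^ n \<le> D * \<theta> ^ n" "C * R n \<le> D * R n"
      using D(1) th1 pos[of n] by (auto intro!: mult_right_mono)
    then show ?thesis using up[OF True] lo[OF True] by linarith
  next
    case False
    have "1 \<le> \<theta> ^ n" "\<theta> ^ n \<le> \<theta> ^ k1" using th1 False by (auto intro: power_increasing)
    moreover have RD: "R n \<le> D" "0 \<le> D" using D(3)[of n] False pos[of n] by auto
    moreover have "D * 1 \<le> D * \<theta> ^ n" "D * 1 \<le> D * R n"
      using \<open>1 \<le> \<theta> ^ n\<close> RD R1[of n] by (intro mult_left_mono; simp)+
    ultimately show ?thesis using D(2) by linarith
  qed
  then show ?thesis using th1 D(1) C1 by (intro exI[of _ \<theta>] conjI exI[of _ D]) auto
qed

context connected_nested_fractal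
begin

lemma sum_words_add: "(\<Sum>w\<in>W (n + m). g w) = (\<Sum>w\<in>W n. \<Sum>v\<in>W m. g (w @ v))"
proof -
  have "bij_betw (\<lambda>(w, v). w @ v) (W n \<times> W m) (W (n + m))"
    by (rule bij_betwI[of _ _ _ "\<lambda>w. (take n w, drop n w)"])
       (auto simp: words_append words_length dest: take_words drop_words in_set_takeD in_set_dropD,
        auto simp: words_def dest: in_set_takeD in_set_dropD)
  then have "(\<Sum>w\<in>W (n + m). g w) = (\<Sum>(w, v)\<in>W n \<times> W m. g (w @ v))"
    by (subst sum.reindex_bij_betw[symmetric]) (auto intro!: sum.cong)
  then show ?thesis by (simp add: sum.cartesian_product)
qed

lemma sum_adj_le:
  fixes h :: "nat list \<Rightarrow> real"
  assumes "\<And>w. w \<in> W n \<Longrightarrow> 0 \<le> h w"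
  shows "(\<Sum>w\<in>W n. \<Sum>v\<in>W n. if adj w v then h w else 0) \<le> mult * (\<Sum>w\<in>W n. h w)"
    "(\<Sum>w\<in>W n. \<Sum>v\<in>W n. if adj w v then h v else 0) \<le> mult * (\<Sum>w\<in>W n. h w)"
proof -
  have "(\<Sum>v\<in>W n. if adj w v then h w else 0) \<le> mult * h w" if w: "w \<in> W n" for w
  proof -
    have "(\<Sum>v\<in>W n. if adj w v then h w else 0) = card {v\<in>W n. adj w v} * h w"
      by (simp add: sum.inter_filter[symmetric] finite_words)
    also have "\<dots> \<le> mult * h w" using mult(2)[OF w] assms[OF w] by (intro mult_right_mono) auto
    finally show ?thesis .
  qed
  then have "(\<Sum>w\<in>W n. \<Sum>v\<in>W n. if adj w v then h w else 0) \<le> (\<Sum>w\<in>W n. mult * h w)"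
    by (rule sum_mono)
  then show 1: "(\<Sum>w\<in>W n. \<Sum>v\<in>W n. if adj w v then h w else 0) \<le> mult * (\<Sum>w\<in>W n. h w)"
    by (simp add: sum_distrib_left)
  have "(\<Sum>w\<in>W n. \<Sum>v\<in>W n. if adj w v then h v else 0) = (\<Sum>w\<in>W n. \<Sum>v\<in>W n. if adj w v then h w else 0)"
    by (subst sum.swap) (simp add: adj_sym)
  then show "(\<Sum>w\<in>W n. \<Sum>v\<in>W n. if adj w v then h v else 0) \<le> mult * (\<Sum>w\<in>W n. h w)" using 1 by simp
qed

text \<open>All m-cells through x, whatever their addresses: no choice of index is involved, and
  reflections carry stars to stars.\<close>

definition star :: "nat \<Rightarrow> 'a \<Rightarrow> nat list set" where
  "star m x = {w \<in> W m. x \<in> kcell w}"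

lemma star_adj: "w \<in> star m x \<Longrightarrow> v \<in> star m x \<Longrightarrow> adj w v"
  by (auto simp: star_def intro: adjI)

lemma corner_star: "x \<in> V0 \<Longrightarrow> corner m x \<in> star m x"
  by (simp add: star_def corner_words corner_mem)

lemma ex_card_star: "\<exists>M. \<forall>m x. card (star m x) \<le> M"
  using ex_multiplicity[of 0] by (auto simp: star_def)

text \<open>From this level on the diameter of a cell is below the least distance in
  \<open>V0\<close>, so a cell contains at most one boundary point.\<close>

definition k0 :: nat where "k0 = (SOME k. \<rho> ^ k < vgap)"

lemma star_disjoint:
  assumes "k0 \<le> m" "x \<in> V0" "y \<in> V0" "x \<noteq> y" "w \<in> star m x" shows "y \<notin> kcell w"
proof
  assume "y \<in> kcell w"
  then have "dist x y \<le> \<rho> ^ m" using assms(5) dist_cell[of w m x y] by (auto simp: star_def)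
  also have "\<dots> \<le> \<rho> ^ k0" using rho assms(1) by (intro power_decreasing) auto
  also have "\<rho> ^ k0 < vgap"
    unfolding k0_def using real_arch_pow_inv[OF vgap_pos rho(2)] by (rule someI_ex)
  finally show False using vgap_le[OF assms(2-4)] by simp
qed

end

locale nested_fractal_energy = connected_nested_fractal +
  fixes p :: real
  assumes p: "1 < p"
begin

definition eterm :: "(nat list \<Rightarrow> real) \<Rightarrow> nat list \<Rightarrow> nat list \<Rightarrow> real" where
  "eterm f w v = (if adj w v then \<bar>f w - f v\<bar> powr p else 0)"

text \<open>The sum runs over ordered pairs, so each edge counts twice.\<close>

definition energy :: "nat \<Rightarrow> (nat list \<Rightarrow> real) \<Rightarrow> real" where
  "energy m f = (\<Sum>w\<in>W m. \<Sum>v\<in>W m. eterm f w v)"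

text \<open>For w and v of level n, the part of the level n + m energy that lives between subcells
  of w and subcells of v. The diagonal block is the energy of f rescaled to the cell w.\<close>

definition block :: "nat \<Rightarrow> (nat list \<Rightarrow> real) \<Rightarrow> nat list \<Rightarrow> nat list \<Rightarrow> real" where
  "block m f w v = (\<Sum>w'\<in>W m. \<Sum>v'\<in>W m. eterm f (w @ w') (v @ v'))"

lemma eterm_nonneg: "0 \<le> eterm f w v" by (simp add: eterm_def)
lemma energy_nonneg: "0 \<le> energy m f" by (simp add: energy_def eterm_nonneg sum_nonneg)
lemma block_nonneg: "0 \<le> block m f w v" by (simp add: block_def eterm_nonneg sum_nonneg)

lemma eterm_le_energy: "w \<in> W m \<Longrightarrow> v \<in> W m \<Longrightarrow> eterm f w v \<le> energy m f"
  unfolding energy_def by (intro member_le_double_sum finite_words eterm_nonneg)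

lemma adj_le_energy: "w \<in> W m \<Longrightarrow> v \<in> W m \<Longrightarrow> adj w v \<Longrightarrow> \<bar>f w - f v\<bar> powr p \<le> energy m f"
  using eterm_le_energy[of w m v f] by (simp add: eterm_def)

lemma eterm_le_block: "w' \<in> W m \<Longrightarrow> v' \<in> W m \<Longrightarrow> eterm f (w @ w') (v @ v') \<le> block m f w v"
  unfolding block_def
  by (rule member_le_double_sum[of _ _ _ _ "\<lambda>w' v'. eterm f (w @ w') (v @ v')"])
     (auto simp: eterm_nonneg finite_words)

lemma energy_block: "energy (n + m) f = (\<Sum>w\<in>W n. \<Sum>v\<in>W n. block m f w v)"
proof -
  have "energy (n + m) f = (\<Sum>w\<in>W n. \<Sum>w'\<in>W m. \<Sum>v\<in>W n. \<Sum>v'\<in>W m. eterm f (w @ w') (v @ v'))"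
    by (simp add: energy_def sum_words_add)
  also have "\<dots> = (\<Sum>w\<in>W n. \<Sum>v\<in>W n. block m f w v)"
    unfolding block_def by (intro sum.cong refl sum.swap)
  finally show ?thesis .
qed

lemma block_self: "w \<in> W n \<Longrightarrow> block m f w w = energy m (\<lambda>v. f (w @ v))"
  by (simp add: block_def energy_def eterm_def adj_append_same)

lemma block_le_energy: "w \<in> W n \<Longrightarrow> v \<in> W n \<Longrightarrow> block m f w v \<le> energy (n + m) f"
  unfolding energy_block by (intro member_le_double_sum finite_words block_nonneg)

lemma sum_block_self_le: "(\<Sum>w\<in>W n. block m f w w) \<le> energy (n + m) f"
  unfolding energy_block
  by (intro sum_mono member_le_sum) (auto simp: block_nonneg finite_words)

lemma energy_le_scale:
  assumes "0 \<le> c" "\<And>w v. w \<in> W m \<Longrightarrow> v \<in> W m \<Longrightarrow> adj w v \<Longrightarrow> \<bar>f w - f v\<bar> \<le> c * \<bar>g w - g v\<bar>"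
  shows "energy m f \<le> c powr p * energy m g"
proof -
  have "eterm f w v \<le> c powr p * eterm g w v" if "w \<in> W m" "v \<in> W m" for w v
  proof (cases "adj w v")
    case True
    have "\<bar>f w - f v\<bar> powr p \<le> (c * \<bar>g w - g v\<bar>) powr p"
      using assms(2)[OF that True] p by (intro powr_mono2) auto
    then show ?thesis using True assms(1) by (simp add: eterm_def powr_mult)
  qed (simp add: eterm_def)
  then show ?thesis unfolding energy_def sum_distrib_left by (intro sum_mono) auto
qed

lemma sum_rword:
  assumes "x \<in> V0" "y \<in> V0" "x \<noteq> y"
  shows "(\<Sum>w\<in>W m. h (rword x y w)) = (\<Sum>w\<in>W m. h w)"
proof (rule sum.reindex_bij_betw)
  show "bij_betw (rword x y) (W m) (W m)"
    by (rule bij_betwI[of _ _ _ "rword x y"]) (auto simp: rword[OF assms] rword_rword[OF assms])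
qed

text \<open>A bounds all effective p-resistances between boundary cells at level m. The multiplied
  form needs no division by an energy that might vanish.\<close>

definition res_bound :: "nat \<Rightarrow> real \<Rightarrow> bool" where
  "res_bound m A \<longleftrightarrow> (\<forall>f. \<forall>x\<in>V0. \<forall>y\<in>V0. \<bar>f (corner m x) - f (corner m y)\<bar> powr p \<le> A * energy m f)"

lemma res_bound_D: "res_bound m A \<Longrightarrow> x \<in> V0 \<Longrightarrow> y \<in> V0 \<Longrightarrow> \<bar>f (corner m x) - f (corner m y)\<bar> powr p \<le> A * energy m f"
  by (simp add: res_bound_def)

section \<open>Corner sampling and submultiplicativity of the resistances\<close>

definition sample_const :: real where "sample_const = 3 powr p * (2 * real mult + 1)"

lemma sample_const_ge: "1 \<le> sample_const"
proof -
  have "1 * 1 \<le> 3 powr p * (2 * real mult + 1)" using p by (intro mult_mono ge_one_powr_ge_zero) auto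
  then show ?thesis by (simp only: sample_const_def mult_1)
qed

text \<open>Two distinct meeting cells share a vertex F_w x = F_v y. Going from the sample corner of
  w to that vertex, across to v, and on to the sample corner of v takes three differences. The outer
  two cost B times a diagonal block, charged at most \<open>mult\<close> times each; the middle one
  is a single term of the mixed block.\<close>

lemma sample_energy:
  assumes "res_bound m B" "1 \<le> B" "x0 \<in> V0"
  shows "energy n (\<lambda>w. f (w @ corner m x0)) \<le> sample_const * B * energy (n + m) f"
proof -
  let ?g = "\<lambda>w. f (w @ corner m x0)"
  have in_cell: "\<bar>f (w @ corner m x) - f (w @ corner m y)\<bar> powr p \<le> B * block m f w w"
    if "w \<in> W n" "x \<in> V0" "y \<in> V0" for w x y
    using res_bound_D[OF assms(1) that(2,3), of "\<lambda>v. f (w @ v)"] by (simp add: block_self[OF that(1)])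
  have et: "eterm ?g w v \<le> 3 powr p * ((if adj w v then B * block m f w w else 0)
      + block m f w v + (if adj w v then B * block m f v v else 0))" (is "_ \<le> ?R")
    if wv: "w \<in> W n" "v \<in> W n" for w v
  proof (cases "adj w v \<and> w \<noteq> v")
    case True
    then obtain x y where xy: "x \<in> V0" "y \<in> V0" "word_map F w x = word_map F v y"
      using adj_vertices wv by metis
    have "\<bar>?g w - ?g v\<bar> powr p \<le> 3 powr p * (\<bar>?g w - f (w @ corner m x)\<bar> powr p
        + \<bar>f (w @ corner m x) - f (v @ corner m y)\<bar> powr p + \<bar>f (v @ corner m y) - ?g v\<bar> powr p)"
      using p by (intro abs_diff3_powr_le) auto
    also have "\<dots> \<le> 3 powr p * (B * block m f w w + block m f w v + B * block m f v v)"
    proof (intro mult_left_mono add_mono in_cell wv xy assms(3))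
      show "\<bar>f (w @ corner m x) - f (v @ corner m y)\<bar> powr p \<le> block m f w v"
        using eterm_le_block[OF corner_words[OF xy(1)] corner_words[OF xy(2)], where m = m and f = f and w = w and v = v]
          corner_adj[OF xy, of m] by (simp add: eterm_def)
    qed simp
    finally show ?thesis using True by (simp add: eterm_def)
  next
    case False
    then have "eterm ?g w v = 0" using p by (auto simp: eterm_def)
    moreover have "0 \<le> ?R" using assms(2) by (simp add: block_nonneg)
    ultimately show ?thesis by simp
  qed
  let ?S = "\<Sum>w\<in>W n. block m f w w" and ?E = "energy (n + m) f"
  have "energy n ?g \<le> (\<Sum>w\<in>W n. \<Sum>v\<in>W n. 3 powr p * ((if adj w v then B * block m f w w else 0)
      + block m f w v + (if adj w v then B * block m f v v else 0)))"
    unfolding energy_def by (intro sum_mono et)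
  also have "\<dots> = 3 powr p * ((\<Sum>w\<in>W n. \<Sum>v\<in>W n. if adj w v then B * block m f w w else 0)
      + ?E + (\<Sum>w\<in>W n. \<Sum>v\<in>W n. if adj w v then B * block m f v v else 0))"
    by (simp add: sum_distrib_left sum.distrib energy_block distrib_left)
  also have "\<dots> \<le> 3 powr p * (mult * (B * ?E) + B * ?E + mult * (B * ?E))"
  proof (intro mult_left_mono add_mono)
    have "(\<Sum>w\<in>W n. B * block m f w w) \<le> B * ?E"
      unfolding sum_distrib_left[symmetric] using assms(2) sum_block_self_le
      by (intro mult_left_mono) auto
    then have *: "mult * (\<Sum>w\<in>W n. B * block m f w w) \<le> mult * (B * ?E)"
      by (intro mult_left_mono) auto
    have "0 \<le> B * block m f w w" for w using assms(2) block_nonneg[of m f w w] by simp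
    from sum_adj_le[of n "\<lambda>w. B * block m f w w", OF this]
    show "(\<Sum>w\<in>W n. \<Sum>v\<in>W n. if adj w v then B * block m f w w else 0) \<le> mult * (B * ?E)"
      "(\<Sum>w\<in>W n. \<Sum>v\<in>W n. if adj w v then B * block m f v v else 0) \<le> mult * (B * ?E)"
      using * by linarith+
    show "?E \<le> B * ?E" using assms(2) energy_nonneg[of "n + m" f]
      by (simp add: mult_le_cancel_right1)
  qed simp
  also have "\<dots> = sample_const * B * ?E" by (simp add: sample_const_def algebra_simps)
  finally show ?thesis .
qed

definition res_add_const :: real where "res_add_const = 3 powr p * (2 + sample_const)"

lemma res_add_const_ge: "1 \<le> res_add_const"
proof -
  have "1 * 1 \<le> 3 powr p * (2 + sample_const)" using p sample_const_ge by (intro mult_mono ge_one_powr_ge_zero) auto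
  then show ?thesis by (simp add: res_add_const_def)
qed

text \<open>Sampling at the corner of x makes one end exact. At the other end the sample is off by a
  difference inside the cell \<open>corner n y\<close>, controlled by B; the sampled function is
  controlled by A and \<open>sample_energy\<close>.\<close>

lemma res_bound_add:
  assumes "res_bound n A" "1 \<le> A" "res_bound m B" "1 \<le> B"
  shows "res_bound (n + m) (res_add_const * (A * B))"
  unfolding res_bound_def
proof (intro allI ballI)
  fix f x y assume xy: "x \<in> V0" "y \<in> V0"
  let ?E = "energy (n + m) f" and ?g = "\<lambda>w. f (w @ corner m x)"
  have E0: "0 \<le> ?E" by (rule energy_nonneg)
  have AB: "1 \<le> A * B" "B \<le> A * B" "0 \<le> A * B"
    using assms mult_mono[of 1 A 1 B] mult_right_mono[of 1 A B] by auto
  have "\<bar>f (corner (n + m) y) - ?g (corner n y)\<bar> powr p \<le> B * block m f (corner n y) (corner n y)"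
    using res_bound_D[OF assms(3) xy(2,1), of "\<lambda>v. f (corner n y @ v)"] corner_words[OF xy(2), of n]
    by (simp add: block_self corner_append)
  also have "\<dots> \<le> B * ?E" using assms(4) block_le_energy corner_words[OF xy(2)]
    by (intro mult_left_mono) auto
  also have "\<dots> \<le> A * B * ?E" using AB(2) E0 by (intro mult_right_mono)
  finally have 1: "\<bar>?g (corner n y) - f (corner (n + m) y)\<bar> powr p \<le> A * B * ?E"
    by (simp add: abs_minus_commute)
  have "\<bar>?g (corner n x) - ?g (corner n y)\<bar> powr p \<le> A * energy n ?g"
    by (rule res_bound_D[OF assms(1) xy])
  also have "\<dots> \<le> A * (sample_const * B * ?E)"
    using assms(2) sample_energy[OF assms(3,4) xy(1)] by (intro mult_left_mono) auto
  finally have 2: "\<bar>?g (corner n x) - ?g (corner n y)\<bar> powr p \<le> sample_const * (A * B * ?E)"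
    by (simp add: ac_simps)
  have "\<bar>f (corner (n + m) x) - f (corner (n + m) y)\<bar> powr p
      \<le> 3 powr p * (\<bar>f (corner (n + m) x) - ?g (corner n x)\<bar> powr p
        + \<bar>?g (corner n x) - ?g (corner n y)\<bar> powr p + \<bar>?g (corner n y) - f (corner (n + m) y)\<bar> powr p)"
    using p by (intro abs_diff3_powr_le) auto
  also have "\<dots> \<le> 3 powr p * (A * B * ?E + sample_const * (A * B * ?E) + A * B * ?E)"
    using p AB E0 by (intro mult_left_mono add_mono 1 2) (simp_all add: corner_append)
  also have "\<dots> = res_add_const * (A * B) * ?E" by (simp add: res_add_const_def algebra_simps)
  finally show "\<bar>f (corner (n + m) x) - f (corner (n + m) y)\<bar> powr p \<le> res_add_const * (A * B) * ?E" .
qed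

text \<open>The connectivity axiom joins any two 1-cells by a chain; n steps cost the factor n^p,
  and there are finitely many pairs.\<close>

lemma ex_level_one_bound:
  "\<exists>C\<ge>1. \<forall>f. \<forall>w\<in>W 1. \<forall>v\<in>W 1. \<bar>f w - f v\<bar> powr p \<le> C * energy 1 f"
proof -
  define P where "P = (\<lambda>(w, v) C. \<forall>f. \<bar>f w - f v\<bar> powr p \<le> C * energy 1 f)"
  have "\<exists>C\<ge>1. \<forall>s\<in>W 1 \<times> W 1. P s C"
  proof (rule finite_bound_choice)
    show "finite (W 1 \<times> W 1)" by (simp add: finite_words)
    fix s assume "s \<in> W 1 \<times> W 1"
    then obtain i j where s: "s = ([i], [j])" and ij: "i \<in> {1..N}" "j \<in> {1..N}"
      by (auto simp: words_def length_Suc_conv)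
    obtain n a where a: "a (0::nat) = i" "a n = j" "\<forall>k\<le>n. a k \<in> {1..N}"
        "\<forall>k<n. F (a k) ` K \<inter> F (a (Suc k)) ` K \<noteq> {}"
      using chains ij unfolding nf_connectivity_def by blast
    have "P s (real n powr p)"
      unfolding P_def s prod.case
    proof
      fix f
      define e where "e = energy 1 f powr (1 / p)"
      have ep: "e powr p = energy 1 f" using p energy_nonneg[of 1 f] by (simp add: e_def powr_powr)
      have e0: "0 \<le> e" by (simp add: e_def)
      have "k \<le> n \<Longrightarrow> \<bar>f [a 0] - f [a k]\<bar> \<le> k * e" for k
      proof (induction k)
        case (Suc k)
        have "[a k] \<in> W 1" "[a (Suc k)] \<in> W 1" "adj [a k] [a (Suc k)]"
          using a Suc.prems by (auto simp: words_def adj_def cell_def word_map_def)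
        then have "\<bar>f [a k] - f [a (Suc k)]\<bar> powr p \<le> e powr p"
          unfolding ep by (rule adj_le_energy)
        then have "\<bar>f [a k] - f [a (Suc k)]\<bar> \<le> e"
          using p e0 by (meson abs_ge_zero linorder_not_le order_less_trans powr_less_mono2 zero_less_one)
        then show ?case using Suc by (simp add: algebra_simps)
      qed simp
      then have "\<bar>f [i] - f [j]\<bar> powr p \<le> (n * e) powr p"
        using p a by (intro powr_mono2) auto
      then show "\<bar>f [i] - f [j]\<bar> powr p \<le> real n powr p * energy 1 f"
        using e0 by (simp add: powr_mult ep)
    qed
    then show "\<exists>c. P s c" by blast
  next
    fix s c c' assume "P s c" "c \<le> c'"
    then show "P s c'" unfolding P_def using energy_nonneg[of 1]
      by (auto simp: case_prod_beta intro: order_trans[OF _ mult_right_mono])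
  qed
  then show ?thesis by (auto simp: P_def)
qed

lemma ex_res_bound: "\<exists>A\<ge>1. res_bound m A"
proof (induction m)
  case 0
  show ?case using energy_nonneg[of 0] p by (intro exI[of _ 1]) (auto simp: res_bound_def)
next
  case (Suc m)
  then obtain A where A: "1 \<le> A" "res_bound m A" by auto
  obtain C where C: "1 \<le> C" "\<And>f w v. w \<in> W 1 \<Longrightarrow> v \<in> W 1 \<Longrightarrow> \<bar>f w - f v\<bar> powr p \<le> C * energy 1 f"
    using ex_level_one_bound by blast
  have "res_bound 1 C" unfolding res_bound_def using C(2) corner_words by blast
  then have "res_bound (1 + m) (res_add_const * (C * A))" using res_bound_add C(1) A by blast
  moreover have "1 \<le> res_add_const * (C * A)"
    using res_add_const_ge C(1) A(1) mult_mono[of 1 C 1 A] mult_mono[of 1 res_add_const 1 "C * A"] by simp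
  ultimately show ?case by auto
qed

text \<open>
  Up to constants, the largest effective \<open>p\<close>-resistance between two boundary cells at level \<open>m\<close>;
  the bound \<open>1 \<le> A\<close> only serves to absorb additive constants.
\<close>
definition res :: "nat \<Rightarrow> real" where "res m = Inf {A. 1 \<le> A \<and> res_bound m A}"

lemma res_bdd: "bdd_below {A. 1 \<le> A \<and> res_bound m A}" by (rule bdd_belowI[of _ 1]) auto

lemma res_ge_1: "1 \<le> res m"
  unfolding res_def using ex_res_bound by (intro cInf_greatest) auto

lemma res_le: "1 \<le> A \<Longrightarrow> res_bound m A \<Longrightarrow> res m \<le> A"
  unfolding res_def using res_bdd by (intro cInf_lower) auto

text \<open>For positive energy the inequality, divided by the energy, passes to the infimum; for
  zero energy any admissible A already forces the difference to vanish.\<close>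

lemma res_res_bound: "res_bound m (res m)"
  unfolding res_bound_def
proof (intro allI ballI)
  fix f x y assume xy: "x \<in> V0" "y \<in> V0"
  show "\<bar>f (corner m x) - f (corner m y)\<bar> powr p \<le> res m * energy m f"
  proof (cases "energy m f = 0")
    case True
    obtain A where "res_bound m A" using ex_res_bound by auto
    then show ?thesis using True res_bound_D[OF _ xy, of m A f] by simp
  next
    case False
    then have pos: "0 < energy m f" using energy_nonneg[of m f] by simp
    have "\<bar>f (corner m x) - f (corner m y)\<bar> powr p / energy m f \<le> res m"
      unfolding res_def
    proof (rule cInf_greatest)
      show "{A. 1 \<le> A \<and> res_bound m A} \<noteq> {}" using ex_res_bound by auto
      fix A assume "A \<in> {A. 1 \<le> A \<and> res_bound m A}"
      then show "\<bar>f (corner m x) - f (corner m y)\<bar> powr p / energy m f \<le> A"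
        using res_bound_D[OF _ xy, of m A f] pos by (simp add: divide_le_eq)
    qed
    then show ?thesis using pos by (simp add: divide_le_eq)
  qed
qed

lemma res_add: "res (n + m) \<le> res_add_const * (res n * res m)"
proof (rule res_le)
  show "res_bound (n + m) (res_add_const * (res n * res m))" by (intro res_bound_add res_res_bound res_ge_1)
  show "1 \<le> res_add_const * (res n * res m)"
    using res_add_const_ge res_ge_1[of n] res_ge_1[of m] mult_mono[of 1 "res n" 1 "res m"]
      mult_mono[of 1 res_add_const 1 "res n * res m"] by simp
qed

text \<open>Only pairs of m-cells in different k-cells contribute, and such a pair meets at a vertex
  F_a x with a in \<open>W k\<close> and x in \<open>V0\<close>. There are finitely many such
  vertices, each with a star of bounded size, so the bound is uniform in m and A.\<close>

lemma ex_prefix_energy: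
  "\<exists>C\<ge>1. \<forall>m\<ge>k. \<forall>A. energy m (\<lambda>w. if take k w \<in> A then 1 else 0) \<le> C"
proof -
  obtain M where M: "\<And>m x. card (star m x) \<le> M" using ex_card_star by blast
  have "energy m (\<lambda>w. if take k w \<in> A then 1 else 0) \<le> real (card (W k) * (card V0 * (M * M)))"
    if m: "k \<le> m" for m A
  proof -
    let ?f = "\<lambda>w. if take k w \<in> A then 1 else (0::real)"
    define P where "P = (\<Union>a\<in>W k. \<Union>x\<in>V0. star m (word_map F a x) \<times> star m (word_map F a x))"
    have fin_star: "finite (star m x)" for x using finite_words[of m] by (simp add: star_def)
    have finP: "finite P" unfolding P_def using fin_star finite_V0 finite_words by auto
    have et: "eterm ?f w v \<le> (if (w, v) \<in> P then 1 else 0)" if wv: "w \<in> W m" "v \<in> W m" for w v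
    proof (cases "adj w v \<and> take k w \<noteq> take k v")
      case True
      then obtain q where q: "q \<in> kcell w" "q \<in> kcell v" by (auto simp: adj_def)
      then have "q \<in> kcell (take k w) \<inter> kcell (take k v)" using cell_take wv by blast
      then obtain x where "x \<in> V0" "q = word_map F (take k w) x"
        using cell_Int[of "take k w" k "take k v"] take_words wv m True by blast
      then have "(w, v) \<in> P"
        unfolding P_def using q wv take_words[OF wv(1) m] by (auto simp: star_def)
      then show ?thesis by (simp add: eterm_def)
    next
      case False
      then have "eterm ?f w v = 0" using p by (auto simp: eterm_def)
      then show ?thesis by simp
    qed
    have "energy m ?f \<le> (\<Sum>w\<in>W m. \<Sum>v\<in>W m. if (w, v) \<in> P then 1 else 0)"
      unfolding energy_def by (intro sum_mono et)
    also have "\<dots> = (\<Sum>z\<in>W m \<times> W m. if z \<in> P then 1 else 0)"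
      by (subst sum.cartesian_product) (auto intro!: sum.cong)
    also have "\<dots> \<le> real (card P)"
    proof -
      have "card {z \<in> W m \<times> W m. z \<in> P} \<le> card P" using finP by (intro card_mono) auto
      then show ?thesis using finite_words[of m] by (simp add: sum.inter_filter[symmetric])
    qed
    also have "card P \<le> (\<Sum>a\<in>W k. \<Sum>x\<in>V0. M * M)"
      unfolding P_def
      by (intro order_trans[OF card_UN_le] sum_mono finite_words finite_V0)
         (simp add: card_cartesian_product mult_le_mono M)
    finally show ?thesis by (simp add: mult.assoc)
  qed
  then show ?thesis
    by (intro exI[of _ "max 1 (real (card (W k) * (card V0 * (M * M))))"]) (auto simp: le_max_iff_disj)
qed

section \<open>Separating functions and their transport by symmetry\<close>

definition separates :: "nat \<Rightarrow> 'a \<Rightarrow> 'a \<Rightarrow> real \<Rightarrow> bool" where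
  "separates m x y B \<longleftrightarrow> (\<exists>f. (\<forall>w\<in>W m. 0 \<le> f w \<and> f w \<le> 1) \<and> (\<forall>w\<in>star m x. f w = 1) \<and>
     (\<forall>w\<in>star m y. f w = 0) \<and> energy m f \<le> B)"

text \<open>Either the energy is so small that f varies by at most 1/4 on each star, and then
  truncating 2 f - 1/2 to [0, 1] gives the exact values on both stars. Or the energy is bounded
  below, and the indicator of the k0-cells through x, which has bounded energy, serves
  instead.\<close>

lemma ex_separate:
  "\<exists>C\<ge>1. \<forall>m\<ge>k0. \<forall>f. \<forall>x\<in>V0. \<forall>y\<in>V0. \<forall>w\<in>star m x. \<forall>v\<in>star m y.
     x \<noteq> y \<longrightarrow> f w = 1 \<longrightarrow> f v = 0 \<longrightarrow> separates m x y (C * energy m f)"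
proof -
  obtain C1 where C1: "1 \<le> C1" "\<And>m A. k0 \<le> m \<Longrightarrow> energy m (\<lambda>w. if take k0 w \<in> A then 1 else 0) \<le> C1"
    using ex_prefix_energy[of k0] by blast
  define C where "C = C1 * 4 powr p"
  have C: "C1 \<le> C" "2 powr p \<le> C"
  proof -
    have four: "1 \<le> (4::real) powr p" using p by (intro ge_one_powr_ge_zero) auto
    show "C1 \<le> C" using mult_left_mono[OF four, of C1] C1(1) by (simp add: C_def)
    have "2 powr p \<le> 1 * 4 powr p" using p by (simp add: powr_mono2)
    also have "\<dots> \<le> C" unfolding C_def using C1(1) by (intro mult_right_mono) auto
    finally show "2 powr p \<le> C" .
  qed
  have "separates m x y (C * energy m f)"
    if m: "k0 \<le> m" and xy: "x \<in> V0" "y \<in> V0" "x \<noteq> y" and w: "w \<in> star m x" "f w = 1"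
      and v: "v \<in> star m y" "f v = 0" for m f x y w v
  proof (cases "energy m f \<le> (1/4) powr p")
    case True
    define g where "g u = max 0 (min 1 (2 * f u - 1/2))" for u
    have near: "\<bar>f a - f c\<bar> \<le> 1/4" if "a \<in> star m z" "c \<in> star m z" for a c z
    proof -
      have "\<bar>f a - f c\<bar> powr p \<le> energy m f"
        using that star_adj[OF that] by (intro adj_le_energy) (auto simp: star_def)
      then have "\<bar>f a - f c\<bar> powr p \<le> (1/4) powr p" using True by simp
      then show ?thesis using p
        by (meson abs_ge_zero divide_nonneg_nonneg linorder_not_le order_less_trans powr_less_mono2
            zero_le_numeral zero_le_one zero_less_one)
    qed
    have "energy m g \<le> 2 powr p * energy m f"
      by (intro energy_le_scale) (auto simp: g_def max_def min_def abs_if)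
    also have "\<dots> \<le> C * energy m f" using C energy_nonneg[of m f] by (intro mult_right_mono) auto
    finally have "energy m g \<le> C * energy m f" .
    moreover have "g a = 1" if "a \<in> star m x" for a
      using near[OF that w(1)] w(2) by (auto simp: g_def abs_if split: if_splits)
    moreover have "g a = 0" if "a \<in> star m y" for a
      using near[OF that v(1)] v(2) by (auto simp: g_def abs_if split: if_splits)
    ultimately show ?thesis unfolding separates_def by (intro exI[of _ g]) (auto simp: g_def)
  next
    case False
    define g where "g u = (if take k0 u \<in> star k0 x then 1 else (0::real))" for u
    have "(1/4) powr p * 4 powr p \<le> energy m f * 4 powr p"
      using False by (intro mult_right_mono) auto
    then have "1 \<le> energy m f * 4 powr p" by (simp add: powr_mult[symmetric])
    then have "C1 * 1 \<le> C1 * (energy m f * 4 powr p)" using C1(1) by (intro mult_left_mono) auto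
    then have "energy m g \<le> C * energy m f"
      using C1(2)[OF m, of "star k0 x"] by (simp add: C_def g_def[abs_def] ac_simps)
    moreover have tk: "take k0 u \<in> star k0 z" if "u \<in> star m z" for u z
      using that m take_words[of u m k0] cell_take[of u m k0] by (auto simp: star_def)
    moreover have "take k0 u \<notin> star k0 x" if "u \<in> star m y" for u
      using tk[OF that] star_disjoint[OF order_refl xy, of "take k0 u"] by (auto simp: star_def)
    ultimately show ?thesis unfolding separates_def by (intro exI[of _ g]) (auto simp: g_def)
  qed
  moreover have "1 \<le> C" using C C1 by simp
  ultimately show ?thesis by (intro exI[of _ C]) auto
qed

lemma separates_U:
  assumes "separates m a c B" "x \<in> V0" "y \<in> V0" "x \<noteq> y"
  shows "separates m (U x y a) (U x y c) B"
proof -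
  obtain f where f: "\<forall>w\<in>W m. 0 \<le> f w \<and> f w \<le> 1" "\<forall>w\<in>star m a. f w = 1"
     "\<forall>w\<in>star m c. f w = 0" "energy m f \<le> B" using assms(1) unfolding separates_def by auto
  have st: "rword x y w \<in> star m z" if "w \<in> star m (U x y z)" for w z
  proof -
    have w: "w \<in> W m" "U x y z \<in> kcell w" using that by (auto simp: star_def)
    then have "U x y (U x y z) \<in> U x y ` kcell w" by (intro imageI)
    then show ?thesis using rword[OF assms(2-4) w(1)] by (simp add: star_def bisector_reflection_inverse)
  qed
  have "energy m (\<lambda>w. f (rword x y w)) = (\<Sum>w\<in>W m. \<Sum>v\<in>W m. eterm f (rword x y w) (rword x y v))"
    unfolding energy_def eterm_def
    by (intro sum.cong refl) (simp add: rword_adj[OF assms(2-4)])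
  also have "\<dots> = (\<Sum>w\<in>W m. \<Sum>v\<in>W m. eterm f (rword x y w) v)"
    by (intro sum.cong refl sum_rword assms)
  also have "\<dots> = energy m f"
    unfolding energy_def by (rule sum_rword[OF assms(2-4), of "\<lambda>w. \<Sum>v\<in>W m. eterm f w v"])
  finally have "energy m (\<lambda>w. f (rword x y w)) \<le> B" using f by simp
  then show ?thesis unfolding separates_def using f st rword(1)[OF assms(2-4)]
    by (intro exI[of _ "\<lambda>w. f (rword x y w)"]) blast
qed

text \<open>
  Folding along the bisector of \<open>y\<close> and \<open>z\<close> onto the side of \<open>y\<close> is a graph morphism on cells,
  because cells meeting both sides are symmetric.
\<close>
lemma separates_fold:
  assumes "separates m x y B" "x \<in> V0" "y \<in> V0" "z \<in> V0" "y \<noteq> z" "dist x y \<le> dist x z"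
  shows "separates m x z (4 * B)"
proof -
  obtain f where f: "\<forall>w\<in>W m. 0 \<le> f w \<and> f w \<le> 1" "\<forall>w\<in>star m x. f w = 1"
     "\<forall>w\<in>star m y. f w = 0" "energy m f \<le> B" using assms(1) unfolding separates_def by auto
  let ?r = "rword y z"
  note yz = assms(3-5)
  define near where "near w \<longleftrightarrow> (\<exists>q\<in>kcell w. dist q y < dist q z)" for w
  define fd where "fd w = (if near w then w else ?r w)" for w
  have rU: "U y z q \<in> kcell (?r w)" if "q \<in> kcell w" "w \<in> W m" for q w
    using rword(2)[OF yz that(2)] that(1) by simp
  have straddle: "?r w = w" if "near w" "q \<in> kcell w" "dist q z < dist q y" "w \<in> W m" for w q
    using that by (intro rword_straddle[OF yz]) (auto simp: near_def meets_both_sides_def)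
  have fdW: "fd w \<in> W m" if "w \<in> W m" for w using that rword(1)[OF yz] by (simp add: fd_def)
  \<comment> \<open>A common point of a near and a far cell lies either strictly beyond the
    bisector, and then w is its own reflection, or on the bisector, and then the reflection fixes
    it.\<close>
  have mixed: "adj w (?r v)"
    if wv: "adj w v" "near w" "\<not> near v" "w \<in> W m" "v \<in> W m" for w v
  proof -
    obtain q where q: "q \<in> kcell w" "q \<in> kcell v" using wv(1) by (auto simp: adj_def)
    have "dist q z \<le> dist q y" using wv(3) q(2) by (auto simp: near_def not_less)
    then consider "dist q z < dist q y" | "dist q y = dist q z" by linarith
    then show ?thesis
    proof cases
      case 1
      then have "?r w = w" using straddle wv q by blast
      then show ?thesis using rword_adj[OF yz wv(4,5)] wv(1) by simp
    next
      case 2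
      then have "U y z q = q" by (rule bisector_reflection_eq_self)
      then show ?thesis using rU[OF q(2) wv(5)] q(1) adjI by metis
    qed
  qed
  have fd_adj: "adj (fd w) (fd v)" if "adj w v" "w \<in> W m" "v \<in> W m" for w v
    using that mixed[of w v] mixed[of v w] rword_adj[OF yz that(2,3)] adj_sym
    by (auto simp: fd_def)
  have fx: "fd w \<in> star m x" if w: "w \<in> star m x" for w
  proof (cases "near w")
    case False
    have wW: "w \<in> W m" "x \<in> kcell w" using w by (auto simp: star_def)
    then have "dist x z \<le> dist x y" using False by (auto simp: near_def not_less)
    then have "U y z x = x" using assms(6) by (intro bisector_reflection_eq_self) simp
    then show ?thesis using rU[OF wW(2,1)] fdW[OF wW(1)] False by (simp add: star_def fd_def)
  qed (use w in \<open>simp add: fd_def\<close>)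
  have fz: "fd w \<in> star m y" if w: "w \<in> star m z" for w
  proof -
    have wW: "w \<in> W m" "z \<in> kcell w" using w by (auto simp: star_def)
    have "fd w = ?r w" using straddle[of w z] wW yz by (auto simp: fd_def)
    then show ?thesis using rU[OF wW(2,1)] fdW[OF wW(1)] by (simp add: star_def bisector_reflection_swap)
  qed
  \<comment> \<open>Each end of a folded edge is either the original cell or its reflection. Each of
    the four combinations, summed over all pairs, reproduces the energy; hence the factor 4.\<close>
  have et: "eterm (\<lambda>w. f (fd w)) w v
      \<le> eterm f w v + eterm f (?r w) v + eterm f w (?r v) + eterm f (?r w) (?r v)"
    if "w \<in> W m" "v \<in> W m" for w v
  proof (cases "adj w v")
    case True
    then have "eterm (\<lambda>w. f (fd w)) w v = eterm f (fd w) (fd v)"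
      using fd_adj that by (simp add: eterm_def)
    also have "\<dots> \<le> eterm f w v + eterm f (?r w) v + eterm f w (?r v) + eterm f (?r w) (?r v)"
      using eterm_nonneg[of f w v] eterm_nonneg[of f "?r w" v] eterm_nonneg[of f w "?r v"]
        eterm_nonneg[of f "?r w" "?r v"] by (auto simp: fd_def)
    finally show ?thesis .
  qed (simp add: eterm_def[of "\<lambda>w. f (fd w)"] eterm_nonneg)
  have "energy m (\<lambda>w. f (fd w)) \<le> (\<Sum>w\<in>W m. \<Sum>v\<in>W m.
      eterm f w v + eterm f (?r w) v + eterm f w (?r v) + eterm f (?r w) (?r v))"
    unfolding energy_def by (intro sum_mono et)
  also have "\<dots> = 4 * energy m f"
    using sum_rword[OF yz, of "\<lambda>w. \<Sum>v\<in>W m. eterm f w v" m]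
    by (simp add: sum.distrib energy_def sum_rword[OF yz, of "eterm f _"] flip: sum_distrib_left)
  also have "\<dots> \<le> 4 * B" using f by simp
  finally show ?thesis unfolding separates_def using f fx fz fdW
    by (intro exI[of _ "\<lambda>w. f (fd w)"]) blast
qed

text \<open>Two reflections suffice: one carries a to x and c to a nearest neighbour c' of x, the
  other exchanges c' and y and fixes x, which is equidistant from both.\<close>

lemma separates_short_edges:
  assumes "separates m a c B" "(a, c) \<in> short_edges" "(x, y) \<in> short_edges"
  shows "separates m x y B"
proof -
  have V: "a \<in> V0" "c \<in> V0" "x \<in> V0" "y \<in> V0" "dist x y = vgap"
    using assms by (auto simp: short_edges_def)
  have "\<exists>c'. (x, c') \<in> short_edges \<and> separates m x c' B"
  proof (cases "a = x")
    case True
    then show ?thesis using assms by blast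
  next
    case False
    then show ?thesis
      using separates_U[OF assms(1) V(1,3)] short_edge_U[OF V(1,3) _ assms(2)]
      by (auto simp: bisector_reflection_swap)
  qed
  then obtain c' where c': "(x, c') \<in> short_edges" "separates m x c' B" by blast
  show ?thesis
  proof (cases "c' = y")
    case False
    have "c' \<in> V0" "dist x c' = dist x y" using c' V by (auto simp: short_edges_def)
    then show ?thesis using separates_U[OF c'(2) _ V(4) False] bisector_reflection_eq_self[of x c' y]
      by (simp add: bisector_reflection_swap)
  qed (use c' in simp)
qed

text \<open>Choose a nearest neighbour y of x. It is no farther from x than z is, so folding turns
  separation from y into separation from z.\<close>

lemma separates_all:
  assumes "separates m a c B" "0 \<le> B" "(a, c) \<in> short_edges" "x \<in> V0" "z \<in> V0" "x \<noteq> z"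
  shows "separates m x z (4 * B)"
proof -
  obtain y where y: "(x, y) \<in> short_edges" using ex_short_edge[OF assms(4)] by blast
  have sw: "separates m x y B" by (rule separates_short_edges[OF assms(1,3) y])
  have V: "y \<in> V0" "dist x y = vgap" using y by (auto simp: short_edges_def)
  show ?thesis
  proof (cases "y = z")
    case True
    then show ?thesis using sw assms(2) unfolding separates_def by fastforce
  next
    case False
    then show ?thesis using separates_fold[OF sw assms(4) V(1) assms(5)] vgap_le[OF assms(4-6)] V by simp
  qed
qed

text \<open>Take the minimum over y of the separating functions. A difference of minima is at most
  the largest of the differences, so the energies add up.\<close>

lemma bump_of_separates:
  fixes B :: real
  assumes sw: "\<And>y. y \<in> V0 \<Longrightarrow> y \<noteq> x \<Longrightarrow> separates m x y B"
  shows "\<exists>f. (\<forall>w\<in>W m. 0 \<le> f w \<and> f w \<le> 1) \<and> (\<forall>w\<in>star m x. f w = 1) \<and>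
     (\<forall>y\<in>V0 - {x}. \<forall>w\<in>star m y. f w = 0) \<and> energy m f \<le> card V0 * B"
proof -
  have "\<exists>f. (\<forall>w\<in>W m. 0 \<le> f w \<and> f w \<le> 1) \<and> (\<forall>w\<in>star m x. f w = 1) \<and>
     (\<forall>y\<in>T. \<forall>w\<in>star m y. f w = 0) \<and> energy m f \<le> card T * B"
    if "finite T" "T \<subseteq> V0 - {x}" for T
    using that
  proof (induction T rule: finite_induct)
    case empty
    have "energy m (\<lambda>_. 1) = 0" using p by (simp add: energy_def eterm_def cong: if_cong)
    then show ?case by (intro exI[of _ "\<lambda>_. 1"]) simp
  next
    case (insert y T)
    obtain f where f: "\<forall>w\<in>W m. 0 \<le> f w \<and> f w \<le> 1" "\<forall>w\<in>star m x. f w = 1"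
      "\<forall>y\<in>T. \<forall>w\<in>star m y. f w = 0" "energy m f \<le> card T * B" using insert by auto
    obtain g where g: "\<forall>w\<in>W m. 0 \<le> g w \<and> g w \<le> 1" "\<forall>w\<in>star m x. g w = 1"
      "\<forall>w\<in>star m y. g w = 0" "energy m g \<le> B" using sw[of y] insert.prems unfolding separates_def by auto
    have star: "w \<in> W m" if "w \<in> star m z" for w z using that by (simp add: star_def)
    define h where "h w = min (f w) (g w)" for w
    have et: "eterm h w v \<le> eterm f w v + eterm g w v" for w v
    proof (cases "adj w v")
      case True
      have "\<bar>h w - h v\<bar> \<le> max \<bar>f w - f v\<bar> \<bar>g w - g v\<bar>" by (auto simp: h_def min_def max_def abs_if)
      then have "\<bar>h w - h v\<bar> powr p \<le> max \<bar>f w - f v\<bar> \<bar>g w - g v\<bar> powr p"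
        using p by (intro powr_mono2) auto
      also have "\<dots> \<le> \<bar>f w - f v\<bar> powr p + \<bar>g w - g v\<bar> powr p" by (auto simp: max_def)
      finally show ?thesis using True by (simp add: eterm_def)
    qed (simp add: eterm_def)
    have "energy m h \<le> (\<Sum>w\<in>W m. \<Sum>v\<in>W m. eterm f w v + eterm g w v)"
      unfolding energy_def by (intro sum_mono et)
    also have "\<dots> = energy m f + energy m g" by (simp add: energy_def sum.distrib)
    also have "\<dots> \<le> card (insert y T) * B" using f g insert.hyps by (simp add: algebra_simps)
    finally have "energy m h \<le> card (insert y T) * B" .
    moreover have "h w = 0" if "z \<in> insert y T" "w \<in> star m z" for z w
    proof (cases "z = y")
      case True then show ?thesis using that f(1) g(3) star[OF that(2)] by (auto simp: h_def)
    next
      case False then show ?thesis using that f(3) g(1) star[OF that(2)] by (auto simp: h_def)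
    qed
    moreover have "\<forall>w\<in>W m. 0 \<le> h w \<and> h w \<le> 1" "\<forall>w\<in>star m x. h w = 1"
      using f(1,2) g(1,2) by (auto simp: h_def)
    ultimately show ?case by blast
  qed
  from this[of "V0 - {x}"] obtain f where f: "\<forall>w\<in>W m. 0 \<le> f w \<and> f w \<le> 1" "\<forall>w\<in>star m x. f w = 1"
     "\<forall>y\<in>V0 - {x}. \<forall>w\<in>star m y. f w = 0" "energy m f \<le> card (V0 - {x}) * B"
    using finite_V0 by auto
  have "0 \<le> B"
    if "V0 - {x} \<noteq> {}" using that sw energy_nonneg[of m] unfolding separates_def by (metis Diff_iff all_not_in_conv insertCI order_trans)
  then have "card (V0 - {x}) * B \<le> card V0 * B"
    using finite_V0 V0_other V0_ne
    by (cases "V0 - {x} = {}") (auto intro!: mult_right_mono card_mono)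
  then show ?thesis using f by (intro exI[of _ f]) auto
qed

end

section \<open>Growth of the resistances and the Poincare inequality\<close>

lemma sum_powr_le:
  fixes a :: "'b \<Rightarrow> real"
  assumes "finite I" "\<And>i. i \<in> I \<Longrightarrow> 0 \<le> a i" "0 < p"
  shows "(\<Sum>i\<in>I. a i) powr p \<le> card I powr p * (\<Sum>i\<in>I. a i powr p)"
proof (cases "I = {}")
  case False
  have "Max (a ` I) \<in> a ` I" using assms(1) False by (intro Max_in) auto
  then obtain j where j: "j \<in> I" "a j = Max (a ` I)" by auto
  have le: "a i \<le> a j" if "i \<in> I" for i using j that assms(1) by simp
  have "(\<Sum>i\<in>I. a i) \<le> card I * a j" using le by (intro sum_bounded_above) auto
  then have "(\<Sum>i\<in>I. a i) powr p \<le> (card I * a j) powr p"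
    using assms by (intro powr_mono2 sum_nonneg) auto
  also have "\<dots> = card I powr p * a j powr p" using assms j by (simp add: powr_mult)
  also have "a j powr p \<le> (\<Sum>i\<in>I. a i powr p)" using assms(1) j by (intro member_le_sum) auto
  finally show ?thesis by (simp add: mult_left_mono)
qed simp

text \<open>The factor 3/2 is below 2 \<le> N, which is what closes the induction for the Poincare
  inequality. The constant on b comes from comparing b with e * a, where (1 + e)^p = 3/2.\<close>

lemma ex_powr_add_le:
  fixes p :: real
  assumes "0 < p"
  shows "\<exists>C\<ge>1. \<forall>a b. 0 \<le> a \<longrightarrow> 0 \<le> b \<longrightarrow> (a + b) powr p \<le> 3/2 * a powr p + C * b powr p"
proof -
  define e where "e = (3/2) powr (1/p) - 1"
  have e: "0 < e" using assms by (simp add: e_def)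
  have e': "(1 + e) powr p = 3/2" using assms by (simp add: e_def powr_powr)
  have "(a + b) powr p \<le> 3/2 * a powr p + (1 / e + 1) powr p * b powr p" if "0 \<le> a" "0 \<le> b" for a b
  proof (cases "b \<le> e * a")
    case True
    have "(a + b) powr p \<le> ((1 + e) * a) powr p"
      using True that assms by (intro powr_mono2) (auto simp: algebra_simps)
    also have "\<dots> = 3/2 * a powr p" using e that by (simp add: powr_mult e')
    finally show ?thesis by (simp add: add_increasing2)
  next
    case False
    then have "a \<le> b / e" using e by (simp add: pos_le_divide_eq mult.commute)
    then have "a + b \<le> (1 / e + 1) * b" by (simp add: algebra_simps)
    then have "(a + b) powr p \<le> ((1 / e + 1) * b) powr p"
      using that assms by (intro powr_mono2) auto
    also have "\<dots> = (1 / e + 1) powr p * b powr p" using e that by (simp add: powr_mult)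
    finally show ?thesis by (simp add: add_increasing)
  qed
  moreover have "1 \<le> (1 / e + 1) powr p" using e assms by (intro ge_one_powr_ge_zero) auto
  ultimately show ?thesis by blast
qed

lemma relpow_diff_le:
  fixes g :: "'b \<Rightarrow> real"
  assumes "(x, y) \<in> r ^^ n" "\<And>a c. (a, c) \<in> r \<Longrightarrow> \<bar>g a - g c\<bar> \<le> t"
  shows "\<bar>g x - g y\<bar> \<le> n * t"
  using assms(1)
proof (induction n arbitrary: y)
  case (Suc n)
  then obtain z where z: "(x, z) \<in> r ^^ n" "(z, y) \<in> r" by auto
  then show ?case using Suc.IH[OF z(1)] assms(2)[OF z(2)] by (simp add: algebra_simps)
qed simp

context nested_fractal_energy
begin

section \<open>Bumps of optimal energy\<close>

lemma ex_chain_bound: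
  "\<exists>L\<ge>1. \<forall>x\<in>V0. \<forall>y\<in>V0. \<exists>n. real n \<le> L \<and> (x, y) \<in> short_edges ^^ n"
proof -
  have "\<exists>L\<ge>1. \<forall>s\<in>V0 \<times> V0. \<exists>n. real n \<le> L \<and> s \<in> short_edges ^^ n"
  proof (rule finite_bound_choice)
    show "finite (V0 \<times> V0)" using finite_V0 by simp
    fix s assume "s \<in> V0 \<times> V0"
    then have "s \<in> short_edges\<^sup>*" using short_edges_connected by auto
    then obtain n where "s \<in> short_edges ^^ n" by (metis rtrancl_imp_relpow)
    then show "\<exists>c. \<exists>n. real n \<le> c \<and> s \<in> short_edges ^^ n" by blast
  qed (meson order_trans)
  then show ?thesis by blast
qed

definition bump :: "nat \<Rightarrow> 'a \<Rightarrow> (nat list \<Rightarrow> real) \<Rightarrow> bool" where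
  "bump m x f \<longleftrightarrow> (\<forall>w\<in>W m. 0 \<le> f w \<and> f w \<le> 1) \<and> (\<forall>w\<in>star m x. f w = 1) \<and>
     (\<forall>y\<in>V0 - {x}. \<forall>w\<in>star m y. f w = 0)"

text \<open>Along a chain of at most L shortest edges from x to y the corner values of f change by
  1, so some edge (a, c) carries a change above 1 / (L + 1). Rescaling f on that edge gives a
  function separating a from c, and symmetry moves it to every pair of boundary points.\<close>

lemma ex_bump_le:
  "\<exists>C\<ge>1. \<forall>m\<ge>k0. \<forall>f. \<forall>x\<in>V0. \<forall>y\<in>V0. \<forall>z\<in>V0. f (corner m x) = 1 \<longrightarrow> f (corner m y) = 0 \<longrightarrow>
     (\<exists>g. bump m z g \<and> energy m g \<le> C * energy m f)"
proof -
  obtain L where L: "1 \<le> L" "\<And>x y. x \<in> V0 \<Longrightarrow> y \<in> V0 \<Longrightarrow> \<exists>n. real n \<le> L \<and> (x, y) \<in> short_edges ^^ n"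
    using ex_chain_bound by blast
  obtain C1 where "1 \<le> C1 \<and> (\<forall>m\<ge>k0. \<forall>f. \<forall>x\<in>V0. \<forall>y\<in>V0. \<forall>w\<in>star m x. \<forall>v\<in>star m y.
     x \<noteq> y \<longrightarrow> f w = 1 \<longrightarrow> f v = 0 \<longrightarrow> separates m x y (C1 * energy m f))"
    using ex_separate by (rule exE)
  note C1 = this[THEN conjunct1] this[THEN conjunct2, rule_format]
  define C where "C = card V0 * (4 * (C1 * (L + 1) powr p))"
  have "\<exists>g. bump m z g \<and> energy m g \<le> C * energy m f"
    if m: "k0 \<le> m" and V: "x \<in> V0" "y \<in> V0" "z \<in> V0" and f: "f (corner m x) = 1" "f (corner m y) = 0"
    for m f x y z
  proof -
    define g where "g a = f (corner m a)" for a
    have "\<exists>a c. (a, c) \<in> short_edges \<and> 1 / (L + 1) < \<bar>g a - g c\<bar>"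
    proof (rule ccontr)
      assume c: "\<not> ?thesis"
      obtain n where n: "real n \<le> L" "(x, y) \<in> short_edges ^^ n" using L(2)[OF V(1,2)] by blast
      have "\<bar>g x - g y\<bar> \<le> n * (1 / (L + 1))" using c by (intro relpow_diff_le[OF n(2)]) (auto simp: not_less)
      then have "1 \<le> n / (L + 1)" using f by (simp add: g_def)
      then show False using n(1) L(1) by (simp add: field_simps)
    qed
    then obtain a c where ac: "(a, c) \<in> short_edges" "1 / (L + 1) < \<bar>g a - g c\<bar>" by blast
    define d where "d = g a - g c"
    have "0 < 1 / (L + 1)" using L(1) by simp
    then have d0: "0 < \<bar>d\<bar>" using ac(2) unfolding d_def by linarith
    have "1 < \<bar>d\<bar> * (L + 1)" using ac(2) L(1) unfolding d_def by (subst (asm) pos_divide_less_eq) auto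
    then have d: "1 \<le> (L + 1) * \<bar>d\<bar>" "0 < \<bar>d\<bar>" using d0 by (simp_all add: mult.commute)
    define f' where "f' w = (f w - g c) / d" for w
    have "energy m f' \<le> (L + 1) powr p * energy m f"
    proof (rule energy_le_scale)
      fix w v
      have "\<bar>f' w - f' v\<bar> = \<bar>f w - f v\<bar> / \<bar>d\<bar>" by (simp add: f'_def flip: diff_divide_distrib)
      also have "\<dots> \<le> (L + 1) * \<bar>f w - f v\<bar>"
        using d mult_right_mono[OF d(1), of "\<bar>f w - f v\<bar>"] by (simp add: divide_le_eq ac_simps)
      finally show "\<bar>f' w - f' v\<bar> \<le> (L + 1) * \<bar>f w - f v\<bar>" .
    qed (use L in simp)
    then have le: "C1 * energy m f' \<le> C1 * ((L + 1) powr p * energy m f)" (is "_ \<le> ?B")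
      using C1(1) by (intro mult_left_mono) auto
    have acV: "a \<in> V0" "c \<in> V0" "a \<noteq> c" using ac vgap_pos by (auto simp: short_edges_def)
    have "separates m a c (C1 * energy m f')"
      using acV d(2) by (intro C1(2)[OF m _ _ corner_star corner_star]) (auto simp: f'_def g_def d_def)
    then have sw0: "separates m a c ?B" using le unfolding separates_def by (meson order_trans)
    have B0: "0 \<le> ?B" using C1(1) energy_nonneg[of m f] by simp
    have sw: "separates m z y (4 * ?B)" if "y \<in> V0" "y \<noteq> z" for y
      using separates_all[OF sw0 B0 ac(1) V(3) that(1)] that(2) by blast
    have "\<exists>h. bump m z h \<and> energy m h \<le> card V0 * (4 * ?B)"
      using bump_of_separates[of z m "4 * ?B"] sw unfolding bump_def by blast
    then show ?thesis by (simp add: C_def ac_simps)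
  qed
  moreover have "1 \<le> C"
  proof -
    have "1 \<le> real (card V0)" using finite_V0 V0_ne by (simp add: Suc_le_eq card_gt_0_iff)
    moreover have "1 \<le> (L + 1) powr p" using L p by (intro ge_one_powr_ge_zero) auto
    moreover have "1 * 1 \<le> C1 * (L + 1) powr p" using calculation C1 by (intro mult_mono) auto
    ultimately have "1 * 1 \<le> C" unfolding C_def by (intro mult_mono) auto
    then show ?thesis by simp
  qed
  ultimately show ?thesis by (intro exI[of _ C]) auto
qed

text \<open>If \<open>res m\<close> \<ge> 2, then \<open>res m / 2\<close> is at least 1 and below
  the infimum, hence not a bound; a violating f, normalised, is the witness. If \<open>res m\<close>
  < 2, bounded energy is enough and an indicator of k0-cells works.\<close>

lemma ex_witness:
  "\<exists>C\<ge>1. \<forall>m\<ge>k0. \<exists>f. \<exists>x\<in>V0. \<exists>y\<in>V0. f (corner m x) = 1 \<and> f (corner m y) = 0 \<and> energy m f \<le> C / res m"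
proof -
  obtain C1 where C1: "1 \<le> C1" "\<And>m A. k0 \<le> m \<Longrightarrow> energy m (\<lambda>w. if take k0 w \<in> A then 1 else 0) \<le> C1"
    using ex_prefix_energy[of k0] by blast
  have "\<exists>f. \<exists>x\<in>V0. \<exists>y\<in>V0. f (corner m x) = 1 \<and> f (corner m y) = 0 \<and> energy m f \<le> (2 * C1) / res m"
    if m: "k0 \<le> m" for m
  proof (cases "2 \<le> res m")
    case True
    define A where "A = res m / 2"
    have A: "1 \<le> A" using True by (simp add: A_def)
    have "\<not> res_bound m A" using res_le[OF A, of m] True by (auto simp: A_def)
    then obtain f x y where xy: "x \<in> V0" "y \<in> V0"
        and gt: "A * energy m f < \<bar>f (corner m x) - f (corner m y)\<bar> powr p"
      unfolding res_bound_def by (auto simp: not_le)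
    define d where "d = f (corner m x) - f (corner m y)"
    have dp: "0 < \<bar>d\<bar> powr p" using gt A energy_nonneg[of m f] unfolding d_def
      by (meson le_less_trans less_le_trans mult_nonneg_nonneg zero_le_one order_trans)
    then have d: "d \<noteq> 0" by auto
    define g where "g w = (f w - f (corner m y)) / d" for w
    have "energy m g \<le> (1 / \<bar>d\<bar>) powr p * energy m f"
      by (intro energy_le_scale) (auto simp: g_def simp flip: diff_divide_distrib)
    also have "\<dots> = energy m f / \<bar>d\<bar> powr p" by (simp add: powr_divide)
    also have "\<dots> \<le> 1 / A" using gt dp A by (simp add: d_def divide_le_eq le_divide_eq mult.commute)
    also have "\<dots> = 2 / res m" by (simp add: A_def)
    also have "\<dots> \<le> (2 * C1) / res m" using C1 res_ge_1[of m] by (intro divide_right_mono) auto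
    finally have "g (corner m x) = 1 \<and> g (corner m y) = 0 \<and> energy m g \<le> (2 * C1) / res m"
      using d by (simp add: g_def d_def)
    then show ?thesis using xy by blast
  next
    case False
    obtain x y where xy: "x \<in> V0" "y \<in> V0" "x \<noteq> y" using V0_ne V0_other by blast
    define g where "g u = (if take k0 u \<in> star k0 x then 1 else (0::real))" for u
    have tk: "take k0 (corner m z) = corner k0 z" for z using m by (simp add: corner_def min_def)
    have "corner k0 y \<notin> star k0 x"
      using star_disjoint[OF order_refl xy, of "corner k0 y"] corner_mem[OF xy(2)] by auto
    moreover have "energy m g \<le> (2 * C1) / res m"
    proof -
      have "energy m g \<le> C1" unfolding g_def using C1(2)[OF m] by blast
      also have "\<dots> \<le> (2 * C1) / res m" using False res_ge_1[of m] C1 by (simp add: le_divide_eq mult.commute)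
      finally show ?thesis .
    qed
    moreover have "g (corner m x) = 1" using corner_star[OF xy(1), of k0] by (simp add: g_def tk)
    ultimately have "g (corner m x) = 1 \<and> g (corner m y) = 0 \<and> energy m g \<le> (2 * C1) / res m"
      by (simp add: g_def tk)
    then show ?thesis using xy(1,2) by blast
  qed
  moreover have "1 \<le> 2 * C1" using C1(1) by simp
  ultimately show ?thesis by blast
qed

lemma ex_bump:
  "\<exists>C\<ge>1. \<forall>m\<ge>k0. \<forall>z\<in>V0. \<exists>g. bump m z g \<and> energy m g \<le> C / res m"
proof -
  obtain C where "1 \<le> C \<and> (\<forall>m\<ge>k0. \<forall>f. \<forall>x\<in>V0. \<forall>y\<in>V0. \<forall>z\<in>V0. f (corner m x) = 1 \<longrightarrow>
      f (corner m y) = 0 \<longrightarrow> (\<exists>g. bump m z g \<and> energy m g \<le> C * energy m f))"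
    using ex_bump_le by (rule exE)
  note C = this[THEN conjunct1] this[THEN conjunct2, rule_format]
  obtain D where D: "1 \<le> D" "\<And>m. k0 \<le> m \<Longrightarrow> \<exists>f. \<exists>x\<in>V0. \<exists>y\<in>V0. f (corner m x) = 1 \<and> f (corner m y) = 0
      \<and> energy m f \<le> D / res m"
    using ex_witness by blast
  have "\<exists>g. bump m z g \<and> energy m g \<le> (C * D) / res m" if m: "k0 \<le> m" "z \<in> V0" for m z
  proof -
    obtain f x y where f: "x \<in> V0" "y \<in> V0" "f (corner m x) = 1" "f (corner m y) = 0" "energy m f \<le> D / res m"
      using D(2)[OF m(1)] by blast
    obtain g where g: "bump m z g" "energy m g \<le> C * energy m f" using C(2)[OF m(1) f(1,2) m(2) f(3,4)] by blast
    have "C * energy m f \<le> C * (D / res m)" using f(5) C(1) by (intro mult_left_mono) auto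
    then show ?thesis using g by auto
  qed
  moreover have "1 * 1 \<le> C * D" using C D by (intro mult_mono) auto
  ultimately show ?thesis by (intro exI[of _ "C * D"]) auto
qed

text \<open>
  A function on the \<open>n\<close>-cells is interpolated inside every cell by bumps at its vertices; the
  value attached to a vertex depends on the vertex only, so no energy arises across cells.
\<close>
lemma interpolation_energy:
  assumes "\<And>z. z \<in> V0 \<Longrightarrow> bump m z (\<phi> z)" "\<And>z. z \<in> V0 \<Longrightarrow> energy m (\<phi> z) \<le> e"
  shows "\<exists>h. energy (n + m) h \<le> (card V0 powr p * card V0 * e) * energy n f \<and>
    (\<forall>x\<in>V0. h (corner (n + m) x) = f (corner n x))"
proof -
  \<comment> \<open>An n-cell attached to the point q alone. On \<open>V0\<close> it is the corner
    cell, so that h keeps the boundary values of f.\<close>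
  define vc where "vc q = (if q \<in> V0 then corner n q else (SOME w. w \<in> W n \<and> q \<in> kcell w))" for q
  have vc: "vc q \<in> W n" "q \<in> kcell (vc q)" if q: "q \<in> K" for q
  proof -
    have "\<exists>w. w \<in> W n \<and> q \<in> kcell w" using ex_cell[OF q] by blast
    then have "(SOME w. w \<in> W n \<and> q \<in> kcell w) \<in> W n \<and> q \<in> kcell (SOME w. w \<in> W n \<and> q \<in> kcell w)"
      by (rule someI_ex)
    then show "vc q \<in> W n" "q \<in> kcell (vc q)" by (auto simp: vc_def corner_words corner_mem)
  qed
  \<comment> \<open>The cell attached to F_w z meets w, so the p-th power of this difference is a
    single term of the energy of f.\<close>
  define d where "d w z = f (vc (word_map F w z)) - f w" for w z
  define h where "h u = f (take n u) + (\<Sum>z\<in>V0. d (take n u) z * \<phi> z (drop n u))" for u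
  have h: "h (w @ w') = f w + (\<Sum>z\<in>V0. d w z * \<phi> z w')" if "w \<in> W n" for w w'
    using that by (simp add: h_def words_length)
  have h_star: "h (w @ w') = f (vc (word_map F w x))"
    if "w \<in> W n" "x \<in> V0" "w' \<in> star m x" for w w' x
  proof -
    have "(\<Sum>z\<in>V0. d w z * \<phi> z w') = (\<Sum>z\<in>V0. if z = x then d w x else 0)"
    proof (rule sum.cong[OF refl])
      fix z assume z: "z \<in> V0"
      show "d w z * \<phi> z w' = (if z = x then d w x else 0)"
        using assms(1)[OF z] that z unfolding bump_def by auto
    qed
    then show ?thesis using that finite_V0 by (simp add: h d_def)
  qed
  define s where "s w = (\<Sum>v\<in>W n. eterm f w v)" for w
  have d_le: "\<bar>d w z\<bar> powr p \<le> s w" if "w \<in> W n" "z \<in> V0" for w z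
  proof -
    have q: "word_map F w z \<in> kcell w" using that V0_subset_K by (auto simp: cell_def)
    then have qK: "word_map F w z \<in> K" using cell_subset_K that by blast
    have "\<bar>d w z\<bar> powr p = eterm f w (vc (word_map F w z))"
      using adjI[OF q vc(2)[OF qK]] by (simp add: eterm_def d_def abs_minus_commute)
    also have "\<dots> \<le> s w" unfolding s_def using vc(1)[OF qK]
      by (intro member_le_sum) (auto simp: eterm_nonneg finite_words)
    finally show ?thesis .
  qed
  have self: "block m h w w \<le> (card V0 powr p * card V0 * e) * s w" if w: "w \<in> W n" for w
  proof -
    have et: "eterm h (w @ w') (w @ v') \<le> card V0 powr p * (\<Sum>z\<in>V0. \<bar>d w z\<bar> powr p * eterm (\<phi> z) w' v')"
      if "w' \<in> W m" "v' \<in> W m" for w' v'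
    proof (cases "adj w' v'")
      case True
      have "\<bar>h (w @ w') - h (w @ v')\<bar> = \<bar>\<Sum>z\<in>V0. d w z * (\<phi> z w' - \<phi> z v')\<bar>"
        by (simp add: h[OF w] sum_subtractf right_diff_distrib)
      also have "\<dots> \<le> (\<Sum>z\<in>V0. \<bar>d w z\<bar> * \<bar>\<phi> z w' - \<phi> z v'\<bar>)"
        by (rule order_trans[OF sum_abs]) (simp add: abs_mult)
      finally have "\<bar>h (w @ w') - h (w @ v')\<bar> powr p \<le> (\<Sum>z\<in>V0. \<bar>d w z\<bar> * \<bar>\<phi> z w' - \<phi> z v'\<bar>) powr p"
        using p by (intro powr_mono2) auto
      also have "\<dots> \<le> card V0 powr p * (\<Sum>z\<in>V0. (\<bar>d w z\<bar> * \<bar>\<phi> z w' - \<phi> z v'\<bar>) powr p)"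
        using p finite_V0 by (intro sum_powr_le) auto
      finally show ?thesis using True w by (simp add: eterm_def adj_append_same powr_mult)
    next
      case False
      then have "eterm h (w @ w') (w @ v') = 0" using w by (simp add: eterm_def adj_append_same)
      then show ?thesis by (simp add: eterm_nonneg sum_nonneg)
    qed
    have "block m h w w \<le> (\<Sum>w'\<in>W m. \<Sum>v'\<in>W m. card V0 powr p * (\<Sum>z\<in>V0. \<bar>d w z\<bar> powr p * eterm (\<phi> z) w' v'))"
      unfolding block_def by (intro sum_mono et)
    also have "\<dots> = card V0 powr p * (\<Sum>w'\<in>W m. \<Sum>v'\<in>W m. \<Sum>z\<in>V0. \<bar>d w z\<bar> powr p * eterm (\<phi> z) w' v')"
      by (simp add: sum_distrib_left)
    also have "(\<Sum>w'\<in>W m. \<Sum>v'\<in>W m. \<Sum>z\<in>V0. \<bar>d w z\<bar> powr p * eterm (\<phi> z) w' v')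
        = (\<Sum>w'\<in>W m. \<Sum>z\<in>V0. \<Sum>v'\<in>W m. \<bar>d w z\<bar> powr p * eterm (\<phi> z) w' v')"
      by (intro sum.cong refl sum.swap)
    also have "\<dots> = (\<Sum>z\<in>V0. \<Sum>w'\<in>W m. \<Sum>v'\<in>W m. \<bar>d w z\<bar> powr p * eterm (\<phi> z) w' v')"
      by (rule sum.swap)
    also have "\<dots> = (\<Sum>z\<in>V0. \<bar>d w z\<bar> powr p * energy m (\<phi> z))"
      by (simp add: energy_def sum_distrib_left)
    also have "\<dots> \<le> (\<Sum>z\<in>V0. s w * e)"
      using d_le w assms(2) energy_nonneg by (intro sum_mono mult_mono) (auto simp: s_def eterm_nonneg sum_nonneg)
    finally have "block m h w w \<le> card V0 powr p * (\<Sum>z\<in>V0. s w * e)" by (simp add: mult_left_mono)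
    then show ?thesis by (simp add: ac_simps)
  qed
  have cross: "block m h w v = 0" if wv: "w \<in> W n" "v \<in> W n" "w \<noteq> v" for w v
    unfolding block_def
  proof (intro sum.neutral ballI)
    fix w' v' assume w': "w' \<in> W m" "v' \<in> W m"
    show "eterm h (w @ w') (v @ v') = 0"
    proof (cases "adj (w @ w') (v @ v')")
      case True
      then obtain q where q: "q \<in> kcell (w @ w')" "q \<in> kcell (v @ v')" by (auto simp: adj_def)
      then have "q \<in> kcell w \<inter> kcell v" using cell_mono words_set w' by blast
      then obtain x y where xy: "x \<in> V0" "y \<in> V0" "q = word_map F w x" "q = word_map F v y"
        using cell_Int[OF wv] by blast
      have "w' \<in> star m x" using q(1) xy(3) w' word_map_inject[OF wv(1)] by (auto simp: star_def cell_append)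
      moreover have "v' \<in> star m y" using q(2) xy(4) w' word_map_inject[OF wv(2)] by (auto simp: star_def cell_append)
      ultimately have "h (w @ w') = h (v @ v')" using h_star wv xy by metis
      then show ?thesis using p by (simp add: eterm_def)
    qed (simp add: eterm_def)
  qed
  have "energy (n + m) h = (\<Sum>w\<in>W n. block m h w w)"
  proof -
    have "(\<Sum>v\<in>W n. block m h w v) = (\<Sum>v\<in>W n. if v = w then block m h w w else 0)" if "w \<in> W n" for w
      using cross[OF that] by (intro sum.cong) auto
    then show ?thesis unfolding energy_block by (intro sum.cong) (auto simp: finite_words)
  qed
  also have "\<dots> \<le> (\<Sum>w\<in>W n. (card V0 powr p * card V0 * e) * s w)" by (intro sum_mono self)
  also have "\<dots> = (card V0 powr p * card V0 * e) * energy n f"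
    by (simp add: s_def energy_def sum_distrib_left)
  finally have "energy (n + m) h \<le> (card V0 powr p * card V0 * e) * energy n f" .
  moreover have "h (corner (n + m) x) = f (corner n x)" if "x \<in> V0" for x
    using h_star[OF corner_words[OF that] that corner_star[OF that]] word_map_corner[OF that, of n] that
    by (simp add: corner_append vc_def)
  ultimately show ?thesis by blast
qed

text \<open>Interpolating a level n witness by level m bumps gives energy of order 1 /
  (\<open>res n\<close> * \<open>res m\<close>), while the boundary values 1 and 0 survive. Testing
  \<open>res (n + m)\<close> with this function yields the claim.\<close>

lemma ex_res_super:
  "\<exists>C\<ge>1. \<forall>n\<ge>k0. \<forall>m\<ge>k0. res n * res m \<le> C * res (n + m)"
proof -
  obtain C where C: "1 \<le> C" "\<And>m z. k0 \<le> m \<Longrightarrow> z \<in> V0 \<Longrightarrow> \<exists>g. bump m z g \<and> energy m g \<le> C / res m"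
    using ex_bump by blast
  obtain D where D: "1 \<le> D" "\<And>m. k0 \<le> m \<Longrightarrow> \<exists>f. \<exists>x\<in>V0. \<exists>y\<in>V0. f (corner m x) = 1 \<and> f (corner m y) = 0
      \<and> energy m f \<le> D / res m"
    using ex_witness by blast
  define B where "B = (card V0 powr p * card V0 * C) * D"
  have le: "res n * res m \<le> B * res (n + m)" if nm: "k0 \<le> n" "k0 \<le> m" for n m
  proof -
    obtain f x y where f: "x \<in> V0" "y \<in> V0" "f (corner n x) = 1" "f (corner n y) = 0" "energy n f \<le> D / res n"
      using D(2)[OF nm(1)] by blast
    obtain \<phi> where "\<forall>z\<in>V0. bump m z (\<phi> z) \<and> energy m (\<phi> z) \<le> C / res m"
      using C(2)[OF nm(2)] by (metis (no_types))
    then obtain h where h: "energy (n + m) h \<le> (card V0 powr p * card V0 * (C / res m)) * energy n f"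
        "\<forall>x\<in>V0. h (corner (n + m) x) = f (corner n x)"
      using interpolation_energy[of m \<phi> "C / res m" n f] by blast
    have pos: "0 < res k" for k using res_ge_1[of k] by simp
    have "energy (n + m) h \<le> (card V0 powr p * card V0 * (C / res m)) * (D / res n)"
      using C(1) pos[of m] f(5) by (intro order_trans[OF h(1)] mult_left_mono) auto
    also have "\<dots> = B / (res n * res m)" by (simp add: B_def)
    finally have E: "energy (n + m) h \<le> B / (res n * res m)" .
    have "1 \<le> res (n + m) * energy (n + m) h"
      using res_bound_D[OF res_res_bound f(1,2), where f = h and m = "n + m"] h(2) f(1-4) by simp
    also have "\<dots> \<le> res (n + m) * (B / (res n * res m))" using E pos[of "n + m"] by (intro mult_left_mono) auto
    finally show ?thesis using pos[of n] pos[of m] by (simp add: le_divide_eq mult.commute)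
  qed
  have "res n * res m \<le> max 1 B * res (n + m)" if "k0 \<le> n" "k0 \<le> m" for n m
  proof -
    have "B * res (n + m) \<le> max 1 B * res (n + m)"
      using res_ge_1[of "n + m"] by (intro mult_right_mono) auto
    then show ?thesis using le[OF that] by linarith
  qed
  then show ?thesis by (intro exI[of _ "max 1 B"]) auto
qed

section \<open>The growth rate and the discrete Poincare inequality\<close>

definition theta :: real where
  "theta = (SOME t. 1 \<le> t \<and> (\<exists>D\<ge>1. \<forall>n. res n \<le> D * t ^ n \<and> t ^ n \<le> D * res n))"

lemma theta_ge_1: "1 \<le> theta"
  and res_theta: "\<exists>D\<ge>1. \<forall>n. res n \<le> D * theta ^ n \<and> theta ^ n \<le> D * res n"
proof -
  obtain C where C: "1 \<le> C" "\<And>n m. k0 \<le> n \<Longrightarrow> k0 \<le> m \<Longrightarrow> res n * res m \<le> C * res (n + m)"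
    using ex_res_super by blast
  define B where "B = max C res_add_const"
  have pos: "0 < res k" for k using res_ge_1[of k] by simp
  have "\<exists>t\<ge>1. \<exists>D\<ge>1. \<forall>n. res n \<le> D * t ^ n \<and> t ^ n \<le> D * res n"
  proof (rule almost_multiplicative_growth[of res B k0])
    show "1 \<le> B" using C by (simp add: B_def)
    show "res (n + m) \<le> B * (res n * res m)" for n m
      using pos[of n] pos[of m] by (intro order_trans[OF res_add] mult_right_mono) (auto simp: B_def)
    show "res n * res m \<le> B * res (n + m)" if "k0 \<le> n" "k0 \<le> m" for n m
      using pos[of "n + m"] by (intro order_trans[OF C(2)[OF that]] mult_right_mono) (auto simp: B_def)
  qed (rule res_ge_1)
  then have "1 \<le> theta \<and> (\<exists>D\<ge>1. \<forall>n. res n \<le> D * theta ^ n \<and> theta ^ n \<le> D * res n)"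
    unfolding theta_def by (rule someI_ex)
  then show "1 \<le> theta" "\<exists>D\<ge>1. \<forall>n. res n \<le> D * theta ^ n \<and> theta ^ n \<le> D * res n" by auto
qed

text \<open>Split off the first letter. Inside a 1-cell the induction hypothesis applies, with loss
  3/2. The p-th powers of the differences between corner samples of the 1-cells are at most of order
  theta^m times the energy, by \<open>sample_energy\<close>, and they are counted once for each of
  the N^(m+1) words.\<close>

lemma ex_poincare:
  assumes x0: "x0 \<in> V0"
  shows "\<exists>A\<ge>1. \<forall>m f. (\<Sum>w\<in>W m. \<bar>f w - f (corner m x0)\<bar> powr p) \<le> A * (N * theta) ^ m * energy m f"
proof -
  obtain C0 where C0: "1 \<le> C0" "\<And>a b. 0 \<le> a \<Longrightarrow> 0 \<le> b \<Longrightarrow> (a + b) powr p \<le> 3/2 * a powr p + C0 * b powr p"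
    using ex_powr_add_le[of p] p by auto
  obtain C1 where C1: "1 \<le> C1" "\<And>f w v. w \<in> W 1 \<Longrightarrow> v \<in> W 1 \<Longrightarrow> \<bar>f w - f v\<bar> powr p \<le> C1 * energy 1 f"
    using ex_level_one_bound by blast
  obtain D where D: "1 \<le> D" "\<And>n. res n \<le> D * theta ^ n" using res_theta by blast
  define C2 where "C2 = C0 * (C1 * (sample_const * D))"
  have C2: "1 \<le> C2"
  proof -
    have "1 * 1 \<le> sample_const * D" using sample_const_ge D by (intro mult_mono) auto
    then have "1 * 1 \<le> C1 * (sample_const * D)" using C1 by (intro mult_mono) auto
    then have "1 * 1 \<le> C2" unfolding C2_def using C0 by (intro mult_mono) auto
    then show ?thesis by simp
  qed
  \<comment> \<open>Chosen so that 3/2 * A + N * C2 \<le> A * N, using N \<ge> 2.\<close>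
  define A where "A = 4 * C2"
  have th: "0 < theta" using theta_ge_1 by simp
  have "(\<Sum>w\<in>W m. \<bar>f w - f (corner m x0)\<bar> powr p) \<le> A * (N * theta) ^ m * energy m f" for m f
  proof (induction m arbitrary: f)
    case 0
    show ?case using p C2 energy_nonneg[of 0 f] by (simp add: A_def)
  next
    case (Suc m)
    let ?E = "energy (1 + m) f"
    define g where "g v = f (v @ corner m x0)" for v
    have E0: "0 \<le> ?E" by (rule energy_nonneg)
    have c: "corner (1 + m) x0 = corner 1 x0 @ corner m x0" by (rule corner_append)
    have jump: "C0 * \<bar>g v - g (corner 1 x0)\<bar> powr p \<le> C2 * theta ^ m * ?E" if v: "v \<in> W 1" for v
    proof -
      have "\<bar>g v - g (corner 1 x0)\<bar> powr p \<le> C1 * energy 1 g" by (intro C1 v corner_words x0)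
      also have "\<dots> \<le> C1 * (sample_const * res m * ?E)"
        unfolding g_def[abs_def] using C1(1) by (intro mult_left_mono sample_energy res_res_bound res_ge_1 x0) auto
      also have "\<dots> \<le> C1 * (sample_const * (D * theta ^ m) * ?E)"
        using C1(1) sample_const_ge D(2) E0 by (intro mult_left_mono mult_right_mono) auto
      finally have "C0 * \<bar>g v - g (corner 1 x0)\<bar> powr p \<le> C0 * (C1 * (sample_const * (D * theta ^ m) * ?E))"
        using C0(1) by (intro mult_left_mono) auto
      then show ?thesis by (simp add: C2_def ac_simps)
    qed
    have "(\<Sum>w\<in>W (1 + m). \<bar>f w - f (corner (1 + m) x0)\<bar> powr p)
        = (\<Sum>v\<in>W 1. \<Sum>w\<in>W m. \<bar>f (v @ w) - f (corner (1 + m) x0)\<bar> powr p)"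
      by (rule sum_words_add)
    also have "\<dots> \<le> (\<Sum>v\<in>W 1. \<Sum>w\<in>W m. 3/2 * \<bar>f (v @ w) - f (v @ corner m x0)\<bar> powr p + C2 * theta ^ m * ?E)"
    proof (intro sum_mono)
      fix v w assume v: "v \<in> W 1" "w \<in> W m"
      have "\<bar>f (v @ w) - f (corner (1 + m) x0)\<bar> powr p
          \<le> (\<bar>f (v @ w) - f (v @ corner m x0)\<bar> + \<bar>g v - g (corner 1 x0)\<bar>) powr p"
        using p unfolding g_def c by (intro powr_mono2) auto
      also have "\<dots> \<le> 3/2 * \<bar>f (v @ w) - f (v @ corner m x0)\<bar> powr p + C0 * \<bar>g v - g (corner 1 x0)\<bar> powr p"
        by (intro C0) auto
      finally show "\<bar>f (v @ w) - f (corner (1 + m) x0)\<bar> powr p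
          \<le> 3/2 * \<bar>f (v @ w) - f (v @ corner m x0)\<bar> powr p + C2 * theta ^ m * ?E"
        using jump[OF v(1)] by linarith
    qed
    also have "\<dots> = 3/2 * (\<Sum>v\<in>W 1. \<Sum>w\<in>W m. \<bar>f (v @ w) - f (v @ corner m x0)\<bar> powr p)
        + real N * real N ^ m * (C2 * theta ^ m * ?E)"
      by (simp add: sum.distrib card_words sum_distrib_left)
    also have "(\<Sum>v\<in>W 1. \<Sum>w\<in>W m. \<bar>f (v @ w) - f (v @ corner m x0)\<bar> powr p)
        \<le> (\<Sum>v\<in>W 1. A * (N * theta) ^ m * block m f v v)"
      using Suc.IH by (intro sum_mono) (simp add: block_self)
    also have "\<dots> \<le> A * (N * theta) ^ m * ?E"
      unfolding sum_distrib_left[symmetric] using th C2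
      by (intro mult_left_mono sum_block_self_le) (auto simp: A_def)
    finally have "(\<Sum>w\<in>W (1 + m). \<bar>f w - f (corner (1 + m) x0)\<bar> powr p)
        \<le> (3/2 * A + N * C2) * ((N * theta) ^ m * ?E)"
      by (simp add: power_mult_distrib algebra_simps)
    also have "\<dots> \<le> (A * (N * theta)) * ((N * theta) ^ m * ?E)"
    proof (rule mult_right_mono)
      have "C2 * 2 \<le> C2 * N" using N_ge_2 C2 by (intro mult_left_mono) auto
      then have "3/2 * A + N * C2 \<le> A * N" by (simp add: A_def)
      also have "A * N * 1 \<le> A * N * theta" using theta_ge_1 C2 by (intro mult_left_mono) (auto simp: A_def)
      finally show "3/2 * A + N * C2 \<le> A * (N * theta)" by (simp add: ac_simps)
    qed (use th E0 in auto)
    finally show ?case by (simp add: ac_simps)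
  qed
  moreover have "1 \<le> A" using C2 by (simp add: A_def)
  ultimately show ?thesis by blast
qed

end

section \<open>Hausdorff measure of the cells\<close>

lemma hausdorff_premeasure_finite_cover:
  assumes "finite I" "E \<subseteq> (\<Union>i\<in>I. A i)" "\<And>i. i \<in> I \<Longrightarrow> bounded (A i)"
    "\<And>i. i \<in> I \<Longrightarrow> diameter (A i) \<le> \<delta>" "0 \<le> \<delta>"
  shows "hausdorff_premeasure s \<delta> E \<le> (\<Sum>i\<in>I. hausdorff_gauge s (A i))"
proof -
  obtain f where f: "bij_betw f {..<card I} I"
    using ex_bij_betw_nat_finite[OF assms(1)] by (auto simp: atLeast0LessThan)
  define B where "B k = (if k < card I then A (f k) else {})" for k
  have fI: "f k \<in> I" if "k < card I" for k using f that by (auto simp: bij_betw_def)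
  have "E \<subseteq> (\<Union>k. B k)"
  proof
    fix x assume "x \<in> E"
    then obtain i where i: "i \<in> I" "x \<in> A i" using assms(2) by auto
    then have "i \<in> f ` {..<card I}" using f by (simp add: bij_betw_def)
    then obtain k where "k < card I" "f k = i" by auto
    then have "x \<in> B k" using i by (simp add: B_def)
    then show "x \<in> (\<Union>k. B k)" by blast
  qed
  then have "hausdorff_premeasure s \<delta> E \<le> (\<Sum>k. hausdorff_gauge s (B k))"
    using assms fI by (intro hausdorff_premeasure_le) (auto simp: B_def)
  also have "\<dots> = (\<Sum>k<card I. hausdorff_gauge s (B k))"
    by (intro suminf_finite) (auto simp: B_def)
  also have "\<dots> = (\<Sum>k<card I. hausdorff_gauge s (A (f k)))" by (simp add: B_def)
  also have "\<dots> = (\<Sum>i\<in>I. hausdorff_gauge s (A i))" by (rule sum.reindex_bij_betw[OF f])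
  finally show ?thesis .
qed

text \<open>Continuity of the power: covering sets can be thickened to open sets at arbitrarily
  small cost.\<close>

lemma ex_powr_enlarge:
  fixes d s \<eta> :: real
  assumes "0 \<le> d" "0 < s" "0 < \<eta>"
  shows "\<exists>e>0. (d + 2 * e) powr s \<le> d powr s + \<eta>"
proof -
  have "((\<lambda>e. (d + 2 * e) powr s) \<longlongrightarrow> (d + 2 * 0) powr s) (at_right 0)"
    using assms
    by (intro tendsto_powr' tendsto_intros)
       (auto intro!: eventually_at_right_less[THEN eventually_mono])
  then have "eventually (\<lambda>e. (d + 2 * e) powr s < d powr s + \<eta>) (at_right 0)"
    using assms by (intro order_tendstoD(2)) auto
  then have "eventually (\<lambda>e. 0 < e \<and> (d + 2 * e) powr s \<le> d powr s + \<eta>) (at_right 0)"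
    using eventually_at_right_less[of 0] by eventually_elim auto
  then show ?thesis by (metis (mono_tags, lifting) eventually_happens trivial_limit_at_right_real)
qed

context connected_nested_fractal
begin

text \<open>The similarity dimension, characterised by \<rho>^dimK = 1 / N; it turns out to be the
  Hausdorff dimension of K.\<close>

definition dimK :: real where "dimK = ln N / ln (1 / \<rho>)"

lemma dimK_pos: "0 < dimK"
  using N_ge_2 rho by (simp add: dimK_def)

lemma rho_powr_dimK: "\<rho> powr dimK = 1 / N"
proof -
  have "ln (1 / \<rho>) = - ln \<rho>" using rho by (simp add: ln_div)
  moreover have "ln \<rho> < 0" using rho by simp
  ultimately have "dimK * ln \<rho> = - ln N" by (simp add: dimK_def)
  then show ?thesis using rho N_ge_2 by (simp add: powr_def exp_minus inverse_eq_divide)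
qed

lemma rho_pow_powr: "(\<rho> ^ n) powr t = (\<rho> powr t) ^ n"
  using rho by (simp add: powr_powr powr_realpow[symmetric] mult.commute)

lemma diameter_cell: assumes "w \<in> W n" shows "diameter (kcell w) \<le> \<rho> ^ n"
  using dist_cell[OF assms] by (intro diameter_le) (auto simp: cell_ne dist_norm)

lemma gauge_cell_le:
  assumes "w \<in> W n" "0 < t"
  shows "hausdorff_gauge t (kcell w) \<le> ennreal ((\<rho> powr t) ^ n)"
proof -
  have "0 \<le> diameter (kcell w)"
    using compact_imp_bounded[OF compact_cell[OF assms(1)]] by (rule diameter_ge_0)
  then have "diameter (kcell w) powr t \<le> (\<rho> ^ n) powr t"
    using diameter_cell[OF assms(1)] assms(2) by (intro powr_mono2) auto
  then show ?thesis using assms(2)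
    by (simp add: hausdorff_gauge_def cell_ne rho_pow_powr ennreal_leI)
qed

lemma premeasure_cell_le:
  assumes w: "w \<in> W n" and "\<rho> ^ (n + m) \<le> \<delta>" "0 < t"
  shows "hausdorff_premeasure t \<delta> (kcell w) \<le> ennreal (real N ^ m * (\<rho> powr t) ^ (n + m))"
proof -
  have wv: "w @ v \<in> W (n + m)" if "v \<in> W m" for v using words_append[OF w that] .
  have "0 \<le> \<rho> ^ (n + m)" using rho by simp
  then have d0: "0 \<le> \<delta>" using assms(2) by linarith
  have "hausdorff_premeasure t \<delta> (kcell w) \<le> (\<Sum>v\<in>W m. hausdorff_gauge t (kcell (w @ v)))"
  proof (rule hausdorff_premeasure_finite_cover)
    show "kcell w \<subseteq> (\<Union>v\<in>W m. kcell (w @ v))" using cell_cells[OF w, of m] by simp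
    show "diameter (kcell (w @ v)) \<le> \<delta>" if "v \<in> W m" for v
      using diameter_cell[OF wv[OF that]] assms(2) by linarith
  qed (use wv compact_cell compact_imp_bounded d0 in \<open>auto simp: finite_words\<close>)
  also have "\<dots> \<le> (\<Sum>v\<in>W m. ennreal ((\<rho> powr t) ^ (n + m)))"
    by (intro sum_mono gauge_cell_le wv assms(3))
  also have "\<dots> = ennreal (real N ^ m * (\<rho> powr t) ^ (n + m))"
    by (simp add: card_words ennreal_mult ennreal_of_nat_eq_real_of_nat)
  finally show ?thesis .
qed

lemma outer_cell_le: assumes w: "w \<in> W n" shows "hausdorff_outer dimK (kcell w) \<le> ennreal (1 / real N ^ n)"
  unfolding hausdorff_outer_def
proof (rule SUP_least)
  fix \<delta> :: real assume "\<delta> \<in> {0<..}"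
  then obtain m where m: "\<rho> ^ m < \<delta>" using real_arch_pow_inv[of \<delta> \<rho>] rho by auto
  have "\<rho> ^ (n + m) \<le> \<rho> ^ m" using rho by (intro power_decreasing) auto
  then have "hausdorff_premeasure dimK \<delta> (kcell w) \<le> ennreal (real N ^ m * (\<rho> powr dimK) ^ (n + m))"
    using m dimK_pos by (intro premeasure_cell_le w) auto
  also have "real N ^ m * (\<rho> powr dimK) ^ (n + m) = 1 / real N ^ n"
    using N_ge_2 by (simp add: rho_powr_dimK power_divide power_add)
  finally show "hausdorff_premeasure dimK \<delta> (kcell w) \<le> ennreal (1 / real N ^ n)" .
qed

text \<open>The m-cells cover K at a cost of at most (N \<rho>^t)^m, which tends to 0 for t >
  dimK.\<close>

lemma outer_K_eq_0: assumes "dimK < t" shows "hausdorff_outer t K = 0"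
proof -
  have t: "0 < t" using assms dimK_pos by simp
  have "hausdorff_premeasure t \<delta> K \<le> 0" if \<delta>: "\<delta> > 0" for \<delta>
  proof -
    define q where "q = N * \<rho> powr t"
    have "\<rho> powr t < \<rho> powr dimK" using rho assms by (intro powr_less_mono') auto
    then have q: "0 \<le> q" "q < 1" using N_ge_2 by (auto simp: q_def rho_powr_dimK field_simps)
    have "(\<lambda>m. q ^ m) \<longlonglongrightarrow> 0" using q by (intro LIMSEQ_power_zero) auto
    then have lim: "(\<lambda>m. ennreal (q ^ m)) \<longlonglongrightarrow> 0"
      using q by (simp flip: ennreal_0 add: tendsto_ennreal_iff)
    obtain m0 where m0: "\<rho> ^ m0 < \<delta>" using real_arch_pow_inv[OF \<delta> rho(2)] by auto
    have "hausdorff_premeasure t \<delta> K \<le> ennreal (q ^ m)" if "m0 \<le> m" for m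
    proof -
      have "\<rho> ^ m \<le> \<rho> ^ m0" using rho that by (intro power_decreasing) auto
      then have "\<rho> ^ (0 + m) \<le> \<delta>" using m0 by simp
      then show ?thesis using premeasure_cell_le[of "[]" 0 m \<delta> t] t
        by (simp add: q_def power_mult_distrib)
    qed
    then show ?thesis by (intro LIMSEQ_le_const[OF lim]) blast
  qed
  then show ?thesis unfolding hausdorff_outer_def by (intro antisym SUP_least) auto
qed

text \<open>If \<rho>^(k+1) < r \<le> \<rho>^k, then S meets at most M of the k-cells, each of which
  has N^(m-k) subcells of level m. For r > 1 the total number N^m of m-cells is bound
  enough.\<close>

lemma ex_cell_count:
  "\<exists>C\<ge>1. \<forall>m. \<forall>r. \<forall>S. \<rho> ^ m \<le> r \<longrightarrow> (\<forall>x\<in>S. \<forall>y\<in>S. dist x y \<le> r) \<longrightarrow>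
     real (card {v \<in> W m. kcell v \<inter> S \<noteq> {}}) \<le> C * real N ^ m * r powr dimK"
proof -
  obtain M :: nat where M: "\<And>n x. card {w \<in> W n. \<exists>y\<in>kcell w. dist x y \<le> 1 * \<rho> ^ n} \<le> M"
    using ex_multiplicity[of 1] by blast
  define C where "C = real (max 1 M) * N"
  have C: "1 \<le> C" "M * N \<le> C"
  proof -
    have "1 * 1 \<le> real (max 1 M) * N" using N_ge_2 by (intro mult_mono) auto
    then show "1 \<le> C" by (simp add: C_def)
    show "M * N \<le> C" unfolding C_def of_nat_mult by (intro mult_right_mono) auto
  qed
  have "real (card {v \<in> W m. kcell v \<inter> S \<noteq> {}}) \<le> C * real N ^ m * r powr dimK" (is "real (card ?T) \<le> _")
    if r: "\<rho> ^ m \<le> r" and S: "\<forall>x\<in>S. \<forall>y\<in>S. dist x y \<le> r" for m r S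
  proof -
    have rpos: "0 < r" using r rho by (meson less_le_trans zero_less_power)
    consider "S = {}" | "1 < r" | "S \<noteq> {}" "r \<le> 1" by linarith
    then show ?thesis
    proof cases
      case 1 then show ?thesis using C rpos by simp
    next
      case 2
      have "card ?T \<le> N ^ m" using card_mono[of "W m" ?T] by (auto simp: finite_words card_words)
      then have "real (card ?T) \<le> 1 * real N ^ m * 1" by (simp flip: of_nat_power)
      also have "\<dots> \<le> C * real N ^ m * r powr dimK"
        using C 2 dimK_pos by (intro mult_mono ge_one_powr_ge_zero) auto
      finally show ?thesis .
    next
      case 3
      define k where "k = (GREATEST k. r \<le> \<rho> ^ k)"
      obtain j where j: "\<rho> ^ j < r" using real_arch_pow_inv[OF rpos rho(2)] by blast
      have bound: "y < j" if "r \<le> \<rho> ^ y" for y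
        using that j rho power_decreasing[of j y \<rho>] by (meson less_le_not_le linorder_not_le order_trans less_imp_le)
      have k: "r \<le> \<rho> ^ k" "\<And>y. r \<le> \<rho> ^ y \<Longrightarrow> y \<le> k"
        unfolding k_def using 3(2) bound
        by (auto intro!: GreatestI_nat[of "\<lambda>k. r \<le> \<rho> ^ k" 0 j] Greatest_le_nat[of "\<lambda>k. r \<le> \<rho> ^ k" _ j] intro: less_imp_le)
      have k': "\<rho> ^ Suc k < r" using k(2)[of "Suc k"] by (meson Suc_n_not_le_n linorder_not_le)
      have km: "k \<le> m"
      proof (rule ccontr)
        assume "\<not> k \<le> m"
        then have "\<rho> ^ k \<le> \<rho> ^ Suc m" using rho by (intro power_decreasing) auto
        also have "\<dots> < \<rho> ^ m" using rho by simp
        finally show False using k r by simp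
      qed
      obtain x where x: "x \<in> S" using 3 by auto
      define Q where "Q = {w \<in> W k. \<exists>y\<in>kcell w. dist x y \<le> 1 * \<rho> ^ k}"
      have finQ: "finite Q" by (simp add: Q_def finite_words)
      have "?T \<subseteq> (\<lambda>(a, c). a @ c) ` (Q \<times> W (m - k))"
      proof
        fix v assume v: "v \<in> ?T"
        then obtain y where y: "y \<in> kcell v" "y \<in> S" by auto
        then have "y \<in> kcell (take k v)" "dist x y \<le> 1 * \<rho> ^ k" using v cell_take x S k(1) by force+
        then have "take k v \<in> Q" using v take_words km unfolding Q_def by blast
        moreover have "drop k v \<in> W (m - k)" using v drop_words by blast
        ultimately show "v \<in> (\<lambda>(a, c). a @ c) ` (Q \<times> W (m - k))"
          by (intro image_eqI[of _ _ "(take k v, drop k v)"]) auto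
      qed
      then have "card ?T \<le> card (Q \<times> W (m - k))"
        using finQ by (meson card_image_le card_mono finite_SigmaI finite_imageI finite_words order_trans)
      also have "\<dots> \<le> M * N ^ (m - k)" using M[of k x] by (simp add: card_cartesian_product card_words Q_def)
      finally have "real (card ?T) \<le> real (M * N ^ (m - k))" by (simp only: of_nat_le_iff)
      also have "\<dots> = real M * real N ^ (m - k)" by simp
      also have "\<dots> = (M * N) * real N ^ m * (1 / real N ^ Suc k)"
        using N_ge_2 km by (simp add: power_diff)
      also have "1 / real N ^ Suc k = (\<rho> ^ Suc k) powr dimK" by (simp add: rho_pow_powr rho_powr_dimK power_divide del: power_Suc)
      also have "(M * N) * real N ^ m * (\<rho> ^ Suc k) powr dimK \<le> C * real N ^ m * r powr dimK"
        using C k' rho dimK_pos by (intro mult_mono powr_mono2 mult_right_mono) auto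
      finally show ?thesis .
    qed
  qed
  then show ?thesis using C(1) by blast
qed

text \<open>A mass distribution argument with counting in place of a measure. A cover is thickened
  to open sets, made finite by compactness, and compared at a level m finer than all its members:
  together these must meet all N^(m-n) subcells of the cell, and \<open>ex_cell_count\<close> limits
  how many each one meets.\<close>

lemma ex_premeasure_ge:
  "\<exists>\<kappa>>0. \<forall>n. \<forall>w\<in>W n. \<forall>\<delta>. ennreal (\<kappa> / real N ^ n) \<le> hausdorff_premeasure dimK \<delta> (kcell w)"
proof -
  obtain C where C: "1 \<le> C" "\<And>m r S. \<rho> ^ m \<le> r \<Longrightarrow> (\<forall>x\<in>S. \<forall>y\<in>S. dist x y \<le> r) \<Longrightarrow>
     real (card {v \<in> W m. kcell v \<inter> S \<noteq> {}}) \<le> C * real N ^ m * r powr dimK"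
    using ex_cell_count by blast
  have "ennreal ((1 / C) / real N ^ n) \<le> hausdorff_premeasure dimK \<delta> (kcell w)"
    if w: "w \<in> W n" for n w \<delta>
    unfolding hausdorff_premeasure_def
  proof (intro INF_greatest; clarify)
    fix A :: "nat \<Rightarrow> 'a set"
    assume cov: "kcell w \<subseteq> (\<Union>i. A i)" and A: "\<forall>i. bounded (A i) \<and> diameter (A i) \<le> \<delta>"
    show "ennreal ((1 / C) / real N ^ n) \<le> (\<Sum>i. hausdorff_gauge dimK (A i))"
    proof (rule ennreal_le_epsilon)
      fix \<eta> :: real assume eta: "0 < \<eta>"
      have dA: "0 \<le> diameter (A i)" for i using A diameter_ge_0 by blast
      have "\<exists>e>0. (diameter (A i) + 2 * e) powr dimK \<le> diameter (A i) powr dimK + \<eta> * (1/2) ^ Suc i" for i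
        using dA dimK_pos eta by (intro ex_powr_enlarge) auto
      then obtain e where e: "\<And>i. 0 < e i"
          "\<And>i. (diameter (A i) + 2 * e i) powr dimK \<le> diameter (A i) powr dimK + \<eta> * (1/2) ^ Suc i"
        by metis
      define r where "r i = diameter (A i) + 2 * e i" for i
      define G where "G i = (\<Union>x\<in>A i. ball x (e i))" for i
      have r0: "0 < r i" for i using dA[of i] e(1)[of i] by (simp add: r_def)
      have AG: "A i \<subseteq> G i" for i using e(1)[of i] by (auto simp: G_def)
      have Gr: "dist x y \<le> r i" if xy: "x \<in> G i" "y \<in> G i" for i x y
      proof -
        obtain a c where ac: "a \<in> A i" "c \<in> A i" "dist a x < e i" "dist c y < e i"
          using xy by (auto simp: G_def)
        have "dist a c \<le> diameter (A i)" using diameter_bounded_bound A ac by blast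
        then show ?thesis
          using ac dist_triangle[of x y a] dist_triangle[of a y c] by (simp add: r_def dist_commute)
      qed
      have "kcell w \<subseteq> \<Union> (G ` UNIV)" using cov AG by blast
      moreover have "open (G i)" for i by (auto simp: G_def)
      ultimately obtain I where I: "finite I" "kcell w \<subseteq> \<Union> (G ` I)"
        by (metis compactE_image[OF compact_cell[OF w]])
      define J where "J = {i\<in>I. A i \<noteq> {}}"
      have J: "finite J" "kcell w \<subseteq> \<Union> (G ` J)" using I by (fastforce simp: J_def G_def)+
      have "\<exists>m\<ge>n. \<forall>i\<in>J. \<rho> ^ m \<le> r i"
        using J(1)
      proof (induction J rule: finite_induct)
        case (insert i J)
        then obtain m where m: "m \<ge> n" "\<forall>i\<in>J. \<rho> ^ m \<le> r i" by auto
        obtain m' where m': "\<rho> ^ m' < r i" using real_arch_pow_inv[OF r0 rho(2)] by blast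
        have "\<rho> ^ max m m' \<le> \<rho> ^ m" "\<rho> ^ max m m' \<le> \<rho> ^ m'" using rho by (auto intro!: power_decreasing)
        then have "\<rho> ^ max m m' \<le> r i" "\<And>j. j \<in> J \<Longrightarrow> \<rho> ^ max m m' \<le> r j"
          using m(2) m' by (fastforce intro: order_trans)+
        then have "\<forall>j\<in>insert i J. \<rho> ^ max m m' \<le> r j" by simp
        then show ?case using m(1) by (intro exI[of _ "max m m'"]) auto
      qed auto
      then obtain m where m: "m \<ge> n" "\<And>i. i \<in> J \<Longrightarrow> \<rho> ^ m \<le> r i" by blast
      let ?T = "\<lambda>i. {v \<in> W m. kcell v \<inter> G i \<noteq> {}}"
      have "(\<lambda>v. w @ v) ` W (m - n) \<subseteq> (\<Union>i\<in>J. ?T i)"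
      proof
        fix u assume "u \<in> (\<lambda>v. w @ v) ` W (m - n)"
        then obtain v where v: "v \<in> W (m - n)" "u = w @ v" by auto
        have "u \<in> W m" using words_append[OF w v(1)] v(2) m(1) by simp
        moreover obtain x where x: "x \<in> kcell u" using cell_ne by blast
        moreover have "x \<in> kcell w" using x cell_mono[OF words_set[OF v(1)]] v(2) by blast
        ultimately show "u \<in> (\<Union>i\<in>J. ?T i)" using J(2) by blast
      qed
      then have "card ((\<lambda>v. w @ v) ` W (m - n)) \<le> card (\<Union>i\<in>J. ?T i)"
        using J(1) finite_words[of m] by (intro card_mono) auto
      also have "\<dots> \<le> (\<Sum>i\<in>J. card (?T i))" by (rule card_UN_le[OF J(1)])
      finally have "real (card ((\<lambda>v. w @ v) ` W (m - n))) \<le> (\<Sum>i\<in>J. real (card (?T i)))"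
        by (simp only: of_nat_le_iff of_nat_sum[symmetric])
      also have "\<dots> \<le> (\<Sum>i\<in>J. C * real N ^ m * r i powr dimK)"
        using C(2) m(2) Gr by (intro sum_mono) blast
      also have "real (card ((\<lambda>v. w @ v) ` W (m - n))) = real N ^ m / real N ^ n"
      proof -
        have "card ((\<lambda>v. w @ v) ` W (m - n)) = N ^ (m - n)" by (simp add: card_image inj_on_def card_words)
        moreover have "real N ^ (m - n) = real N ^ m / real N ^ n" using m(1) N_ge_2 by (intro power_diff) auto
        ultimately show ?thesis by simp
      qed
      finally have "real N ^ m / real N ^ n \<le> C * real N ^ m * (\<Sum>i\<in>J. r i powr dimK)"
        by (simp add: sum_distrib_left)
      then have "(1 / C) / real N ^ n \<le> (\<Sum>i\<in>J. r i powr dimK)"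
        using C(1) N_ge_2 by (simp add: field_simps)
      also have "\<dots> \<le> (\<Sum>i\<in>J. diameter (A i) powr dimK + \<eta> * (1/2) ^ Suc i)"
        unfolding r_def by (intro sum_mono e)
      finally have "ennreal ((1 / C) / real N ^ n) \<le> ennreal (\<Sum>i\<in>J. diameter (A i) powr dimK + \<eta> * (1/2) ^ Suc i)"
        by (rule ennreal_leI)
      also have "\<dots> = (\<Sum>i\<in>J. ennreal (diameter (A i) powr dimK) + ennreal (\<eta> * (1/2) ^ Suc i))"
        using eta by (subst sum_ennreal[symmetric]) (auto intro!: sum.cong ennreal_plus)
      also have "\<dots> = (\<Sum>i\<in>J. hausdorff_gauge dimK (A i) + ennreal (\<eta> * (1/2) ^ Suc i))"
        using dimK_pos by (intro sum.cong) (auto simp: hausdorff_gauge_def J_def)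
      also have "\<dots> \<le> (\<Sum>i. hausdorff_gauge dimK (A i) + ennreal (\<eta> * (1/2) ^ Suc i))"
        by (intro sum_le_suminf J) auto
      also have "\<dots> = (\<Sum>i. hausdorff_gauge dimK (A i)) + (\<Sum>i. ennreal (\<eta> * (1/2) ^ Suc i))"
        by (rule suminf_add[symmetric]) auto
      also have "(\<Sum>i. ennreal (\<eta> * (1/2) ^ Suc i)) = ennreal \<eta>"
      proof (rule suminf_ennreal_eq)
        show "(\<lambda>i. \<eta> * (1/2) ^ Suc i) sums \<eta>" using sums_mult[OF power_half_series, of \<eta>] by simp
      qed (use eta in auto)
      finally show "ennreal ((1 / C) / real N ^ n) \<le> (\<Sum>i. hausdorff_gauge dimK (A i)) + ennreal \<eta>" .
    qed
  qed
  then show ?thesis using C(1) by (intro exI[of _ "1 / C"]) auto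
qed

text \<open>For covers by sets of diameter at most 1, lowering the exponent only increases the
  gauge, so the lower bound at \<open>dimK\<close> passes down to t.\<close>

lemma outer_K_pos: assumes "0 \<le> t" "t \<le> dimK" shows "hausdorff_outer t K \<noteq> 0"
proof -
  obtain \<kappa> where k: "\<kappa> > 0" "\<And>n w \<delta>. w \<in> W n \<Longrightarrow> ennreal (\<kappa> / real N ^ n) \<le> hausdorff_premeasure dimK \<delta> (kcell w)"
    using ex_premeasure_ge by blast
  have "ennreal \<kappa> \<le> hausdorff_premeasure dimK 1 K" using k(2)[of "[]" 0 1] by simp
  also have "\<dots> \<le> hausdorff_premeasure t 1 K"
    unfolding hausdorff_premeasure_def
  proof (intro INF_mono bexI[rotated])
    fix A :: "nat \<Rightarrow> 'a set" assume A: "A \<in> {A. K \<subseteq> (\<Union>i. A i) \<and> (\<forall>i. bounded (A i) \<and> diameter (A i) \<le> 1)}"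
    then show "A \<in> {A. K \<subseteq> (\<Union>i. A i) \<and> (\<forall>i. bounded (A i) \<and> diameter (A i) \<le> 1)}" .
    show "(\<Sum>i. hausdorff_gauge dimK (A i)) \<le> (\<Sum>i. hausdorff_gauge t (A i))"
    proof (intro suminf_le)
      fix i
      have d: "0 \<le> diameter (A i)" "diameter (A i) \<le> 1" using A diameter_ge_0 by auto
      have "diameter (A i) powr dimK \<le> 1" using d dimK_pos by (intro powr_le1) auto
      moreover have "diameter (A i) powr dimK \<le> diameter (A i) powr t"
        using d assms(2) powr_mono'[of t dimK "diameter (A i)"] by (cases "diameter (A i) = 0") auto
      ultimately show "hausdorff_gauge dimK (A i) \<le> hausdorff_gauge t (A i)"
        using dimK_pos by (auto simp: hausdorff_gauge_def intro!: ennreal_leI)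
    qed auto
  qed
  also have "\<dots> \<le> hausdorff_outer t K" by (rule hausdorff_premeasure_le_outer) simp
  finally show ?thesis using k(1) by auto
qed

lemma hausdorff_dim_K: "hausdorff_dim K = dimK"
  unfolding hausdorff_dim_def
proof (rule cInf_eq)
  show "dimK \<le> t" if "t \<in> {s. 0 \<le> s \<and> hausdorff_outer s K = 0}" for t
    using that outer_K_pos[of t] by (cases "dimK \<le> t") auto
  show "y \<le> dimK" if "\<And>t. t \<in> {s. 0 \<le> s \<and> hausdorff_outer s K = 0} \<Longrightarrow> y \<le> t" for y
  proof (rule dense_ge)
    fix t assume "dimK < t"
    then show "y \<le> t" using that[of t] outer_K_eq_0[of t] dimK_pos by auto
  qed
qed

section \<open>The measure on K and the masses of cells\<close>

definition mu :: "'a measure" where "mu = restrict_space (hausdorff_measure dimK) K"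

lemma K_borel: "K \<in> sets borel" using compact_K by (intro borel_closed compact_imp_closed)

lemma space_mu [simp]: "space mu = K" by (simp add: mu_def space_restrict_space)

lemma sets_mu: "A \<in> sets mu \<longleftrightarrow> A \<in> sets borel \<and> A \<subseteq> K"
  using K_borel by (simp add: mu_def sets_restrict_space_iff Int_absorb1 conj_commute)

lemma emeasure_mu: "A \<in> sets borel \<Longrightarrow> A \<subseteq> K \<Longrightarrow> emeasure mu A = hausdorff_outer dimK A"
  using K_borel by (simp add: mu_def emeasure_restrict_space emeasure_hausdorff_measure)

lemma cell_sets [measurable]: "w \<in> W n \<Longrightarrow> kcell w \<in> sets mu"
  using compact_cell cell_subset_K by (auto simp: sets_mu intro!: borel_closed compact_imp_closed)

lemma mu_cell_le: "w \<in> W n \<Longrightarrow> emeasure mu (kcell w) \<le> ennreal (1 / real N ^ n)"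
  using cell_sets[of w n] outer_cell_le[of w n] by (simp add: emeasure_mu sets_mu)

definition mass_const :: real where
  "mass_const = (SOME \<kappa>. 0 < \<kappa> \<and> (\<forall>n. \<forall>w\<in>W n. ennreal (\<kappa> / real N ^ n) \<le> emeasure mu (kcell w)))"

lemma mass_const_pos: "0 < mass_const" and mu_cell_ge: "w \<in> W n \<Longrightarrow> ennreal (mass_const / real N ^ n) \<le> emeasure mu (kcell w)"
proof -
  obtain \<kappa> where k: "\<kappa> > 0" "\<And>n w \<delta>. w \<in> W n \<Longrightarrow> ennreal (\<kappa> / real N ^ n) \<le> hausdorff_premeasure dimK \<delta> (kcell w)"
    using ex_premeasure_ge by blast
  have "ennreal (\<kappa> / real N ^ n) \<le> emeasure mu (kcell w)" if "w \<in> W n" for n w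
    using k(2)[OF that, of 1] hausdorff_premeasure_le_outer[of 1 dimK "kcell w"] cell_sets[OF that]
    by (simp add: emeasure_mu sets_mu)
  then have "\<exists>\<kappa>. 0 < \<kappa> \<and> (\<forall>n. \<forall>w\<in>W n. ennreal (\<kappa> / real N ^ n) \<le> emeasure mu (kcell w))"
    using k(1) by blast
  then have "0 < mass_const \<and> (\<forall>n. \<forall>w\<in>W n. ennreal (mass_const / real N ^ n) \<le> emeasure mu (kcell w))"
    unfolding mass_const_def by (rule someI_ex)
  then show "0 < mass_const" "w \<in> W n \<Longrightarrow> ennreal (mass_const / real N ^ n) \<le> emeasure mu (kcell w)" by auto
qed

lemma finite_measure_mu: "finite_measure mu"
proof
  have "emeasure mu K \<le> ennreal 1" using mu_cell_le[of "[]" 0] by simp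
  then show "emeasure mu (space mu) \<noteq> \<infinity>" using ennreal_less_top[of 1] by (auto simp: top_unique)
qed

text \<open>A point lies in cells of arbitrarily small mass. Consequently the finite overlaps of
  cells are null sets.\<close>

lemma mu_singleton: assumes "x \<in> K" shows "emeasure mu {x} = 0"
proof -
  have "emeasure mu {x} \<le> ennreal ((1 / real N) ^ n)" for n
  proof -
    obtain w where w: "w \<in> W n" "x \<in> kcell w" using ex_cell[OF assms] by blast
    then have "emeasure mu {x} \<le> emeasure mu (kcell w)" using cell_sets by (intro emeasure_mono) auto
    then show ?thesis using mu_cell_le[OF w(1)] by (simp add: power_divide)
  qed
  moreover have "(\<lambda>n. ennreal ((1 / real N) ^ n)) \<longlonglongrightarrow> 0"
  proof -
    have "(\<lambda>n. (1 / real N) ^ n) \<longlonglongrightarrow> 0" using N_ge_2 by (intro LIMSEQ_power_zero) auto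
    then show ?thesis by (simp flip: ennreal_0 add: tendsto_ennreal_iff)
  qed
  ultimately have "emeasure mu {x} \<le> 0" by (intro LIMSEQ_le_const) auto
  then show ?thesis by simp
qed

lemma singleton_sets: "x \<in> K \<Longrightarrow> {x} \<in> sets mu" by (simp add: sets_mu)

end

section \<open>Oscillation energies of functions on the fractal\<close>

lemma convex_on_abs_diff_powr:
  fixes p c :: real
  assumes "1 \<le> p"
  shows "convex_on UNIV (\<lambda>t. \<bar>t - c\<bar> powr p)"
proof (rule convex_onI)
  fix t x y :: real assume t: "0 < t" "t < 1"
  have key: "(s * a + t * b) powr p \<le> s * a powr p + t * b powr p"
    if st: "0 < s" "0 < t" "s + t = 1" and ab: "0 \<le> a" "0 \<le> b" for s t a b :: real
  proof -
    \<comment> \<open>When one of the two arguments is 0, convexity reduces to r^p \<le> r for 0 < r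
      \<le> 1.\<close>
    have zero: "(r * e) powr p \<le> r * e powr p" if "0 < r" "r \<le> 1" "0 \<le> e" for r e :: real
    proof -
      have "r powr p \<le> r powr 1" using that assms by (intro powr_mono') auto
      then show ?thesis using that by (simp add: powr_mult mult_right_mono)
    qed
    consider "a = 0" | "b = 0" | "0 < a" "0 < b" using ab by linarith
    then show ?thesis
    proof cases
      case 1 then show ?thesis using zero[of t b] st ab assms by simp
    next
      case 2 then show ?thesis using zero[of s a] st ab assms by simp
    next
      case 3
      have "1 - t = s" using st by simp
      then show ?thesis
        using convex_onD[OF powr_convex[OF assms], of t a b] 3 st(1,2) by simp
    qed
  qed
  have "\<bar>(1 - t) *\<^sub>R x + t *\<^sub>R y - c\<bar> = \<bar>(1 - t) * (x - c) + t * (y - c)\<bar>" by (simp add: algebra_simps)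
  also have "\<dots> \<le> (1 - t) * \<bar>x - c\<bar> + t * \<bar>y - c\<bar>"
    using t abs_triangle_ineq[of "(1 - t) * (x - c)" "t * (y - c)"] by (simp add: abs_mult)
  finally have "\<bar>(1 - t) *\<^sub>R x + t *\<^sub>R y - c\<bar> powr p \<le> ((1 - t) * \<bar>x - c\<bar> + t * \<bar>y - c\<bar>) powr p"
    using assms by (intro powr_mono2) auto
  also have "\<dots> \<le> (1 - t) * \<bar>x - c\<bar> powr p + t * \<bar>y - c\<bar> powr p" using t by (intro key) auto
  finally show "\<bar>(1 - t) *\<^sub>R x + t *\<^sub>R y - c\<bar> powr p \<le> (1 - t) * \<bar>x - c\<bar> powr p + t * \<bar>y - c\<bar> powr p" .
qed simp

lemma jensen_uniform_measure:
  fixes u :: "'b \<Rightarrow> real"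
  assumes A: "emeasure M A \<noteq> 0" "emeasure M A \<noteq> \<infinity>" and u: "u \<in> borel_measurable M"
    and fin: "(\<integral>\<^sup>+x\<in>A. ennreal (\<bar>u x\<bar> powr p) \<partial>M) < \<infinity>" and p: "1 < p"
  shows "ennreal (\<bar>(\<integral>x. u x \<partial>uniform_measure M A) - c\<bar> powr p)
    \<le> (\<integral>\<^sup>+x\<in>A. ennreal (\<bar>u x - c\<bar> powr p) \<partial>M) / emeasure M A"
proof -
  have AM: "A \<in> sets M" using A(1) by (rule emeasure_neq_0_sets)
  let ?P = "uniform_measure M A"
  interpret P: prob_space ?P using A by (rule prob_space_uniform_measure)
  have [measurable]: "u \<in> borel_measurable M" "u \<in> borel_measurable ?P" using u by auto
  have nn: "(\<integral>\<^sup>+x. f x \<partial>?P) = (\<integral>\<^sup>+x\<in>A. f x \<partial>M) / emeasure M A"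
    if "f \<in> borel_measurable M" for f
    using that AM A by (intro nn_integral_uniform_measure) auto
  have up: "integrable ?P (\<lambda>x. \<bar>u x\<bar> powr p)"
  proof (rule integrableI_bounded)
    have "(\<integral>\<^sup>+x. ennreal (norm (\<bar>u x\<bar> powr p)) \<partial>?P) = (\<integral>\<^sup>+x\<in>A. ennreal (\<bar>u x\<bar> powr p) \<partial>M) / emeasure M A"
      by (subst nn) auto
    also have "\<dots> < \<infinity>" using fin A by (simp add: ennreal_divide_eq_top_iff less_top[symmetric] top_unique)
    finally show "(\<integral>\<^sup>+x. ennreal (norm (\<bar>u x\<bar> powr p)) \<partial>?P) < \<infinity>" .
  qed measurable
  \<comment> \<open>On a probability space the bound |u| \<le> 1 + |u|^p makes an L^p function
    integrable.\<close>
  have int_u: "integrable ?P u"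
  proof (rule Bochner_Integration.integrable_bound)
    show "integrable ?P (\<lambda>x. 1 + \<bar>u x\<bar> powr p)" using up by auto
    have "\<bar>t\<bar> \<le> 1 + \<bar>t\<bar> powr p" for t :: real
    proof (cases "\<bar>t\<bar> \<le> 1")
      case False
      then have "\<bar>t\<bar> powr 1 \<le> \<bar>t\<bar> powr p" using p by (intro powr_mono) auto
      then show ?thesis using False by simp
    qed (simp add: add_increasing2)
    then show "AE x in ?P. norm (u x) \<le> norm (1 + \<bar>u x\<bar> powr p)" by (auto simp: add_nonneg_nonneg)
  qed simp
  have int_c: "integrable ?P (\<lambda>x. \<bar>u x - c\<bar> powr p)"
  proof (rule Bochner_Integration.integrable_bound)
    show "integrable ?P (\<lambda>x. 3 powr p * (\<bar>u x\<bar> powr p + \<bar>c\<bar> powr p))" using up by auto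
    have "\<bar>t - c\<bar> powr p \<le> 3 powr p * (\<bar>t\<bar> powr p + \<bar>c\<bar> powr p)" for t
      using abs_diff3_powr_le[of p t c 0 0] p by simp
    then show "AE x in ?P. norm (\<bar>u x - c\<bar> powr p) \<le> norm (3 powr p * (\<bar>u x\<bar> powr p + \<bar>c\<bar> powr p))"
      by (auto simp: add_nonneg_nonneg)
  qed measurable
  have "\<bar>(\<integral>x. u x \<partial>?P) - c\<bar> powr p \<le> (\<integral>x. \<bar>u x - c\<bar> powr p \<partial>?P)"
    using P.jensens_inequality[where X = u and I = UNIV and q = "\<lambda>t. \<bar>t - c\<bar> powr p"] int_u int_c
      convex_on_abs_diff_powr[of p c] p by auto
  then have "ennreal (\<bar>(\<integral>x. u x \<partial>?P) - c\<bar> powr p) \<le> ennreal (\<integral>x. \<bar>u x - c\<bar> powr p \<partial>?P)"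
    by (rule ennreal_leI)
  also have "\<dots> = (\<integral>\<^sup>+x. ennreal (\<bar>u x - c\<bar> powr p) \<partial>?P)"
    by (rule nn_integral_eq_integral[symmetric, OF int_c]) auto
  also have "\<dots> = (\<integral>\<^sup>+x\<in>A. ennreal (\<bar>u x - c\<bar> powr p) \<partial>M) / emeasure M A"
    by (subst nn) auto
  finally show ?thesis .
qed

lemma inverse_antimono_ennreal: "a \<le> b \<Longrightarrow> inverse b \<le> inverse (a :: ennreal)"
proof -
  assume le: "a \<le> b"
  show ?thesis
  proof (cases "a = 0 \<or> b = \<top>")
    case False
    then obtain x y where xy: "a = ennreal x" "b = ennreal y" "0 \<le> x" "0 \<le> y"
      using le by (cases a; cases b) (auto simp: top_unique)
    then have "0 < x" "x \<le> y" using False le by (auto simp: less_le)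
    then show ?thesis using xy by (simp add: inverse_ennreal)
  qed auto
qed

lemma nn_integral_UN_le:
  assumes "finite I" "\<And>i. i \<in> I \<Longrightarrow> A i \<in> sets M" "f \<in> borel_measurable M" "B \<subseteq> (\<Union>i\<in>I. A i)"
  shows "(\<integral>\<^sup>+x\<in>B. f x \<partial>M) \<le> (\<Sum>i\<in>I. \<integral>\<^sup>+x\<in>A i. f x \<partial>M)"
proof -
  have "(\<integral>\<^sup>+x\<in>B. f x \<partial>M) \<le> (\<integral>\<^sup>+x. (\<Sum>i\<in>I. f x * indicator (A i) x) \<partial>M)"
  proof (rule nn_integral_mono)
    fix x
    show "f x * indicator B x \<le> (\<Sum>i\<in>I. f x * indicator (A i) x)"
    proof (cases "x \<in> B")
      case True
      then obtain i where i: "i \<in> I" "x \<in> A i" using assms(4) by auto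
      have "f x * indicator (A i) x \<le> (\<Sum>i\<in>I. f x * indicator (A i) x)"
        using assms(1) i(1) by (intro member_le_sum) auto
      then show ?thesis using True i by simp
    qed simp
  qed
  also have "\<dots> = (\<Sum>i\<in>I. \<integral>\<^sup>+x\<in>A i. f x \<partial>M)"
    using assms by (intro nn_integral_sum borel_measurable_times_ennreal borel_measurable_indicator) auto
  finally show ?thesis .
qed

context nested_fractal_energy
begin

interpretation mu: finite_measure mu by (rule finite_measure_mu)

section \<open>Oscillation and deviation energies of a function on K\<close>

definition osc :: "('a \<Rightarrow> real) \<Rightarrow> nat list \<Rightarrow> nat list \<Rightarrow> ennreal" where
  "osc u w v = (\<integral>\<^sup>+x\<in>kcell w. (\<integral>\<^sup>+y\<in>kcell v. ennreal (\<bar>u x - u y\<bar> powr p) \<partial>mu) \<partial>mu)"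

definition cell_dev :: "('a \<Rightarrow> real) \<Rightarrow> nat list \<Rightarrow> real \<Rightarrow> ennreal" where
  "cell_dev u w c = (\<integral>\<^sup>+x\<in>kcell w. ennreal (\<bar>u x - c\<bar> powr p) \<partial>mu)"

text \<open>Cell masses are of order N^-n, so the factor N^(2 n) turns each double integral into a
  mean, up to constants. This is the D_n u of the overview.\<close>

definition osc_energy :: "nat \<Rightarrow> ('a \<Rightarrow> real) \<Rightarrow> ennreal" where
  "osc_energy n u = ennreal (real N ^ (2 * n)) * (\<Sum>w\<in>W n. \<Sum>v\<in>W n. if adj w v then osc u w v else 0)"

definition dev_energy :: "nat \<Rightarrow> ('a \<Rightarrow> real) \<Rightarrow> (nat list \<Rightarrow> real) \<Rightarrow> ennreal" where
  "dev_energy n u f = ennreal (real N ^ n) * (\<Sum>w\<in>W n. cell_dev u w (f w))"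

lemma sum_adj_le_ennreal:
  fixes h :: "nat list \<Rightarrow> ennreal"
  shows "(\<Sum>w\<in>W n. \<Sum>v\<in>W n. if adj w v then h w else 0) \<le> ennreal mult * (\<Sum>w\<in>W n. h w)"
    "(\<Sum>w\<in>W n. \<Sum>v\<in>W n. if adj w v then h v else 0) \<le> ennreal mult * (\<Sum>w\<in>W n. h w)"
proof -
  have "(\<Sum>v\<in>W n. if adj w v then h w else 0) \<le> ennreal mult * h w" if w: "w \<in> W n" for w
  proof -
    have "(\<Sum>v\<in>W n. if adj w v then h w else 0) = of_nat (card {v\<in>W n. adj w v}) * h w"
      by (simp add: sum.inter_filter[symmetric] finite_words)
    also have "\<dots> \<le> of_nat mult * h w" using mult(2)[OF w] by (intro mult_right_mono of_nat_mono) auto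
    finally show ?thesis by (simp add: ennreal_of_nat_eq_real_of_nat)
  qed
  then have "(\<Sum>w\<in>W n. \<Sum>v\<in>W n. if adj w v then h w else 0) \<le> (\<Sum>w\<in>W n. ennreal mult * h w)"
    by (rule sum_mono)
  then show 1: "(\<Sum>w\<in>W n. \<Sum>v\<in>W n. if adj w v then h w else 0) \<le> ennreal mult * (\<Sum>w\<in>W n. h w)"
    by (simp add: sum_distrib_left)
  have "(\<Sum>w\<in>W n. \<Sum>v\<in>W n. if adj w v then h v else 0) = (\<Sum>w\<in>W n. \<Sum>v\<in>W n. if adj w v then h w else 0)"
    by (subst sum.swap) (simp add: adj_sym)
  then show "(\<Sum>w\<in>W n. \<Sum>v\<in>W n. if adj w v then h v else 0) \<le> ennreal mult * (\<Sum>w\<in>W n. h w)" using 1 by simp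
qed

lemma osc_le:
  assumes u [measurable]: "u \<in> borel_measurable mu" and w: "w \<in> W n" and v: "v \<in> W n"
  shows "osc u w v \<le> ennreal (3 powr p) * (ennreal (1 / real N ^ n) * cell_dev u w s
    + ennreal (\<bar>s - t\<bar> powr p) * ennreal (1 / real N ^ n) * ennreal (1 / real N ^ n)
    + ennreal (1 / real N ^ n) * cell_dev u v t)"
proof -
  note [measurable] = cell_sets[OF w] cell_sets[OF v]
  let ?c = "ennreal (1 / real N ^ n)" and ?q = "ennreal (3 powr p)" and ?b = "ennreal (\<bar>s - t\<bar> powr p)"
  have pt: "ennreal (\<bar>u x - u y\<bar> powr p) \<le> ?q * (ennreal (\<bar>u x - s\<bar> powr p) + ?b + ennreal (\<bar>u y - t\<bar> powr p))" for x y
  proof -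
    have "\<bar>u x - u y\<bar> powr p \<le> 3 powr p * (\<bar>u x - s\<bar> powr p + \<bar>s - t\<bar> powr p + \<bar>t - u y\<bar> powr p)"
      using p by (intro abs_diff3_powr_le) auto
    then have "ennreal (\<bar>u x - u y\<bar> powr p) \<le> ennreal (3 powr p * (\<bar>u x - s\<bar> powr p + \<bar>s - t\<bar> powr p + \<bar>t - u y\<bar> powr p))"
      by (rule ennreal_leI)
    then show ?thesis by (simp add: ennreal_mult abs_minus_commute)
  qed
  have inner: "(\<integral>\<^sup>+y\<in>kcell v. ennreal (\<bar>u x - u y\<bar> powr p) \<partial>mu)
      \<le> ?q * ((ennreal (\<bar>u x - s\<bar> powr p) + ?b) * ?c + cell_dev u v t)" for x
  proof -
    have "(\<integral>\<^sup>+y\<in>kcell v. ennreal (\<bar>u x - u y\<bar> powr p) \<partial>mu)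
        \<le> (\<integral>\<^sup>+y. ?q * ((ennreal (\<bar>u x - s\<bar> powr p) + ?b) * indicator (kcell v) y
            + ennreal (\<bar>u y - t\<bar> powr p) * indicator (kcell v) y) \<partial>mu)"
      using pt[of x] by (intro nn_integral_mono) (auto split: split_indicator)
    also have "\<dots> = ?q * ((ennreal (\<bar>u x - s\<bar> powr p) + ?b) * emeasure mu (kcell v) + cell_dev u v t)"
      by (simp add: nn_integral_cmult nn_integral_add nn_integral_cmult_indicator cell_dev_def)
    also have "\<dots> \<le> ?q * ((ennreal (\<bar>u x - s\<bar> powr p) + ?b) * ?c + cell_dev u v t)"
      by (intro mult_left_mono add_right_mono mu_cell_le v) auto
    finally show ?thesis .
  qed
  have "osc u w v \<le> (\<integral>\<^sup>+x\<in>kcell w. ?q * ((ennreal (\<bar>u x - s\<bar> powr p) + ?b) * ?c + cell_dev u v t) \<partial>mu)"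
    unfolding osc_def using inner by (intro nn_integral_mono) (auto split: split_indicator)
  also have "\<dots> = (\<integral>\<^sup>+x. ?q * (?c * (ennreal (\<bar>u x - s\<bar> powr p) * indicator (kcell w) x)
      + (?b * ?c + cell_dev u v t) * indicator (kcell w) x) \<partial>mu)"
    by (intro nn_integral_cong) (simp split: split_indicator add: algebra_simps)
  also have "\<dots> = ?q * (?c * cell_dev u w s + (?b * ?c + cell_dev u v t) * emeasure mu (kcell w))"
    by (simp add: nn_integral_cmult nn_integral_add nn_integral_cmult_indicator cell_dev_def)
  also have "\<dots> \<le> ?q * (?c * cell_dev u w s + (?b * ?c + cell_dev u v t) * ?c)"
    by (intro mult_left_mono add_left_mono mu_cell_le w) auto
  finally show ?thesis by (simp add: algebra_simps)
qed

lemma ennreal_N_pow: "ennreal (real N ^ n) * ennreal (1 / real N ^ n) = 1"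
  using N_ge_2 by (simp add: ennreal_mult[symmetric])

text \<open>Compare u on two meeting cells through the values g w and g v. The function g is
  arbitrary and is chosen according to the application.\<close>

lemma osc_energy_le:
  assumes u: "u \<in> borel_measurable mu"
  shows "osc_energy n u \<le> ennreal (3 powr p) * (ennreal (2 * mult) * dev_energy n u g + ennreal (energy n g))"
proof -
  let ?c = "ennreal (1 / real N ^ n)" and ?q = "ennreal (3 powr p)" and ?N = "ennreal (real N ^ n)"
  let ?a = "\<lambda>w. ?c * cell_dev u w (g w)"
  have et: "(if adj w v then osc u w v else 0) \<le> ?q * ((if adj w v then ?a w else 0)
      + ?c * ?c * ennreal (eterm g w v) + (if adj w v then ?a v else 0))" if "w \<in> W n" "v \<in> W n" for w v
    using osc_le[OF u that, of "g w" "g v"] by (simp add: eterm_def ac_simps)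
  have "(\<Sum>w\<in>W n. \<Sum>v\<in>W n. if adj w v then osc u w v else 0)
     \<le> (\<Sum>w\<in>W n. \<Sum>v\<in>W n. ?q * ((if adj w v then ?a w else 0)
      + ?c * ?c * ennreal (eterm g w v) + (if adj w v then ?a v else 0)))"
    by (intro sum_mono et)
  also have "\<dots> = ?q * ((\<Sum>w\<in>W n. \<Sum>v\<in>W n. if adj w v then ?a w else 0)
      + ?c * ?c * (\<Sum>w\<in>W n. \<Sum>v\<in>W n. ennreal (eterm g w v))
      + (\<Sum>w\<in>W n. \<Sum>v\<in>W n. if adj w v then ?a v else 0))"
    by (simp add: sum_distrib_left sum.distrib distrib_left)
  also have "(\<Sum>w\<in>W n. \<Sum>v\<in>W n. ennreal (eterm g w v)) = ennreal (energy n g)"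
    by (simp add: energy_def sum_ennreal eterm_nonneg sum_nonneg)
  also have "?q * ((\<Sum>w\<in>W n. \<Sum>v\<in>W n. if adj w v then ?a w else 0) + ?c * ?c * ennreal (energy n g)
      + (\<Sum>w\<in>W n. \<Sum>v\<in>W n. if adj w v then ?a v else 0))
    \<le> ?q * (ennreal mult * (\<Sum>w\<in>W n. ?a w) + ?c * ?c * ennreal (energy n g) + ennreal mult * (\<Sum>w\<in>W n. ?a w))"
    by (intro mult_left_mono add_mono sum_adj_le_ennreal) auto
  finally have "osc_energy n u \<le> ennreal (real N ^ (2 * n)) * (?q * (ennreal mult * (\<Sum>w\<in>W n. ?a w)
      + ?c * ?c * ennreal (energy n g) + ennreal mult * (\<Sum>w\<in>W n. ?a w)))"
    unfolding osc_energy_def by (intro mult_left_mono) auto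
  also have "(\<Sum>w\<in>W n. ?a w) = ?c * (\<Sum>w\<in>W n. cell_dev u w (g w))" (is "_ = ?c * ?S") by (simp add: sum_distrib_left)
  also have "ennreal (real N ^ (2 * n)) = ?N * ?N" by (simp add: ennreal_mult[symmetric] mult_2 power_add)
  also have "?N * ?N * (?q * (ennreal mult * (?c * ?S) + ?c * ?c * ennreal (energy n g) + ennreal mult * (?c * ?S)))
    = ?q * ((ennreal mult + ennreal mult) * (?N * ?c) * (?N * ?S) + (?N * ?c) * (?N * ?c) * ennreal (energy n g))"
    by (simp add: algebra_simps)
  also have "ennreal mult + ennreal mult = ennreal (2 * mult)" by (simp flip: ennreal_plus)
  finally show ?thesis by (simp add: ennreal_N_pow dev_energy_def)
qed

lemma dev_energy_le:
  assumes u [measurable]: "u \<in> borel_measurable mu"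
  shows "dev_energy n u g \<le> ennreal (3 powr p) * (ennreal (1 / real N ^ k) * dev_energy (n + k) u f
    + ennreal ((\<Sum>w\<in>W n. \<Sum>v\<in>W k. \<bar>f (w @ v) - g w\<bar> powr p) / real N ^ k))"
proof -
  let ?q = "ennreal (3 powr p)" and ?c = "ennreal (1 / real N ^ (n + k))" and ?N = "ennreal (real N ^ n)"
  let ?e = "\<lambda>w v. \<bar>f (w @ v) - g w\<bar> powr p"
  have one: "(\<integral>\<^sup>+x\<in>kcell (w @ v). ennreal (\<bar>u x - g w\<bar> powr p) \<partial>mu)
      \<le> ?q * (cell_dev u (w @ v) (f (w @ v)) + ennreal (?e w v) * ?c)"
    if wv: "w \<in> W n" "v \<in> W k" for w v
  proof -
    note [measurable] = cell_sets[OF words_append[OF wv]]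
    have pt: "ennreal (\<bar>u x - g w\<bar> powr p) \<le> ?q * (ennreal (\<bar>u x - f (w @ v)\<bar> powr p) + ennreal (?e w v))" for x
    proof -
      have "\<bar>u x - g w\<bar> powr p \<le> 3 powr p * (\<bar>u x - f (w @ v)\<bar> powr p + ?e w v)"
        using abs_diff3_powr_le[of p "u x" "g w" "f (w @ v)" "g w"] p by simp
      then have "ennreal (\<bar>u x - g w\<bar> powr p) \<le> ennreal (3 powr p * (\<bar>u x - f (w @ v)\<bar> powr p + ?e w v))"
        by (rule ennreal_leI)
      then show ?thesis by (simp add: ennreal_mult)
    qed
    have "(\<integral>\<^sup>+x\<in>kcell (w @ v). ennreal (\<bar>u x - g w\<bar> powr p) \<partial>mu)
      \<le> (\<integral>\<^sup>+x. ?q * (ennreal (\<bar>u x - f (w @ v)\<bar> powr p) * indicator (kcell (w @ v)) x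
          + ennreal (?e w v) * indicator (kcell (w @ v)) x) \<partial>mu)"
      using pt by (intro nn_integral_mono) (auto split: split_indicator)
    also have "\<dots> = ?q * (cell_dev u (w @ v) (f (w @ v)) + ennreal (?e w v) * emeasure mu (kcell (w @ v)))"
      by (simp add: nn_integral_cmult nn_integral_add nn_integral_cmult_indicator cell_dev_def)
    also have "\<dots> \<le> ?q * (cell_dev u (w @ v) (f (w @ v)) + ennreal (?e w v) * ?c)"
      by (intro mult_left_mono add_left_mono mu_cell_le words_append wv) auto
    finally show ?thesis .
  qed
  have "(\<Sum>w\<in>W n. cell_dev u w (g w)) \<le> (\<Sum>w\<in>W n. \<Sum>v\<in>W k. ?q * (cell_dev u (w @ v) (f (w @ v)) + ennreal (?e w v) * ?c))"
  proof (rule sum_mono)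
    fix w assume w: "w \<in> W n"
    have "cell_dev u w (g w) \<le> (\<Sum>v\<in>W k. \<integral>\<^sup>+x\<in>kcell (w @ v). ennreal (\<bar>u x - g w\<bar> powr p) \<partial>mu)"
      unfolding cell_dev_def
    proof (rule nn_integral_UN_le)
      show "kcell w \<subseteq> (\<Union>v\<in>W k. kcell (w @ v))" using cell_cells[OF w, of k] by simp
      show "kcell (w @ v) \<in> sets mu" if "v \<in> W k" for v using cell_sets words_append[OF w that] .
    qed (auto simp: finite_words)
    also have "\<dots> \<le> (\<Sum>v\<in>W k. ?q * (cell_dev u (w @ v) (f (w @ v)) + ennreal (?e w v) * ?c))"
      by (intro sum_mono one w)
    finally show "cell_dev u w (g w) \<le> (\<Sum>v\<in>W k. ?q * (cell_dev u (w @ v) (f (w @ v)) + ennreal (?e w v) * ?c))" .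
  qed
  also have "\<dots> = ?q * ((\<Sum>w\<in>W (n + k). cell_dev u w (f w)) + (\<Sum>w\<in>W n. \<Sum>v\<in>W k. ennreal (?e w v)) * ?c)"
    by (simp add: sum_words_add sum.distrib sum_distrib_left sum_distrib_right distrib_left del: sum_ennreal)
  also have "(\<Sum>w\<in>W n. \<Sum>v\<in>W k. ennreal (?e w v)) = ennreal (\<Sum>w\<in>W n. \<Sum>v\<in>W k. ?e w v)" (is "_ = ennreal ?E")
    by (simp add: sum_ennreal sum_nonneg)
  finally have "dev_energy n u g \<le> ?N * (?q * ((\<Sum>w\<in>W (n + k). cell_dev u w (f w)) + ennreal ?E * ?c))" (is "_ \<le> ?N * (?q * (?S + _))")
    unfolding dev_energy_def by (intro mult_left_mono) auto
  also have "\<dots> = ?q * (?N * ?S + ennreal ?E * (?N * ?c))" by (simp add: algebra_simps)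
  also have "?N * ?c = ennreal (1 / real N ^ k)"
    using N_ge_2 by (simp add: ennreal_mult[symmetric] power_add)
  also have "?N * ?S = ennreal (1 / real N ^ k) * dev_energy (n + k) u f"
    using N_ge_2 by (simp add: dev_energy_def mult.assoc[symmetric] ennreal_mult[symmetric] power_add)
  also have "ennreal ?E * ennreal (1 / real N ^ k) = ennreal (?E / real N ^ k)"
    by (simp add: ennreal_mult[symmetric] sum_nonneg)
  finally show ?thesis .
qed

text \<open>Sample f at a corner of each n-cell. Sampling costs a factor of order theta^k in energy,
  and the deviation of f from its samples inside the n-cells is bounded by
  \<open>ex_poincare\<close>, whose factor N^k cancels against the normalisation. Keeping 1 / N^k in
  front of the deviation term lets that term vanish as k grows when f approximates u well.\<close>

lemma ex_osc_energy_le: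
  "\<exists>C\<ge>1. \<forall>u\<in>borel_measurable mu. \<forall>n k f. osc_energy n u \<le> ennreal C *
     (ennreal (1 / real N ^ k) * dev_energy (n + k) u f + ennreal (theta ^ k * energy (n + k) f))"
proof -
  obtain x0 where x0: "x0 \<in> V0" using V0_ne by blast
  obtain A where A: "1 \<le> A" "\<And>m f. (\<Sum>w\<in>W m. \<bar>f w - f (corner m x0)\<bar> powr p) \<le> A * (N * theta) ^ m * energy m f"
    using ex_poincare[OF x0] by blast
  obtain D where D: "1 \<le> D" "\<And>n. res n \<le> D * theta ^ n" using res_theta by blast
  define C where "C = 3 powr p * (2 * mult * 3 powr p * A + sample_const * D)"
  have th: "0 < theta" using theta_ge_1 by simp
  have "osc_energy n u \<le> ennreal C * (ennreal (1 / real N ^ k) * dev_energy (n + k) u f + ennreal (theta ^ k * energy (n + k) f))"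
    if u: "u \<in> borel_measurable mu" for u n k f
  proof -
    define g where "g w = f (w @ corner k x0)" for w
    let ?E = "energy (n + k) f" and ?q = "3 powr p" and ?Q = "ennreal (1 / real N ^ k) * dev_energy (n + k) u f"
    have E0: "0 \<le> ?E" by (rule energy_nonneg)
    have eb: "energy n g \<le> sample_const * D * (theta ^ k * ?E)"
    proof -
      have "energy n g \<le> sample_const * res k * ?E" unfolding g_def[abs_def] by (intro sample_energy res_res_bound res_ge_1 x0)
      also have "\<dots> \<le> sample_const * (D * theta ^ k) * ?E"
        using D(2) sample_const_ge E0 by (intro mult_right_mono mult_left_mono) auto
      finally show ?thesis by (simp add: ac_simps)
    qed
    have "(\<Sum>w\<in>W n. \<Sum>v\<in>W k. \<bar>f (w @ v) - g w\<bar> powr p) \<le> (\<Sum>w\<in>W n. A * (N * theta) ^ k * block k f w w)"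
      using A(2) by (intro sum_mono) (simp add: g_def block_self)
    also have "\<dots> \<le> A * (N * theta) ^ k * ?E"
      unfolding sum_distrib_left[symmetric] using A(1) th by (intro mult_left_mono sum_block_self_le) auto
    finally have "(\<Sum>w\<in>W n. \<Sum>v\<in>W k. \<bar>f (w @ v) - g w\<bar> powr p) / real N ^ k \<le> A * (theta ^ k * ?E)"
      using N_ge_2 by (simp add: divide_le_eq power_mult_distrib ac_simps)
    then have "dev_energy n u g \<le> ennreal ?q * (?Q + ennreal (A * (theta ^ k * ?E)))"
      by (intro order_trans[OF dev_energy_le[OF u, of n g k f]] mult_left_mono add_left_mono ennreal_leI) auto
    also have "\<dots> \<le> ennreal ?q * (ennreal A * ?Q + ennreal A * ennreal (theta ^ k * ?E))"
      using A(1) th E0 mult_right_mono[of 1 "ennreal A" ?Q]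
      by (intro mult_left_mono add_mono) (auto simp: ennreal_mult)
    finally have Q: "dev_energy n u g \<le> ennreal (?q * A) * (?Q + ennreal (theta ^ k * ?E))"
      using A(1) by (simp add: ennreal_mult distrib_left mult.assoc)
    have "osc_energy n u \<le> ennreal ?q * (ennreal (2 * mult) * dev_energy n u g + ennreal (energy n g))" by (rule osc_energy_le[OF u])
    also have "\<dots> \<le> ennreal ?q * (ennreal (2 * mult) * (ennreal (?q * A) * (?Q + ennreal (theta ^ k * ?E)))
        + ennreal (sample_const * D) * (?Q + ennreal (theta ^ k * ?E)))"
    proof (intro mult_left_mono add_mono Q)
      have "ennreal (energy n g) \<le> ennreal (sample_const * D * (theta ^ k * ?E))" by (rule ennreal_leI[OF eb])
      also have "\<dots> = ennreal (sample_const * D) * ennreal (theta ^ k * ?E)"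
        using sample_const_ge D(1) th E0 by (intro ennreal_mult) auto
      also have "\<dots> \<le> ennreal (sample_const * D) * (?Q + ennreal (theta ^ k * ?E))"
        by (intro mult_left_mono) (auto simp: add_increasing)
      finally show "ennreal (energy n g) \<le> ennreal (sample_const * D) * (?Q + ennreal (theta ^ k * ?E))" .
    qed auto
    also have "\<dots> = ennreal C * (?Q + ennreal (theta ^ k * ?E))"
    proof -
      have "ennreal C = ennreal ?q * (ennreal (2 * mult) * ennreal (?q * A) + ennreal (sample_const * D))"
        using A(1) sample_const_ge D(1) by (simp add: C_def ennreal_mult[symmetric] ennreal_plus[symmetric] mult.assoc del: ennreal_plus)
      then show ?thesis by (simp add: algebra_simps)
    qed
    finally show ?thesis .
  qed
  moreover have "1 \<le> C"
  proof -
    have "1 * 1 \<le> sample_const * D" using sample_const_ge D by (intro mult_mono) auto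
    then have "1 * 1 \<le> 3 powr p * (2 * mult * 3 powr p * A + sample_const * D)"
      using p A(1) by (intro mult_mono ge_one_powr_ge_zero) (auto simp: add_increasing)
    then show ?thesis by (simp add: C_def)
  qed
  ultimately show ?thesis by blast
qed

lemma emeasure_cell_pos: "w \<in> W n \<Longrightarrow> emeasure mu (kcell w) \<noteq> 0"
proof -
  assume w: "w \<in> W n"
  have "0 < mass_const / real N ^ n" using mass_const_pos N_ge_2 by (intro divide_pos_pos) auto
  then have "0 < ennreal (mass_const / real N ^ n)" by (simp only: ennreal_less_zero_iff)
  then show ?thesis using mu_cell_ge[OF w] by (metis not_le)
qed

lemma divide_mu_cell_le:
  assumes "w \<in> W n"
  shows "a / emeasure mu (kcell w) \<le> ennreal (real N ^ n / mass_const) * a"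
proof -
  have "inverse (emeasure mu (kcell w)) \<le> inverse (ennreal (mass_const / real N ^ n))"
    using mu_cell_ge[OF assms] by (rule inverse_antimono_ennreal)
  also have "\<dots> = ennreal (real N ^ n / mass_const)" using mass_const_pos N_ge_2 by (subst inverse_ennreal) (auto simp: field_simps)
  finally show ?thesis unfolding divide_ennreal_def by (subst mult.commute) (rule mult_right_mono, auto)
qed

section \<open>Cell averages and comparison of levels\<close>

definition avg :: "('a \<Rightarrow> real) \<Rightarrow> nat list \<Rightarrow> real" where
  "avg u w = (\<integral>x. u x \<partial>uniform_measure mu (kcell w))"

lemma avg_jensen:
  assumes u: "u \<in> Lp_functions p mu" and w: "w \<in> W n"
  shows "ennreal (\<bar>avg u w - c\<bar> powr p) \<le> ennreal (real N ^ n / mass_const) * cell_dev u w c"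
proof -
  have um: "u \<in> borel_measurable mu" and fin: "(\<integral>\<^sup>+x. ennreal (\<bar>u x\<bar> powr p) \<partial>mu) < \<infinity>"
    using u by (auto simp: Lp_functions_def)
  have "(\<integral>\<^sup>+x\<in>kcell w. ennreal (\<bar>u x\<bar> powr p) \<partial>mu) \<le> (\<integral>\<^sup>+x. ennreal (\<bar>u x\<bar> powr p) \<partial>mu)"
    by (intro nn_integral_mono) (auto split: split_indicator)
  then have "(\<integral>\<^sup>+x\<in>kcell w. ennreal (\<bar>u x\<bar> powr p) \<partial>mu) < \<infinity>" using fin by (rule le_less_trans)
  then have "ennreal (\<bar>avg u w - c\<bar> powr p) \<le> cell_dev u w c / emeasure mu (kcell w)"
    unfolding avg_def cell_dev_def using um p emeasure_cell_pos[OF w]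
    by (intro jensen_uniform_measure) auto
  also have "\<dots> \<le> ennreal (real N ^ n / mass_const) * cell_dev u w c" by (rule divide_mu_cell_le[OF w])
  finally show ?thesis .
qed

text \<open>Jensen on the cell w with u x held fixed, then integration of x over the cell v.\<close>

lemma cell_dev_avg_le:
  assumes u: "u \<in> Lp_functions p mu" and w: "w \<in> W n" and v: "v \<in> W n"
  shows "cell_dev u v (avg u w) \<le> ennreal (real N ^ n / mass_const) * osc u v w"
proof -
  have [measurable]: "u \<in> borel_measurable mu" using u by (auto simp: Lp_functions_def)
  note [measurable] = cell_sets[OF w] cell_sets[OF v]
  have "cell_dev u v (avg u w) \<le> (\<integral>\<^sup>+x. ennreal (real N ^ n / mass_const) *
      ((\<integral>\<^sup>+y\<in>kcell w. ennreal (\<bar>u x - u y\<bar> powr p) \<partial>mu) * indicator (kcell v) x) \<partial>mu)"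
    unfolding cell_dev_def
  proof (rule nn_integral_mono)
    fix x
    have "ennreal (\<bar>u x - avg u w\<bar> powr p) \<le> ennreal (real N ^ n / mass_const) * (\<integral>\<^sup>+y\<in>kcell w. ennreal (\<bar>u x - u y\<bar> powr p) \<partial>mu)"
      using avg_jensen[OF u w, of "u x"] by (simp add: cell_dev_def abs_minus_commute)
    then show "ennreal (\<bar>u x - avg u w\<bar> powr p) * indicator (kcell v) x \<le> ennreal (real N ^ n / mass_const) *
      ((\<integral>\<^sup>+y\<in>kcell w. ennreal (\<bar>u x - u y\<bar> powr p) \<partial>mu) * indicator (kcell v) x)"
      by (auto split: split_indicator)
  qed
  also have "\<dots> = ennreal (real N ^ n / mass_const) * osc u v w"
    unfolding osc_def by (rule nn_integral_cmult) measurable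
  finally show ?thesis .
qed

lemma dev_energy_avg_le:
  assumes u: "u \<in> Lp_functions p mu"
  shows "dev_energy n u (avg u) \<le> ennreal (1 / mass_const) * osc_energy n u"
proof -
  have "(\<Sum>w\<in>W n. cell_dev u w (avg u w)) \<le> (\<Sum>w\<in>W n. ennreal (real N ^ n / mass_const) * (\<Sum>v\<in>W n. if adj w v then osc u w v else 0))"
  proof (rule sum_mono)
    fix w assume w: "w \<in> W n"
    have "osc u w w \<le> (\<Sum>v\<in>W n. if adj w v then osc u w v else 0)"
      using member_le_sum[of w "W n" "\<lambda>v. if adj w v then osc u w v else 0"] w by (auto simp: finite_words)
    then show "cell_dev u w (avg u w) \<le> ennreal (real N ^ n / mass_const) * (\<Sum>v\<in>W n. if adj w v then osc u w v else 0)"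
      by (intro order_trans[OF cell_dev_avg_le[OF u w w]] mult_left_mono) auto
  qed
  then have "dev_energy n u (avg u) \<le> ennreal (real N ^ n) * (\<Sum>w\<in>W n. ennreal (real N ^ n / mass_const) * (\<Sum>v\<in>W n. if adj w v then osc u w v else 0))"
    unfolding dev_energy_def by (intro mult_left_mono) auto
  also have "\<dots> = ennreal (1 / mass_const) * osc_energy n u"
  proof -
    have "ennreal (real N ^ n) * ennreal (real N ^ n / mass_const) = ennreal (1 / mass_const) * ennreal (real N ^ (2 * n))"
      using mass_const_pos by (simp add: ennreal_mult[symmetric] mult_2 power_add)
    then show ?thesis by (simp add: osc_energy_def sum_distrib_left[symmetric] mult.assoc[symmetric])
  qed
  finally show ?thesis .
qed

lemma energy_avg_le:
  assumes u: "u \<in> Lp_functions p mu"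
  shows "ennreal (energy n (avg u)) \<le> ennreal (1 / mass_const\<^sup>2) * osc_energy n u"
proof -
  have "ennreal (energy n (avg u)) = (\<Sum>w\<in>W n. \<Sum>v\<in>W n. ennreal (eterm (avg u) w v))"
    by (simp add: energy_def sum_ennreal eterm_nonneg sum_nonneg)
  also have "\<dots> \<le> (\<Sum>w\<in>W n. \<Sum>v\<in>W n. ennreal (real N ^ (2 * n) / mass_const\<^sup>2) * (if adj w v then osc u w v else 0))"
  proof (intro sum_mono)
    fix w v assume wv: "w \<in> W n" "v \<in> W n"
    have "ennreal (\<bar>avg u w - avg u v\<bar> powr p) \<le> ennreal (real N ^ n / mass_const) * cell_dev u w (avg u v)"
      by (rule avg_jensen[OF u wv(1)])
    also have "\<dots> \<le> ennreal (real N ^ n / mass_const) * (ennreal (real N ^ n / mass_const) * osc u w v)"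
      by (intro mult_left_mono cell_dev_avg_le u wv) auto
    also have "\<dots> = ennreal (real N ^ (2 * n) / mass_const\<^sup>2) * osc u w v"
      using mass_const_pos by (simp add: mult.assoc[symmetric] ennreal_mult[symmetric] mult_2 power_add power2_eq_square)
    finally show "ennreal (eterm (avg u) w v) \<le> ennreal (real N ^ (2 * n) / mass_const\<^sup>2) * (if adj w v then osc u w v else 0)"
      by (simp add: eterm_def)
  qed
  also have "\<dots> = ennreal (1 / mass_const\<^sup>2) * osc_energy n u"
  proof -
    have "ennreal (real N ^ (2 * n) / mass_const\<^sup>2) = ennreal (1 / mass_const\<^sup>2) * ennreal (real N ^ (2 * n))"
      by (simp add: ennreal_mult[symmetric])
    then show ?thesis by (simp add: osc_energy_def sum_distrib_left[symmetric] mult.assoc)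
  qed
  finally show ?thesis .
qed

text \<open>The case of \<open>ex_osc_energy_le\<close> where f consists of the cell averages: by
  Jensen, both their deviation from u and their energy at level n + k are bounded by the oscillation
  energy of that level.\<close>

lemma ex_osc_energy_mono:
  "\<exists>C>0. \<forall>u\<in>Lp_functions p mu. \<forall>n k. osc_energy n u \<le> ennreal (C * theta ^ k) * osc_energy (n + k) u"
proof -
  obtain C where C: "1 \<le> C" "\<And>u n k f. u \<in> borel_measurable mu \<Longrightarrow> osc_energy n u \<le> ennreal C *
     (ennreal (1 / real N ^ k) * dev_energy (n + k) u f + ennreal (theta ^ k * energy (n + k) f))"
    using ex_osc_energy_le by blast
  define B where "B = C * (1 / mass_const + 1 / mass_const\<^sup>2)"
  have "osc_energy n u \<le> ennreal (B * theta ^ k) * osc_energy (n + k) u" if u: "u \<in> Lp_functions p mu" for u n k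
  proof -
    let ?D = "osc_energy (n + k) u"
    have um: "u \<in> borel_measurable mu" using u by (auto simp: Lp_functions_def)
    have th: "1 \<le> theta ^ k" using theta_ge_1 by simp
    have "1 / real N ^ k \<le> 1" using N_ge_2 by (simp add: divide_le_eq)
    then have Nk: "1 / real N ^ k \<le> theta ^ k" using th by linarith
    have "osc_energy n u \<le> ennreal C * (ennreal (1 / real N ^ k) * dev_energy (n + k) u (avg u)
        + ennreal (theta ^ k * energy (n + k) (avg u)))" by (rule C(2)[OF um])
    also have "\<dots> \<le> ennreal C * (ennreal (theta ^ k) * (ennreal (1 / mass_const) * ?D)
        + ennreal (theta ^ k) * (ennreal (1 / mass_const\<^sup>2) * ?D))"
      using th Nk energy_nonneg by (intro mult_left_mono add_mono mult_mono ennreal_leI dev_energy_avg_le u)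
        (auto simp: ennreal_mult intro!: mult_left_mono energy_avg_le u)
    also have "\<dots> = ennreal (B * theta ^ k) * ?D"
    proof -
      have "ennreal (B * theta ^ k) = ennreal C * (ennreal (theta ^ k) * ennreal (1 / mass_const) + ennreal (theta ^ k) * ennreal (1 / mass_const\<^sup>2))"
        using C(1) th mass_const_pos
        by (simp add: B_def ennreal_mult[symmetric] ennreal_plus[symmetric] algebra_simps del: ennreal_plus)
      then show ?thesis by (simp add: algebra_simps)
    qed
    finally show ?thesis .
  qed
  moreover have "0 < B" using C(1) mass_const_pos by (simp add: B_def add_pos_pos)
  ultimately show ?thesis by blast
qed

end

section \<open>Comparison with the Korevaar-Schoen functional\<close>

lemma ennreal_mult_mult: "0 \<le> a \<Longrightarrow> 0 \<le> b \<Longrightarrow> ennreal a * (ennreal b * x) = ennreal (a * b) * x"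
  by (simp add: ennreal_mult mult.assoc)

lemma ennreal_mult_inverse_le: "a \<le> ennreal c * b \<Longrightarrow> 0 < c \<Longrightarrow> ennreal (1 / c) * a \<le> b"
proof -
  assume le: "a \<le> ennreal c * b" and c: "0 < c"
  have "ennreal (1 / c) * a \<le> ennreal (1 / c) * (ennreal c * b)" using le by (intro mult_left_mono) auto
  also have "\<dots> = b" using c by (simp add: mult.assoc[symmetric] ennreal_mult[symmetric])
  finally show ?thesis .
qed

lemma divide_ennreal_le: "ennreal c \<le> e \<Longrightarrow> 0 < c \<Longrightarrow> a / e \<le> ennreal (1 / c) * a"
proof -
  assume "ennreal c \<le> e" and c: "0 < c"
  then have "inverse e \<le> ennreal (1 / c)"
    using inverse_antimono_ennreal[of "ennreal c" e] by (simp add: inverse_ennreal inverse_eq_divide)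
  then show ?thesis unfolding divide_ennreal_def by (subst mult.commute) (rule mult_right_mono, auto)
qed

lemma divide_ennreal_ge: "e \<le> ennreal c \<Longrightarrow> 0 < c \<Longrightarrow> ennreal (1 / c) * a \<le> a / e"
proof -
  assume "e \<le> ennreal c" and c: "0 < c"
  then have "ennreal (1 / c) \<le> inverse e"
    using inverse_antimono_ennreal[of e "ennreal c"] by (simp add: inverse_ennreal inverse_eq_divide)
  then show ?thesis unfolding divide_ennreal_def by (subst (2) mult.commute) (rule mult_right_mono, auto)
qed

context nested_fractal_energy
begin

interpretation mu: finite_measure mu by (rule finite_measure_mu)

abbreviation pdiff :: "('a \<Rightarrow> real) \<Rightarrow> 'a \<Rightarrow> 'a \<Rightarrow> ennreal" where
  "pdiff u x y \<equiv> ennreal (\<bar>u x - u y\<bar> powr p)"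

text \<open>The integrand in x of the oscillation energy, isolated so that the comparison with
  \<open>Phi\<close> can be made pointwise in x.\<close>

definition local_osc :: "nat \<Rightarrow> ('a \<Rightarrow> real) \<Rightarrow> 'a \<Rightarrow> ennreal" where
  "local_osc n u x = (\<Sum>w\<in>W n. \<Sum>v\<in>W n. if adj w v then (\<integral>\<^sup>+y\<in>kcell v. pdiff u x y \<partial>mu) * indicator (kcell w) x else 0)"

lemma nn_integral_cell_measurable:
  assumes [measurable]: "u \<in> borel_measurable mu" and v: "v \<in> W n"
  shows "(\<lambda>x. \<integral>\<^sup>+y\<in>kcell v. pdiff u x y \<partial>mu) \<in> borel_measurable mu"
proof -
  note [measurable] = cell_sets[OF v]
  show ?thesis by measurable
qed

lemma local_osc_term_measurable:
  assumes u: "u \<in> borel_measurable mu" and wv: "w \<in> W n" "v \<in> W n"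
  shows "(\<lambda>x. if adj w v then (\<integral>\<^sup>+y\<in>kcell v. pdiff u x y \<partial>mu) * indicator (kcell w) x else 0) \<in> borel_measurable mu"
  using nn_integral_cell_measurable[OF u wv(2)] cell_sets[OF wv(1)]
  by (cases "adj w v") auto

lemma local_osc_measurable: "u \<in> borel_measurable mu \<Longrightarrow> local_osc n u \<in> borel_measurable mu"
  unfolding local_osc_def[abs_def] by (intro borel_measurable_sum local_osc_term_measurable) auto

lemma nn_integral_local_osc:
  assumes u: "u \<in> borel_measurable mu"
  shows "osc_energy n u = ennreal (real N ^ (2 * n)) * (\<integral>\<^sup>+x. local_osc n u x \<partial>mu)"
proof -
  have "(\<integral>\<^sup>+x. local_osc n u x \<partial>mu) = (\<Sum>w\<in>W n. \<integral>\<^sup>+x. (\<Sum>v\<in>W n. if adj w v then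
      (\<integral>\<^sup>+y\<in>kcell v. pdiff u x y \<partial>mu) * indicator (kcell w) x else 0) \<partial>mu)"
    unfolding local_osc_def by (intro nn_integral_sum borel_measurable_sum local_osc_term_measurable u)
  also have "\<dots> = (\<Sum>w\<in>W n. \<Sum>v\<in>W n. \<integral>\<^sup>+x. (if adj w v then
      (\<integral>\<^sup>+y\<in>kcell v. pdiff u x y \<partial>mu) * indicator (kcell w) x else 0) \<partial>mu)"
    by (intro sum.cong refl nn_integral_sum local_osc_term_measurable u)
  also have "\<dots> = (\<Sum>w\<in>W n. \<Sum>v\<in>W n. if adj w v then osc u w v else 0)"
    by (intro sum.cong refl) (simp add: osc_def)
  finally show ?thesis by (simp add: osc_energy_def)
qed

text \<open>The factor per level: \<open>Phi\<close> at radii of order \<rho>^n is compared with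
  \<open>scale_ratio \<sigma> ^ n * osc_energy n u\<close>.\<close>

definition scale_ratio :: "real \<Rightarrow> real" where "scale_ratio \<sigma> = 1 / (N * \<rho> powr (p * \<sigma>))"

lemma scale_ratio_pos: "0 < scale_ratio \<sigma>" using N_ge_2 rho by (simp add: scale_ratio_def)

lemma scale_ratio_pow: "scale_ratio \<sigma> ^ n = 1 / (real N ^ n * (\<rho> ^ n) powr (p * \<sigma>))"
  by (simp add: scale_ratio_def power_divide power_mult_distrib rho_pow_powr)

abbreviation mean_pdiff :: "('a \<Rightarrow> real) \<Rightarrow> real \<Rightarrow> 'a \<Rightarrow> ennreal" where
  "mean_pdiff u r x \<equiv> (\<integral>\<^sup>+y\<in>mball_in mu x r. pdiff u x y \<partial>mu) / emeasure mu (mball_in mu x r)"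

lemma mball_in_eq: "mball_in mu x r = K \<inter> ball x r"
  by (auto simp: mball_in_def)

lemma mball_in_sets: "mball_in mu x r \<in> sets mu"
  using K_borel by (auto simp: sets_mu mball_in_eq)

text \<open>Take n with \<open>gap\<close> * \<rho>^(n+1) \<le> r < \<open>gap\<close> * \<rho>^n.
  If r \<ge> \<open>gap\<close>, level 0 works because its only cell meets itself.\<close>

lemma ex_scale_upper:
  assumes "0 < r" "r < 1"
  obtains n where "gap * \<rho> ^ Suc n \<le> r"
    "\<And>x y w v. w \<in> W n \<Longrightarrow> v \<in> W n \<Longrightarrow> x \<in> kcell w \<Longrightarrow> y \<in> kcell v \<Longrightarrow> dist x y < r \<Longrightarrow> adj w v"
proof (cases "gap \<le> r")
  case True
  have "gap * \<rho> \<le> gap * 1" using gap(1) rho by (intro mult_left_mono) auto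
  then have "gap * \<rho> ^ Suc 0 \<le> r" using True by simp
  then show ?thesis by (rule that) simp
next
  case False
  obtain j0 where "\<rho> ^ j0 < r / gap" using real_arch_pow_inv[of "r / gap" \<rho>] assms gap(1) rho by auto
  then have ex: "gap * \<rho> ^ j0 \<le> r" using gap(1) by (simp add: field_simps)
  define j where "j = (LEAST j. gap * \<rho> ^ j \<le> r)"
  have j: "gap * \<rho> ^ j \<le> r" unfolding j_def using ex by (rule LeastI)
  then have "j \<noteq> 0" using False by (cases j) auto
  then obtain n where n: "j = Suc n" by (cases j) auto
  have lt: "r < gap * \<rho> ^ n"
    using not_less_Least[of n "\<lambda>j. gap * \<rho> ^ j \<le> r"] n by (simp add: j_def)
  show ?thesis
  proof (rule that[of n])
    show "gap * \<rho> ^ Suc n \<le> r" using j n by simp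
    fix x y w v assume "w \<in> W n" "v \<in> W n" "x \<in> kcell w" "y \<in> kcell v" "dist x y < r"
    then show "adj w v" using lt by (intro gap(3)[of w n v x y]) auto
  qed
qed

lemma ex_Phi_le:
  assumes s: "0 \<le> \<sigma>"
  shows "\<exists>C>0. \<forall>u\<in>borel_measurable mu. \<forall>r. 0 < r \<longrightarrow> r < 1 \<longrightarrow>
    (\<exists>n. Phi mu p \<sigma> u r \<le> ennreal (C * scale_ratio \<sigma> ^ n) * osc_energy n u)"
proof -
  \<comment> \<open>These k further levels make the cell through x fit into the ball of radius r,
    which bounds the mass of the ball from below.\<close>
  obtain k where k: "\<rho> ^ k < gap * \<rho>" using real_arch_pow_inv[of "gap * \<rho>" \<rho>] gap(1) rho by auto
  define C where "C = real N ^ k / mass_const * (1 / (gap * \<rho>) powr (p * \<sigma>))"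
  have Cpos: "0 < C" using N_ge_2 mass_const_pos gap(1) rho by (simp add: C_def)
  have "\<exists>n. Phi mu p \<sigma> u r \<le> ennreal (C * scale_ratio \<sigma> ^ n) * osc_energy n u"
    if u: "u \<in> borel_measurable mu" and r: "0 < r" "r < 1" for u r
  proof -
    obtain n where n: "gap * \<rho> ^ Suc n \<le> r"
      "\<And>x y w v. w \<in> W n \<Longrightarrow> v \<in> W n \<Longrightarrow> x \<in> kcell w \<Longrightarrow> y \<in> kcell v \<Longrightarrow> dist x y < r \<Longrightarrow> adj w v"
      using ex_scale_upper[OF r] by blast
    define c where "c = real N ^ (n + k) / mass_const"
    have c0: "0 < c" using N_ge_2 mass_const_pos by (simp add: c_def)
    have L: "mean_pdiff u r x \<le> ennreal c * local_osc n u x" if x: "x \<in> K" for x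
    proof -
      obtain w where w: "w \<in> W n" "x \<in> kcell w" using ex_cell[OF x] by blast
      obtain w' where w': "w' \<in> W (n + k)" "x \<in> kcell w'" using ex_cell[OF x] by blast
      have "\<rho> ^ (n + k) < r"
      proof -
        have "\<rho> ^ n * \<rho> ^ k < \<rho> ^ n * (gap * \<rho>)" using k rho by (intro mult_strict_left_mono) auto
        then show ?thesis using n(1) by (simp add: power_add ac_simps)
      qed
      then have "kcell w' \<subseteq> mball_in mu x r"
        using dist_cell[OF w'(1) w'(2)] cell_subset_K[OF w'(1)] by (fastforce simp: mball_in_def)
      then have "emeasure mu (kcell w') \<le> emeasure mu (mball_in mu x r)"
        by (intro emeasure_mono mball_in_sets)
      then have "ennreal (mass_const / real N ^ (n + k)) \<le> emeasure mu (mball_in mu x r)"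
        using mu_cell_ge[OF w'(1)] by (rule order_trans[rotated])
      then have "mean_pdiff u r x \<le> ennreal (1 / (mass_const / real N ^ (n + k))) * (\<integral>\<^sup>+y\<in>mball_in mu x r. pdiff u x y \<partial>mu)"
        using mass_const_pos N_ge_2 by (intro divide_ennreal_le) auto
      also have "\<dots> = ennreal c * (\<integral>\<^sup>+y\<in>mball_in mu x r. pdiff u x y \<partial>mu)" by (simp add: c_def)
      also have "\<dots> \<le> ennreal c * local_osc n u x"
      proof (rule mult_left_mono)
        have "(\<integral>\<^sup>+y\<in>mball_in mu x r. pdiff u x y \<partial>mu) \<le> (\<Sum>v\<in>{v\<in>W n. adj w v}. \<integral>\<^sup>+y\<in>kcell v. pdiff u x y \<partial>mu)"
        proof (rule nn_integral_UN_le)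
          show "mball_in mu x r \<subseteq> (\<Union>v\<in>{v\<in>W n. adj w v}. kcell v)"
          proof
            fix y assume y: "y \<in> mball_in mu x r"
            then obtain v where v: "v \<in> W n" "y \<in> kcell v" using ex_cell[of y n] by (auto simp: mball_in_def)
            then have "adj w v" using n(2)[OF w(1) v(1) w(2) v(2)] y by (simp add: mball_in_def)
            then show "y \<in> (\<Union>v\<in>{v\<in>W n. adj w v}. kcell v)" using v by auto
          qed
        qed (use u cell_sets finite_words in auto)
        also have "\<dots> = (\<Sum>v\<in>W n. if adj w v then (\<integral>\<^sup>+y\<in>kcell v. pdiff u x y \<partial>mu) * indicator (kcell w) x else 0)"
          using w(2) by (auto simp: sum.inter_filter finite_words intro!: sum.cong)
        also have "\<dots> \<le> local_osc n u x"
          unfolding local_osc_def using w(1)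
          by (intro member_le_sum[of w "W n" "\<lambda>w. \<Sum>v\<in>W n. if adj w v then (\<integral>\<^sup>+y\<in>kcell v. pdiff u x y \<partial>mu) * indicator (kcell w) x else 0"])
             (auto simp: finite_words)
        finally show "(\<integral>\<^sup>+y\<in>mball_in mu x r. pdiff u x y \<partial>mu) \<le> local_osc n u x" .
      qed auto
      finally show ?thesis .
    qed
    have "(\<integral>\<^sup>+x. mean_pdiff u r x \<partial>mu) \<le> (\<integral>\<^sup>+x. ennreal c * local_osc n u x \<partial>mu)"
      by (intro nn_integral_mono L) simp
    also have "\<dots> = ennreal c * (\<integral>\<^sup>+x. local_osc n u x \<partial>mu)" by (intro nn_integral_cmult local_osc_measurable u)
    finally have I: "(\<integral>\<^sup>+x. mean_pdiff u r x \<partial>mu) \<le> ennreal c * (\<integral>\<^sup>+x. local_osc n u x \<partial>mu)" .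
    have r': "(gap * \<rho> ^ Suc n) powr (p * \<sigma>) \<le> r powr (p * \<sigma>)"
      using n(1) gap(1) rho s p by (intro powr_mono2) auto
    have pos: "0 < (gap * \<rho> ^ Suc n) powr (p * \<sigma>)" using gap(1) rho by simp
    have "Phi mu p \<sigma> u r \<le> ennreal (1 / (gap * \<rho> ^ Suc n) powr (p * \<sigma>)) * (\<integral>\<^sup>+x. mean_pdiff u r x \<partial>mu)"
      unfolding Phi_def using r' pos by (intro divide_ennreal_le ennreal_leI)
    also have "\<dots> \<le> ennreal (1 / (gap * \<rho> ^ Suc n) powr (p * \<sigma>)) * (ennreal c * (\<integral>\<^sup>+x. local_osc n u x \<partial>mu))"
      using I by (intro mult_left_mono) auto
    also have "\<dots> = ennreal (c / (gap * \<rho> ^ Suc n) powr (p * \<sigma>)) * (\<integral>\<^sup>+x. local_osc n u x \<partial>mu)"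
      using c0 by (simp add: mult.assoc[symmetric] ennreal_mult[symmetric])
    also have "c / (gap * \<rho> ^ Suc n) powr (p * \<sigma>) = C * scale_ratio \<sigma> ^ n * real N ^ (2 * n)"
    proof -
      have "(gap * \<rho> ^ Suc n) powr (p * \<sigma>) = (gap * \<rho>) powr (p * \<sigma>) * (\<rho> ^ n) powr (p * \<sigma>)"
        using gap(1) rho by (simp add: powr_mult ac_simps)
      then show ?thesis using N_ge_2 by (simp add: C_def c_def scale_ratio_pow power_add mult_2)
    qed
    also have "ennreal (C * scale_ratio \<sigma> ^ n * real N ^ (2 * n)) * (\<integral>\<^sup>+x. local_osc n u x \<partial>mu) = ennreal (C * scale_ratio \<sigma> ^ n) * osc_energy n u"
      using Cpos scale_ratio_pos[of \<sigma>] by (simp add: nn_integral_local_osc[OF u] ennreal_mult mult.assoc)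
    finally show ?thesis by blast
  qed
  then show ?thesis using Cpos by blast
qed

text \<open>Points of two meeting m-cells are within 2 * \<rho>^m < r, so the ball about x contains
  every m-cell that meets an m-cell through x. The upper bound on r keeps the mass of the ball of
  order N^-m. The window for r has ratio 1 / \<rho>, so consecutive windows leave no gap.\<close>

lemma ex_Phi_ge:
  assumes s: "0 \<le> \<sigma>"
  shows "\<exists>C>0. \<forall>u\<in>borel_measurable mu. \<forall>m r. 3 * \<rho> ^ m \<le> r \<longrightarrow> r \<le> 3 / \<rho> * \<rho> ^ m \<longrightarrow>
    ennreal (scale_ratio \<sigma> ^ m) * osc_energy m u \<le> ennreal C * Phi mu p \<sigma> u r"
proof -
  obtain M1 :: nat where M1: "\<And>n x. card {w \<in> W n. \<exists>y\<in>kcell w. dist x y \<le> 3 / \<rho> * \<rho> ^ n} \<le> M1"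
    using ex_multiplicity[of "3 / \<rho>"] by blast
  obtain M0 :: nat where M0: "\<And>m x. card (star m x) \<le> M0" using ex_card_star by blast
  define M where "M = real (max 1 M1)"
  define S where "S = real (max 1 M0)"
  have MS: "1 \<le> M" "1 \<le> S" by (auto simp: M_def S_def)
  define C where "C = S * S * M * (3 / \<rho>) powr (p * \<sigma>)"
  have "ennreal (scale_ratio \<sigma> ^ m) * osc_energy m u \<le> ennreal C * Phi mu p \<sigma> u r"
    if u: "u \<in> borel_measurable mu" and r: "3 * \<rho> ^ m \<le> r" "r \<le> 3 / \<rho> * \<rho> ^ m" for u m r
  proof -
    note [measurable] = u
    have rm: "0 < \<rho> ^ m" using rho by simp
    then have r0: "0 < r" using r(1) by linarith
    have ball: "emeasure mu (mball_in mu x r) \<le> ennreal (M / real N ^ m)" for x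
    proof -
      define T where "T = {w \<in> W m. \<exists>y\<in>kcell w. dist x y \<le> 3 / \<rho> * \<rho> ^ m}"
      have "mball_in mu x r \<subseteq> (\<Union>w\<in>T. kcell w)"
      proof
        fix y assume y: "y \<in> mball_in mu x r"
        then obtain w where "w \<in> W m" "y \<in> kcell w" using ex_cell[of y m] by (auto simp: mball_in_def)
        then show "y \<in> (\<Union>w\<in>T. kcell w)" using y r(2) by (force simp: mball_in_def T_def)
      qed
      then have "emeasure mu (mball_in mu x r) \<le> emeasure mu (\<Union>w\<in>T. kcell w)"
        using cell_sets finite_words by (intro emeasure_mono sets.finite_UN) (auto simp: T_def)
      also have "\<dots> \<le> (\<Sum>w\<in>T. emeasure mu (kcell w))"
        using cell_sets finite_words by (intro emeasure_subadditive_finite) (auto simp: T_def)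
      also have "\<dots> \<le> (\<Sum>w\<in>T. ennreal (1 / real N ^ m))" by (intro sum_mono mu_cell_le) (auto simp: T_def)
      also have "\<dots> = ennreal (card T * (1 / real N ^ m))"
        by (simp add: ennreal_mult[symmetric] ennreal_of_nat_eq_real_of_nat)
      also have "\<dots> \<le> ennreal (M * (1 / real N ^ m))"
        using M1[of m x] by (intro ennreal_leI mult_right_mono) (auto simp: M_def T_def)
      finally show ?thesis by simp
    qed
    \<comment> \<open>A point may lie in up to S cells; S enters once for x and once for y.\<close>
    define c where "c = S * S * (M / real N ^ m)"
    have c0: "0 < c" using MS N_ge_2 by (simp add: c_def)
    have L: "ennreal (1 / c) * local_osc m u x \<le> mean_pdiff u r x" for x
    proof -
      let ?B = "\<integral>\<^sup>+y\<in>mball_in mu x r. pdiff u x y \<partial>mu"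
      let ?e = "\<lambda>y. pdiff u x y * indicator (mball_in mu x r) y"
      have [measurable]: "mball_in mu x r \<in> sets mu" by (rule mball_in_sets)
      have card_le: "(\<Sum>w\<in>W m. indicator (kcell w) z) \<le> ennreal S" for z
      proof -
        have "(\<Sum>w\<in>W m. indicator (kcell w) z) = (\<Sum>w\<in>W m. if z \<in> kcell w then 1 else (0::ennreal))"
          by (intro sum.cong) (auto simp: indicator_def)
        also have "\<dots> = of_nat (card (star m z))"
          by (simp add: star_def sum.inter_filter[symmetric] finite_words)
        also have "\<dots> \<le> ennreal S" using M0[of m z] by (simp add: S_def ennreal_of_nat_eq_real_of_nat)
        finally show ?thesis .
      qed
      have "local_osc m u x \<le> (\<Sum>w\<in>W m. \<Sum>v\<in>W m. \<integral>\<^sup>+y. indicator (kcell w) x * (indicator (kcell v) y * ?e y) \<partial>mu)"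
        unfolding local_osc_def
      proof (intro sum_mono)
        fix w v assume wv: "w \<in> W m" "v \<in> W m"
        show "(if adj w v then (\<integral>\<^sup>+y\<in>kcell v. pdiff u x y \<partial>mu) * indicator (kcell w) x else 0)
          \<le> (\<integral>\<^sup>+y. indicator (kcell w) x * (indicator (kcell v) y * ?e y) \<partial>mu)"
        proof (cases "adj w v \<and> x \<in> kcell w")
          case True
          then obtain q where q: "q \<in> kcell w" "q \<in> kcell v" by (auto simp: adj_def)
          have "kcell v \<subseteq> mball_in mu x r"
          proof
            fix y assume y: "y \<in> kcell v"
            have "dist x y \<le> dist x q + dist q y" by (rule dist_triangle)
            also have "\<dots> \<le> \<rho> ^ m + \<rho> ^ m"
              using True q y wv by (intro add_mono dist_cell[of w m] dist_cell[of v m]) auto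
            also have "\<dots> < r" using r(1) rm by linarith
            finally show "y \<in> mball_in mu x r" using y cell_subset_K[OF wv(2)] by (auto simp: mball_in_def)
          qed
          then show ?thesis using True
            by (auto intro!: nn_integral_mono split: split_indicator)
        qed auto
      qed
      also have "\<dots> = (\<Sum>w\<in>W m. \<integral>\<^sup>+y. (\<Sum>v\<in>W m. indicator (kcell w) x * (indicator (kcell v) y * ?e y)) \<partial>mu)"
        using cell_sets by (intro sum.cong refl nn_integral_sum[symmetric]) measurable
      also have "\<dots> = (\<integral>\<^sup>+y. (\<Sum>w\<in>W m. \<Sum>v\<in>W m. indicator (kcell w) x * (indicator (kcell v) y * ?e y)) \<partial>mu)"
        using cell_sets by (intro nn_integral_sum[symmetric] borel_measurable_sum) measurable
      also have "\<dots> = (\<integral>\<^sup>+y. (\<Sum>w\<in>W m. indicator (kcell w) x) * ((\<Sum>v\<in>W m. indicator (kcell v) y) * ?e y) \<partial>mu)"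
        by (intro nn_integral_cong, subst sum_distrib_right, subst sum_product) simp
      also have "\<dots> \<le> (\<integral>\<^sup>+y. ennreal S * (ennreal S * ?e y) \<partial>mu)"
        by (intro nn_integral_mono mult_mono card_le) auto
      also have "\<dots> = ennreal (S * S) * ?B"
        using MS by (simp add: nn_integral_cmult ennreal_mult mult.assoc)
      finally have "ennreal (1 / (S * S)) * local_osc m u x \<le> ?B"
        using MS by (intro ennreal_mult_inverse_le) auto
      then have "ennreal (1 / (M / real N ^ m)) * (ennreal (1 / (S * S)) * local_osc m u x) \<le> ennreal (1 / (M / real N ^ m)) * ?B"
        by (rule mult_left_mono) simp
      also have "\<dots> \<le> mean_pdiff u r x"
        using ball[of x] MS N_ge_2 by (intro divide_ennreal_ge) auto
      also have "ennreal (1 / (M / real N ^ m)) * (ennreal (1 / (S * S)) * local_osc m u x) = ennreal (1 / c) * local_osc m u x"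
      proof -
        have "1 / c = 1 / (M / real N ^ m) * (1 / (S * S))" by (simp add: c_def)
        moreover have "0 \<le> 1 / (M / real N ^ m)" "0 \<le> 1 / (S * S)" using MS by simp_all
        ultimately show ?thesis by (simp only: ennreal_mult_mult)
      qed
      finally show ?thesis .
    qed
    have "ennreal (1 / c) * (\<integral>\<^sup>+x. local_osc m u x \<partial>mu) = (\<integral>\<^sup>+x. ennreal (1 / c) * local_osc m u x \<partial>mu)"
      by (rule nn_integral_cmult[symmetric, OF local_osc_measurable[OF u]])
    also have "\<dots> \<le> (\<integral>\<^sup>+x. mean_pdiff u r x \<partial>mu)" by (intro nn_integral_mono L)
    finally have I: "ennreal (1 / c) * (\<integral>\<^sup>+x. local_osc m u x \<partial>mu) \<le> (\<integral>\<^sup>+x. mean_pdiff u r x \<partial>mu)" .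
    define R where "R = (3 / \<rho> * \<rho> ^ m) powr (p * \<sigma>)"
    have R: "r powr (p * \<sigma>) \<le> R" "0 < R" using r(2) r0 s p rho by (auto simp: R_def intro: powr_mono2)
    have "ennreal (1 / R) * (ennreal (1 / c) * (\<integral>\<^sup>+x. local_osc m u x \<partial>mu)) \<le> ennreal (1 / R) * (\<integral>\<^sup>+x. mean_pdiff u r x \<partial>mu)"
      using I by (intro mult_left_mono) auto
    also have "\<dots> \<le> Phi mu p \<sigma> u r" unfolding Phi_def using R by (intro divide_ennreal_ge ennreal_leI)
    finally have "ennreal C * (ennreal (1 / R) * (ennreal (1 / c) * (\<integral>\<^sup>+x. local_osc m u x \<partial>mu))) \<le> ennreal C * Phi mu p \<sigma> u r"
      by (intro mult_left_mono) auto
    also have "ennreal C * (ennreal (1 / R) * (ennreal (1 / c) * (\<integral>\<^sup>+x. local_osc m u x \<partial>mu)))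
        = ennreal (C * (1 / R) * (1 / c)) * (\<integral>\<^sup>+x. local_osc m u x \<partial>mu)"
      using R(2) c0 MS by (simp add: C_def mult.assoc[symmetric] ennreal_mult[symmetric])
    also have "C * (1 / R) * (1 / c) = scale_ratio \<sigma> ^ m * real N ^ (2 * m)"
    proof -
      have "R = (3 / \<rho>) powr (p * \<sigma>) * (\<rho> ^ m) powr (p * \<sigma>)"
        unfolding R_def by (rule powr_mult)
      then show ?thesis using MS N_ge_2 rho by (simp add: C_def c_def scale_ratio_pow power_add mult_2)
    qed
    also have "ennreal (scale_ratio \<sigma> ^ m * real N ^ (2 * m)) * (\<integral>\<^sup>+x. local_osc m u x \<partial>mu) = ennreal (scale_ratio \<sigma> ^ m) * osc_energy m u"
      using scale_ratio_pos[of \<sigma>] by (simp add: nn_integral_local_osc[OF u] ennreal_mult mult.assoc)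
    finally show ?thesis .
  qed
  moreover have "0 < C" using MS rho by (simp add: C_def)
  ultimately show ?thesis by blast
qed

section \<open>The critical exponent and property (NE)\<close>

lemma ex_scale_lower:
  assumes "0 < r" "r < 3 * \<rho> ^ n"
  obtains k where "3 * \<rho> ^ (n + k) \<le> r" "r \<le> 3 / \<rho> * \<rho> ^ (n + k)"
proof -
  obtain j0 where "\<rho> ^ j0 < r / 3" using real_arch_pow_inv[of "r / 3" \<rho>] assms rho by auto
  then have ex: "3 * \<rho> ^ j0 \<le> r" by simp
  define j where "j = (LEAST j. 3 * \<rho> ^ j \<le> r)"
  have j: "3 * \<rho> ^ j \<le> r" unfolding j_def using ex by (rule LeastI)
  have "n < j"
  proof (rule ccontr)
    assume "\<not> n < j"
    then have "\<rho> ^ n \<le> \<rho> ^ j" using rho by (intro power_decreasing) auto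
    then show False using j assms by linarith
  qed
  then obtain i where i: "j = Suc i" by (cases j) auto
  have "r < 3 * \<rho> ^ i" using not_less_Least[of i "\<lambda>j. 3 * \<rho> ^ j \<le> r"] i by (simp add: j_def)
  also have "3 * \<rho> ^ i = 3 / \<rho> * \<rho> ^ j" using rho by (simp add: i)
  finally have "r \<le> 3 / \<rho> * \<rho> ^ j" by simp
  then show ?thesis using that[of "j - n"] j \<open>n < j\<close> by simp
qed

text \<open>The solution \<sigma> of N * \<rho>^(p \<sigma>) = 1 / theta: one level then changes the
  weight in \<open>Phi\<close> by exactly the factor lost in
  \<open>ex_osc_energy_mono\<close>.\<close>

definition crit_sigma :: real where "crit_sigma = ln (N * theta) / (p * ln (1 / \<rho>))"

lemma crit_sigma_pos: "0 < crit_sigma"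
proof -
  have "2 * 1 \<le> N * theta" using N_ge_2 theta_ge_1 by (intro mult_mono) auto
  then show ?thesis using rho p by (simp add: crit_sigma_def)
qed

lemma scale_ratio_crit_sigma: "scale_ratio crit_sigma = theta"
proof -
  have pos: "0 < N * theta" using N_ge_2 theta_ge_1 by simp
  have "ln \<rho> \<noteq> 0" "ln (1 / \<rho>) = - ln \<rho>" using rho by (auto simp: ln_div)
  then have "p * crit_sigma * ln \<rho> = - ln (N * theta)" using p by (simp add: crit_sigma_def)
  then have "\<rho> powr (p * crit_sigma) = 1 / (N * theta)"
    using rho pos by (simp add: powr_def exp_minus inverse_eq_divide)
  then show ?thesis using pos N_ge_2 by (simp add: scale_ratio_def)
qed

text \<open>The radius r is compared with some level n, this level with every finer level n + k at
  the cost theta^k, which the exponent absorbs, and these levels with all radii r' < 3 * \<rho>^n.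
  Only n depends on r, not the constant, so the bound passes to the limit inferior over r'.\<close>

lemma property_NE_crit_sigma: "property_NE mu p crit_sigma"
proof -
  have s: "0 \<le> crit_sigma" using crit_sigma_pos by simp
  obtain C1 where C1: "0 < C1" "\<And>u r. u \<in> borel_measurable mu \<Longrightarrow> 0 < r \<Longrightarrow> r < 1 \<Longrightarrow>
      \<exists>n. Phi mu p crit_sigma u r \<le> ennreal (C1 * theta ^ n) * osc_energy n u"
    using ex_Phi_le[OF s] unfolding scale_ratio_crit_sigma by blast
  obtain C2 where C2: "0 < C2" "\<And>u m r. u \<in> borel_measurable mu \<Longrightarrow> 3 * \<rho> ^ m \<le> r \<Longrightarrow> r \<le> 3 / \<rho> * \<rho> ^ m \<Longrightarrow>
      ennreal (theta ^ m) * osc_energy m u \<le> ennreal C2 * Phi mu p crit_sigma u r"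
    using ex_Phi_ge[OF s] unfolding scale_ratio_crit_sigma by blast
  obtain C3 where C3: "0 < C3" "\<And>u n k. u \<in> Lp_functions p mu \<Longrightarrow> osc_energy n u \<le> ennreal (C3 * theta ^ k) * osc_energy (n + k) u"
    using ex_osc_energy_mono by blast
  have th: "0 < theta" using theta_ge_1 by simp
  define C where "C = C1 * C3 * C2"
  have C0: "0 < C" using C1 C2 C3 by (simp add: C_def)
  have "(SUP r\<in>{0<..<diameter (space mu)}. Phi mu p crit_sigma u r) \<le> ennreal C * Liminf (at_right 0) (Phi mu p crit_sigma u)"
    if u: "u \<in> KS_space mu p crit_sigma" for u
  proof (rule SUP_least)
    fix r assume "r \<in> {0<..<diameter (space mu)}"
    then have r: "0 < r" "r < 1" using diam by auto
    have uL: "u \<in> Lp_functions p mu" using u by (auto simp: KS_space_def)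
    then have um: "u \<in> borel_measurable mu" by (auto simp: Lp_functions_def)
    obtain n where n: "Phi mu p crit_sigma u r \<le> ennreal (C1 * theta ^ n) * osc_energy n u" using C1(2)[OF um r] by blast
    have le: "ennreal (1 / C) * Phi mu p crit_sigma u r \<le> Phi mu p crit_sigma u r'" if r': "0 < r'" "r' < 3 * \<rho> ^ n" for r'
    proof -
      obtain k where k: "3 * \<rho> ^ (n + k) \<le> r'" "r' \<le> 3 / \<rho> * \<rho> ^ (n + k)" using ex_scale_lower[OF r'] .
      have "Phi mu p crit_sigma u r \<le> ennreal (C1 * theta ^ n) * (ennreal (C3 * theta ^ k) * osc_energy (n + k) u)"
        by (intro order_trans[OF n] mult_left_mono C3(2) uL) auto
      also have "\<dots> = ennreal (C1 * C3) * (ennreal (theta ^ (n + k)) * osc_energy (n + k) u)"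
      proof -
        have "C1 * theta ^ n * (C3 * theta ^ k) = C1 * C3 * theta ^ (n + k)" by (simp add: power_add)
        moreover have "0 \<le> C1 * theta ^ n" "0 \<le> C3 * theta ^ k" "0 \<le> C1 * C3" "0 \<le> theta ^ (n + k)"
          using C1(1) C3(1) th by simp_all
        ultimately show ?thesis by (simp only: ennreal_mult_mult)
      qed
      also have "\<dots> \<le> ennreal (C1 * C3) * (ennreal C2 * Phi mu p crit_sigma u r')"
        by (intro mult_left_mono C2(2)[OF um k]) auto
      also have "\<dots> = ennreal C * Phi mu p crit_sigma u r'"
        using C1(1) C2(1) C3(1) by (simp add: C_def mult.assoc[symmetric] ennreal_mult[symmetric])
      finally show ?thesis using C0 by (rule ennreal_mult_inverse_le)
    qed
    have "0 < 3 * \<rho> ^ n" using rho by simp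
    then have "eventually (\<lambda>r'. r' \<in> {0<..<3 * \<rho> ^ n}) (at_right 0)" by (rule eventually_at_right_real)
    then have "eventually (\<lambda>r'. ennreal (1 / C) * Phi mu p crit_sigma u r \<le> Phi mu p crit_sigma u r') (at_right 0)"
      by (rule eventually_mono) (use le in auto)
    then have "ennreal (1 / C) * Phi mu p crit_sigma u r \<le> Liminf (at_right 0) (Phi mu p crit_sigma u)"
      by (rule Liminf_bounded)
    then have "ennreal C * (ennreal (1 / C) * Phi mu p crit_sigma u r) \<le> ennreal C * Liminf (at_right 0) (Phi mu p crit_sigma u)"
      by (intro mult_left_mono) auto
    moreover have "ennreal C * (ennreal (1 / C) * Phi mu p crit_sigma u r) = Phi mu p crit_sigma u r"
      using C0 by (simp add: mult.assoc[symmetric] ennreal_mult[symmetric])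
    ultimately show "Phi mu p crit_sigma u r \<le> ennreal C * Liminf (at_right 0) (Phi mu p crit_sigma u)" by simp
  qed
  then show ?thesis unfolding property_NE_def using C0 by blast
qed

text \<open>At level 0 the oscillation energy is the full double integral. If it vanishes, some x
  has zero inner integral, since K has positive mass, and u equals u x almost everywhere.\<close>

lemma ae_constant_of_osc_energy_0:
  assumes u [measurable]: "u \<in> borel_measurable mu" and D: "osc_energy 0 u = 0"
  shows "ae_constant mu u"
proof -
  have "(\<integral>\<^sup>+x. (\<integral>\<^sup>+y. pdiff u x y \<partial>mu) \<partial>mu) = osc u [] []"
    unfolding osc_def by (auto intro!: nn_integral_cong)
  also have "\<dots> = 0" using D by (simp add: osc_energy_def)
  finally have "AE x in mu. (\<integral>\<^sup>+y. pdiff u x y \<partial>mu) = 0" by (subst (asm) nn_integral_0_iff_AE) auto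
  then have "\<exists>x. (\<integral>\<^sup>+y. pdiff u x y \<partial>mu) = 0"
  proof (rule contrapos_pp)
    assume "\<nexists>x. (\<integral>\<^sup>+y. pdiff u x y \<partial>mu) = 0"
    then have "\<not> (AE x in mu. False)"
      using emeasure_eq_0_AE[of "\<lambda>_. True" mu] emeasure_cell_pos[of "[]" 0] by auto
    then show "\<not> (AE x in mu. (\<integral>\<^sup>+y. pdiff u x y \<partial>mu) = 0)"
      using \<open>\<nexists>x. (\<integral>\<^sup>+y. pdiff u x y \<partial>mu) = 0\<close> by simp
  qed
  then obtain x where "(\<integral>\<^sup>+y. pdiff u x y \<partial>mu) = 0" by blast
  then have "AE y in mu. pdiff u x y = 0" by (subst (asm) nn_integral_0_iff_AE) auto
  then have "AE y in mu. u y = u x" by (rule eventually_mono) auto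
  then show ?thesis unfolding ae_constant_def by blast
qed

text \<open>Above the critical exponent \<open>scale_ratio \<sigma>\<close> exceeds theta, so
  \<open>osc_energy 0 u\<close> is at most of order (theta / \<open>scale_ratio \<sigma>\<close>)^m
  for all large m, hence 0.\<close>

lemma Besov_exponent_le:
  assumes u: "u \<in> Besov_space mu p \<sigma>" and nc: "\<not> ae_constant mu u"
  shows "\<sigma> \<le> crit_sigma"
proof (rule ccontr)
  assume "\<not> \<sigma> \<le> crit_sigma"
  then have s: "crit_sigma < \<sigma>" by simp
  then have s0: "0 \<le> \<sigma>" using crit_sigma_pos by simp
  have uL: "u \<in> Lp_functions p mu" and fin: "(SUP r\<in>{0<..<1}. Phi mu p \<sigma> u r) < \<infinity>"
    using u by (auto simp: Besov_space_def)
  then have um: "u \<in> borel_measurable mu" by (auto simp: Lp_functions_def)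
  obtain S where S: "(SUP r\<in>{0<..<1}. Phi mu p \<sigma> u r) = ennreal S" "0 \<le> S"
    using fin by (cases "SUP r\<in>{0<..<1}. Phi mu p \<sigma> u r") auto
  obtain C2 where C2: "0 < C2" "\<And>u m r. u \<in> borel_measurable mu \<Longrightarrow> 3 * \<rho> ^ m \<le> r \<Longrightarrow> r \<le> 3 / \<rho> * \<rho> ^ m \<Longrightarrow>
      ennreal (scale_ratio \<sigma> ^ m) * osc_energy m u \<le> ennreal C2 * Phi mu p \<sigma> u r"
    using ex_Phi_ge[OF s0] by blast
  obtain C3 where C3: "0 < C3" "\<And>u n k. u \<in> Lp_functions p mu \<Longrightarrow> osc_energy n u \<le> ennreal (C3 * theta ^ k) * osc_energy (n + k) u"
    using ex_osc_energy_mono by blast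
  have th: "0 < theta" using theta_ge_1 by simp
  define q where "q = theta / scale_ratio \<sigma>"
  have q: "0 \<le> q" "q < 1"
  proof -
    have "\<rho> powr (p * \<sigma>) < \<rho> powr (p * crit_sigma)" using rho s p by (intro powr_less_mono') auto
    then have "scale_ratio crit_sigma < scale_ratio \<sigma>" using N_ge_2 rho
      unfolding scale_ratio_def by (intro divide_strict_left_mono mult_strict_left_mono) auto
    then show "0 \<le> q" "q < 1" using th scale_ratio_pos[of \<sigma>] by (auto simp: q_def scale_ratio_crit_sigma)
  qed
  obtain m0 where m0: "\<rho> ^ m0 < 1 / 3" using real_arch_pow_inv[of "1/3" \<rho>] rho by auto
  have le: "osc_energy 0 u \<le> ennreal (C3 * C2 * S * q ^ m)" if m: "m0 \<le> m" for m
  proof -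
    have "\<rho> ^ m \<le> \<rho> ^ m0" using rho m by (intro power_decreasing) auto
    then have "3 * \<rho> ^ m < 1" using m0 by linarith
    then have r: "0 < 3 * \<rho> ^ m" "3 * \<rho> ^ m < 1" using rho by auto
    have "\<rho> ^ m * \<rho> \<le> \<rho> ^ m * 1" using rho by (intro mult_left_mono) auto
    then have r2: "3 * \<rho> ^ m \<le> 3 / \<rho> * \<rho> ^ m" using rho by (simp add: field_simps)
    have "Phi mu p \<sigma> u (3 * \<rho> ^ m) \<le> ennreal S" unfolding S(1)[symmetric] using r by (intro SUP_upper) auto
    then have "ennreal (scale_ratio \<sigma> ^ m) * osc_energy m u \<le> ennreal C2 * ennreal S"
      by (intro order_trans[OF C2(2)[OF um order_refl r2]] mult_left_mono) auto
    then have D: "ennreal (scale_ratio \<sigma> ^ m) * osc_energy m u \<le> ennreal (C2 * S)" using C2(1) S(2) by (simp add: ennreal_mult)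
    have "ennreal (1 / scale_ratio \<sigma> ^ m) * (ennreal (scale_ratio \<sigma> ^ m) * osc_energy m u) \<le> ennreal (1 / scale_ratio \<sigma> ^ m) * ennreal (C2 * S)"
      using D by (intro mult_left_mono) auto
    then have D: "osc_energy m u \<le> ennreal (1 / scale_ratio \<sigma> ^ m * (C2 * S))"
      using scale_ratio_pos[of \<sigma>] C2(1) S(2) by (simp add: mult.assoc[symmetric] ennreal_mult[symmetric])
    have "osc_energy 0 u \<le> ennreal (C3 * theta ^ m) * osc_energy (0 + m) u" by (rule C3(2)[OF uL])
    also have "\<dots> \<le> ennreal (C3 * theta ^ m) * ennreal (1 / scale_ratio \<sigma> ^ m * (C2 * S))"
      using D by (intro mult_left_mono) auto
    also have "\<dots> = ennreal (C3 * C2 * S * q ^ m)"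
    proof -
      have "C3 * theta ^ m * (1 / scale_ratio \<sigma> ^ m * (C2 * S)) = C3 * C2 * S * q ^ m" by (simp add: q_def power_divide)
      moreover have "0 \<le> C3 * theta ^ m" "0 \<le> 1 / scale_ratio \<sigma> ^ m * (C2 * S)"
        using C2(1) C3(1) S(2) th scale_ratio_pos[of \<sigma>] by simp_all
      ultimately show ?thesis by (simp only: ennreal_mult[symmetric])
    qed
    finally show ?thesis .
  qed
  have "(\<lambda>m. C3 * C2 * S * q ^ m) \<longlonglongrightarrow> C3 * C2 * S * 0"
    using q by (intro tendsto_mult tendsto_const LIMSEQ_power_zero) auto
  then have "(\<lambda>m. ennreal (C3 * C2 * S * q ^ m)) \<longlonglongrightarrow> ennreal 0" by (intro tendsto_ennrealI) simp
  then have "osc_energy 0 u \<le> ennreal 0" using le by (intro LIMSEQ_le_const) auto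
  then have "osc_energy 0 u = 0" by simp
  then show False using ae_constant_of_osc_energy_0[OF um] nc by simp
qed

end

section \<open>Nonconstant functions at the critical exponent\<close>

text \<open>A diagonal extraction, obtained from compactness of a product of copies of [0, 1];
  countability of the index type turns it into sequential compactness.\<close>

lemma bounded_functions_subsequence:
  fixes f :: "nat \<Rightarrow> 'b::countable \<Rightarrow> real"
  assumes "\<And>m i. 0 \<le> f m i \<and> f m i \<le> 1"
  shows "\<exists>r a. strict_mono r \<and> (\<forall>i. (\<lambda>j. f (r j) i) \<longlonglongrightarrow> a i)"
proof -
  have "compactin (product_topology (\<lambda>i::'b. euclidean::real topology) UNIV) (PiE UNIV (\<lambda>_. {0..1}))"
    by (simp add: compactin_PiE)
  then have "compact (PiE (UNIV::'b set) (\<lambda>_. {0..1::real}))"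
    by (simp add: euclidean_product_topology)
  then have "seq_compact (PiE (UNIV::'b set) (\<lambda>_. {0..1::real}))" by (rule compact_imp_seq_compact)
  moreover have "\<forall>m. f m \<in> PiE UNIV (\<lambda>_. {0..1})" using assms by auto
  ultimately obtain a r where ar: "strict_mono (r :: nat \<Rightarrow> nat)" "(f \<circ> r) \<longlonglongrightarrow> a"
    by (meson seq_compactE)
  have "(\<lambda>j. f (r j) i) \<longlonglongrightarrow> a i" for i
  proof -
    have "continuous_on UNIV (\<lambda>x::'b \<Rightarrow> real. x i)" by (rule continuous_on_product_coordinates)
    then have "isCont (\<lambda>x::'b \<Rightarrow> real. x i) a"
      using continuous_on_eq_continuous_at[OF open_UNIV, of "\<lambda>x::'b \<Rightarrow> real. x i"] by blast
    from isCont_tendsto_compose[OF this ar(2)] show ?thesis by simp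
  qed
  then show ?thesis using ar(1) by blast
qed

lemma geometric_increments_limit:
  fixes s :: "nat \<Rightarrow> real"
  assumes q: "0 \<le> q" "q < 1" and inc: "\<And>n. \<bar>s (Suc n) - s n\<bar> \<le> c * q ^ n"
  shows "\<bar>lim s - s n\<bar> \<le> c * q ^ n / (1 - q)" "s \<longlonglongrightarrow> lim s"
proof -
  have sq: "summable (\<lambda>k. c * q ^ (k + n))" for n
    using q by (simp add: power_add summable_mult summable_mult2 summable_geometric mult.assoc[symmetric])
  have sd: "summable (\<lambda>k. s (Suc k) - s k)"
    using inc by (intro summable_comparison_test[OF _ sq[of 0]] exI[of _ 0]) auto
  have tel: "(\<Sum>k<n. s (Suc k) - s k) = s n - s 0" for n by (rule sum_lessThan_telescope)
  have "(\<lambda>n. \<Sum>k<n. s (Suc k) - s k) \<longlonglongrightarrow> (\<Sum>k. s (Suc k) - s k)" using summable_LIMSEQ[OF sd] .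
  then have "(\<lambda>n. s n - s 0 + s 0) \<longlonglongrightarrow> (\<Sum>k. s (Suc k) - s k) + s 0"
    unfolding tel by (intro tendsto_add tendsto_const)
  then have L: "s \<longlonglongrightarrow> (\<Sum>k. s (Suc k) - s k) + s 0" by simp
  then show lim: "s \<longlonglongrightarrow> lim s" by (simp add: convergentI convergent_LIMSEQ_iff[symmetric])
  have eq: "lim s = (\<Sum>k. s (Suc k) - s k) + s 0" using L by (rule limI)
  have sn: "summable (\<lambda>k. norm (s (Suc (k + n)) - s (k + n)))"
    using inc by (intro summable_comparison_test[OF _ sq[of n]] exI[of _ 0]) auto
  have "lim s - s n = (\<Sum>k. s (Suc (k + n)) - s (k + n))"
    using suminf_split_initial_segment[OF sd, of n] eq tel[of n] by simp
  also have "\<bar>\<dots>\<bar> \<le> (\<Sum>k. norm (s (Suc (k + n)) - s (k + n)))"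
    using summable_norm[OF sn] by simp
  also have "\<dots> \<le> (\<Sum>k. c * q ^ (k + n))" using inc by (intro suminf_le sn sq) auto
  also have "\<dots> = c * q ^ n / (1 - q)"
    using q by (simp add: power_add mult.assoc[symmetric] suminf_mult2[symmetric] suminf_mult suminf_geometric summable_geometric summable_mult)
  finally show "\<bar>lim s - s n\<bar> \<le> c * q ^ n / (1 - q)" .
qed

context nested_fractal_energy
begin

interpretation mu: finite_measure mu by (rule finite_measure_mu)

text \<open>At the critical exponent \<open>Phi\<close> carries the weight theta^n, which decay of
  the oscillation energies like theta^-n compensates.\<close>

lemma Besov_sig0I:
  assumes u: "u \<in> borel_measurable mu" and bd: "\<And>x. x \<in> K \<Longrightarrow> \<bar>u x\<bar> \<le> 1"
    and D: "\<And>n. osc_energy n u \<le> ennreal (B / theta ^ n)" and B: "0 \<le> B"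
  shows "u \<in> Besov_space mu p crit_sigma"
proof -
  have "(\<integral>\<^sup>+x. ennreal (\<bar>u x\<bar> powr p) \<partial>mu) \<le> (\<integral>\<^sup>+x. 1 \<partial>mu)"
    using bd p by (intro nn_integral_mono) (auto intro!: ennreal_le_1[THEN iffD2] powr_le1)
  also have "\<dots> < \<infinity>" using mu.emeasure_finite[of "space mu"] by (simp add: less_top[symmetric])
  finally have L: "u \<in> Lp_functions p mu" using u by (simp add: Lp_functions_def)
  obtain C where C: "0 < C" "\<And>r. 0 < r \<Longrightarrow> r < 1 \<Longrightarrow> \<exists>n. Phi mu p crit_sigma u r \<le> ennreal (C * theta ^ n) * osc_energy n u"
    using ex_Phi_le[of crit_sigma] crit_sigma_pos u unfolding scale_ratio_crit_sigma by force
  have "(SUP r\<in>{0<..<1}. Phi mu p crit_sigma u r) \<le> ennreal (C * B)"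
  proof (rule SUP_least)
    fix r :: real assume "r \<in> {0<..<1}"
    then obtain n where "Phi mu p crit_sigma u r \<le> ennreal (C * theta ^ n) * osc_energy n u" using C(2)[of r] by auto
    also have "\<dots> \<le> ennreal (C * theta ^ n) * ennreal (B / theta ^ n)" by (intro mult_left_mono D) auto
    also have "\<dots> = ennreal (C * B)"
      using C(1) B theta_ge_1 by (simp add: ennreal_mult[symmetric])
    finally show "Phi mu p crit_sigma u r \<le> ennreal (C * B)" .
  qed
  also have "ennreal (C * B) < \<infinity>" by simp
  finally have "(SUP r\<in>{0<..<1}. Phi mu p crit_sigma u r) < \<infinity>" .
  then show ?thesis using L by (simp add: Besov_space_def)
qed

text \<open>Cells have positive mass, so each of the two conditions holds at some point where u
  takes its supposed constant value.\<close>

lemma not_ae_constantI: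
  assumes wv: "w \<in> W n" "v \<in> W m" and A: "AE x in mu. x \<in> kcell w \<longrightarrow> P x" "AE x in mu. x \<in> kcell v \<longrightarrow> Q x"
    and ne: "\<And>x y. P x \<Longrightarrow> Q y \<Longrightarrow> u x \<noteq> u y"
  shows "\<not> ae_constant mu u"
proof
  assume "ae_constant mu u"
  then obtain c where c: "AE x in mu. u x = c" by (auto simp: ae_constant_def)
  have ex: "\<exists>x. R x \<and> u x = c" if z: "z \<in> W k" and R: "AE x in mu. x \<in> kcell z \<longrightarrow> R x" for z k R
  proof (rule ccontr)
    assume no: "\<nexists>x. R x \<and> u x = c"
    have "AE x in mu. x \<notin> kcell z" using R c by eventually_elim (use no in auto)
    then have "emeasure mu {x \<in> space mu. x \<in> kcell z} = 0" by (rule emeasure_eq_0_AE)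
    moreover have "{x \<in> space mu. x \<in> kcell z} = kcell z" using cell_subset_K[OF z] by auto
    ultimately show False using emeasure_cell_pos[OF z] by simp
  qed
  show False using ex[OF wv(1) A(1)] ex[OF wv(2) A(2)] ne by metis
qed

lemma finite_null_sets: "finite A \<Longrightarrow> A \<subseteq> K \<Longrightarrow> A \<in> null_sets mu"
proof (induction A rule: finite_induct)
  case (insert x A)
  have "{x} \<in> null_sets mu" using insert mu_singleton singleton_sets by (auto intro: null_setsI)
  then have "{x} \<union> A \<in> null_sets mu" using insert by (intro null_sets.Un) auto
  then show ?case by simp
qed simp

text \<open>For theta = 1 the oscillation energies only have to stay bounded. The indicator of a
  1-cell is almost everywhere constant on each finer cell, and its discrete energy is bounded by
  \<open>ex_prefix_energy\<close>.\<close>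

lemma ex_Besov_nonconstant_1:
  assumes th: "theta = 1"
  shows "\<exists>u\<in>Besov_space mu p crit_sigma. \<not> ae_constant mu u"
proof -
  have w12: "[1] \<in> W 1" "[2] \<in> W 1" using N_ge_2 by (auto simp: words_def)
  define u :: "'a \<Rightarrow> real" where "u = indicator (kcell [1])"
  have um [measurable]: "u \<in> borel_measurable mu" using cell_sets[OF w12(1)] by (simp add: u_def)
  have u01: "u x = 0 \<or> u x = 1" for x by (simp add: u_def indicator_def)
  have cell_u: "AE x in mu. x \<in> kcell w \<longrightarrow> u x = (if take 1 w = [1] then 1 else 0)"
    if w: "w \<in> W n" and n: "1 \<le> n" for w n
  proof (cases "take 1 w = [1]")
    case True
    then have "kcell w \<subseteq> kcell [1]" using cell_take[OF w, of 1] by simp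
    then show ?thesis using True by (intro AE_I2) (auto simp: u_def)
  next
    case False
    have tw: "take 1 w \<in> W 1" using take_words[OF w n] .
    have "kcell (take 1 w) \<inter> kcell [1] \<in> null_sets mu"
      using finite_cell_Int[OF tw w12(1) False] cell_subset_K[OF tw] by (intro finite_null_sets) auto
    then have "AE x in mu. x \<notin> kcell (take 1 w) \<inter> kcell [1]" by (rule AE_not_in)
    then show ?thesis by eventually_elim (use cell_take[OF w, of 1] False in \<open>auto simp: u_def indicator_def\<close>)
  qed
  define g where "g w = (if take 1 w \<in> {[1]} then 1 else (0::real))" for w :: "nat list"
  obtain C where C: "1 \<le> C" "\<And>m. 1 \<le> m \<Longrightarrow> energy m g \<le> C"
    using ex_prefix_energy[of 1] unfolding g_def[abs_def] by blast
  define B where "B = 3 powr p * C"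
  have three: "1 \<le> (3::real) powr p" using p by (intro ge_one_powr_ge_zero) auto
  have B: "1 \<le> B" using mult_mono[OF three C(1)] by (simp add: B_def)
  have DD1: "osc_energy n u \<le> ennreal B" if n: "1 \<le> n" for n
  proof -
    have "cell_dev u w (g w) = 0" if w: "w \<in> W n" for w
    proof -
      note [measurable] = cell_sets[OF w]
      have "AE x in mu. ennreal (\<bar>u x - g w\<bar> powr p) * indicator (kcell w) x = 0"
        using cell_u[OF w n] by eventually_elim (use p in \<open>auto simp: g_def\<close>)
      then show ?thesis unfolding cell_dev_def by (subst nn_integral_0_iff_AE) auto
    qed
    then have "dev_energy n u g = 0" by (simp add: dev_energy_def)
    then have "osc_energy n u \<le> ennreal (3 powr p) * ennreal (energy n g)" using osc_energy_le[OF um, of n g] by simp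
    also have "\<dots> \<le> ennreal (3 powr p) * ennreal C" using C(2)[OF n] by (intro mult_left_mono ennreal_leI) auto
    also have "\<dots> = ennreal B" using C by (simp add: B_def ennreal_mult)
    finally show ?thesis .
  qed
  have "osc_energy n u \<le> ennreal (B / theta ^ n)" for n
  proof (cases "1 \<le> n")
    \<comment> \<open>At level 0 words have no first letter, and the bound comes from the total mass
      being at most 1.\<close>
    case False
    then have "n = 0" by simp
    have "pdiff u x y \<le> 1" for x y using u01[of x] u01[of y] p by auto
    then have pd: "pdiff u x y * indicator A y \<le> 1" for x y A by (simp add: indicator_def)
    have "osc u [] [] \<le> (\<integral>\<^sup>+x. (\<integral>\<^sup>+y. 1 \<partial>mu) \<partial>mu)"
      unfolding osc_def
    proof (rule nn_integral_mono)
      fix x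
      have "(\<integral>\<^sup>+y\<in>kcell []. pdiff u x y \<partial>mu) \<le> (\<integral>\<^sup>+y. 1 \<partial>mu)" by (intro nn_integral_mono pd)
      then have "(\<integral>\<^sup>+y\<in>kcell []. pdiff u x y \<partial>mu) * indicator (kcell []) x \<le> (\<integral>\<^sup>+y. 1 \<partial>mu) * 1"
        by (intro mult_mono) (auto simp: indicator_def)
      then show "(\<integral>\<^sup>+y\<in>kcell []. pdiff u x y \<partial>mu) * indicator (kcell []) x \<le> (\<integral>\<^sup>+y. 1 \<partial>mu)"
        by (simp only: mult_1_right)
    qed
    also have "\<dots> \<le> 1"
    proof -
      have "emeasure mu K \<le> 1" using mu_cell_le[of "[]" 0] by simp
      then have "emeasure mu K * emeasure mu K \<le> 1 * 1" by (intro mult_mono) auto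
      then show ?thesis by simp
    qed
    finally have "osc_energy n u \<le> 1" using \<open>n = 0\<close> by (simp add: osc_energy_def)
    also have "\<dots> \<le> ennreal B" using B by simp
    finally show ?thesis by (simp add: th)
  qed (use DD1 th in simp)
  moreover have "\<bar>u x\<bar> \<le> 1" for x using u01[of x] by auto
  ultimately have "u \<in> Besov_space mu p crit_sigma"
    using B by (intro Besov_sig0I[OF um, of B]) auto
  moreover have "\<not> ae_constant mu u"
    by (rule not_ae_constantI[OF w12 cell_u[OF w12(1)] cell_u[OF w12(2)]]) auto
  ultimately show ?thesis by blast
qed

text \<open>
  Corner samples of nearly optimal functions at level \<open>m\<close> have energy of the right order at every
  lower level; a pointwise limit along a subsequence is a function on all words.
\<close>
lemma ex_limit_function:
  "\<exists>a x y B. x \<in> V0 \<and> y \<in> V0 \<and> 0 \<le> B \<and> (\<forall>w. 0 \<le> a w \<and> a w \<le> 1) \<and>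
     (\<forall>k. energy k a \<le> B / theta ^ k) \<and> (\<forall>k. a (corner k x) = 1) \<and>
     (\<forall>k. \<bar>a (corner k y)\<bar> powr p \<le> B / theta ^ k) \<and>
     (\<forall>k. \<forall>w\<in>W k. a (w @ corner 1 x) = a w)"
proof -
  obtain C where C: "1 \<le> C" "\<And>m z. k0 \<le> m \<Longrightarrow> z \<in> V0 \<Longrightarrow> \<exists>g. bump m z g \<and> energy m g \<le> C / res m"
    using ex_bump by blast
  obtain D where D: "1 \<le> D" "\<And>n. res n \<le> D * theta ^ n \<and> theta ^ n \<le> D * res n" using res_theta by blast
  obtain x y where xy: "x \<in> V0" "y \<in> V0" "y \<noteq> x" using V0_ne V0_other by blast
  have th: "0 < theta" using theta_ge_1 by simp
  have "\<forall>m. \<exists>g. k0 \<le> m \<longrightarrow> bump m x g \<and> energy m g \<le> C / res m" using C(2) xy(1) by blast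
  then obtain f where f: "\<And>m. k0 \<le> m \<Longrightarrow> bump m x (f m)" "\<And>m. k0 \<le> m \<Longrightarrow> energy m (f m) \<le> C / res m"
    by metis
  define B where "B = sample_const * D * (C * D)"
  have B0: "0 \<le> B" using sample_const_ge C(1) D(1) by (simp add: B_def)
  have DCB: "D * (C * D) \<le> B"
    using mult_right_mono[OF sample_const_ge, of "D * (C * D)"] C(1) D(1) by (simp add: B_def mult.assoc)
  have Ef: "res (m - k) * energy m (f m) \<le> D * (C * D) / theta ^ k" if m: "k0 \<le> m" "k \<le> m" for m k
  proof -
    have rm: "0 < res m" using res_ge_1[of m] by simp
    have "energy m (f m) \<le> C * D / theta ^ m"
    proof -
      have "C / res m \<le> C * D / theta ^ m"
        using C(1) D(2)[of m] rm th by (simp add: divide_le_eq le_divide_eq mult_left_mono mult.assoc mult.commute)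
      then show ?thesis using f(2)[OF m(1)] by linarith
    qed
    then have "res (m - k) * energy m (f m) \<le> (D * theta ^ (m - k)) * (C * D / theta ^ m)"
      using D(2)[of "m - k"] D(1) th energy_nonneg by (intro mult_mono) auto
    also have "\<dots> = D * (C * D) / theta ^ k" using m th by (simp add: power_diff)
    finally show ?thesis .
  qed
  \<comment> \<open>Corner samples exist only at levels up to m. The value 0 elsewhere is a
    placeholder: for a fixed word of \<open>W k\<close> it no longer occurs once m is large.\<close>
  define A where "A m w = (if k0 \<le> m \<and> length w \<le> m \<and> w \<in> W (length w) then f m (w @ corner (m - length w) x) else 0)" for m w
  have A_eq: "A m w = f m (w @ corner (m - k) x)" if "k0 \<le> m" "k \<le> m" "w \<in> W k" for m k w
    using that words_length[OF that(3)] by (simp add: A_def)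
  have A01: "0 \<le> A m w \<and> A m w \<le> 1" for m w
  proof (cases "k0 \<le> m \<and> length w \<le> m \<and> w \<in> W (length w)")
    case True
    then have "w @ corner (m - length w) x \<in> W m"
      using words_append[of w "length w" _ "m - length w"] corner_words[OF xy(1)] by simp
    then show ?thesis using True f(1)[of m] by (auto simp: A_def bump_def)
  qed (auto simp: A_def)
  have A_energy: "energy k (A m) \<le> B / theta ^ k" if m: "k0 \<le> m" "k \<le> m" for m k
  proof -
    have "energy k (A m) = energy k (\<lambda>w. f m (w @ corner (m - k) x))"
      unfolding energy_def eterm_def using A_eq[OF m] by (intro sum.cong refl) simp
    also have "\<dots> \<le> sample_const * res (m - k) * energy (k + (m - k)) (f m)"
      by (intro sample_energy res_res_bound res_ge_1 xy)
    also have "\<dots> = sample_const * (res (m - k) * energy m (f m))" using m by simp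
    also have "\<dots> \<le> sample_const * (D * (C * D) / theta ^ k)" using Ef[OF m] sample_const_ge by (intro mult_left_mono) auto
    finally show ?thesis by (simp add: B_def)
  qed
  \<comment> \<open>Samples are taken at x, where the bump is 1, so the value at the corners of x is
    exact. At the corners of y it is only small, by the resistance bound inside the cell
    \<open>corner k y\<close>.\<close>
  have A_x: "A m (corner k x) = 1" if m: "k0 \<le> m" "k \<le> m" for m k
  proof -
    have "corner k x @ corner (m - k) x = corner m x" using m by (simp flip: corner_append)
    then show ?thesis using A_eq[OF m corner_words[OF xy(1)]] f(1)[OF m(1)] corner_star[OF xy(1)] by (simp add: bump_def)
  qed
  have A_y: "\<bar>A m (corner k y)\<bar> powr p \<le> B / theta ^ k" if m: "k0 \<le> m" "k \<le> m" for m k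
  proof -
    let ?g = "\<lambda>v. f m (corner k y @ v)"
    have "corner k y @ corner (m - k) y = corner m y" using m by (simp flip: corner_append)
    then have "?g (corner (m - k) y) = 0" using f(1)[OF m(1)] corner_star[OF xy(2)] xy by (simp add: bump_def)
    then have "\<bar>A m (corner k y)\<bar> powr p \<le> res (m - k) * energy (m - k) ?g"
      using res_bound_D[OF res_res_bound xy(1,2), where f = ?g and m = "m - k"] A_eq[OF m corner_words[OF xy(2)]] by simp
    also have "energy (m - k) ?g = block (m - k) (f m) (corner k y) (corner k y)"
      by (rule block_self[OF corner_words[OF xy(2)], symmetric])
    also have "\<dots> \<le> energy m (f m)"
      using block_le_energy[of "corner k y" k "corner k y" "m - k" "f m"] corner_words[OF xy(2)] m by simp
    finally have "\<bar>A m (corner k y)\<bar> powr p \<le> res (m - k) * energy m (f m)"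
      using res_ge_1[of "m - k"] by (simp add: mult_left_mono)
    also have "\<dots> \<le> D * (C * D) / theta ^ k" by (rule Ef[OF m])
    also have "\<dots> \<le> B / theta ^ k" using DCB th by (intro divide_right_mono) auto
    finally show ?thesis .
  qed
  have A_ext: "A m (w @ corner 1 x) = A m w" if m: "k0 \<le> m" "Suc k \<le> m" and w: "w \<in> W k" for m k w
  proof -
    have w1: "w @ corner 1 x \<in> W (Suc k)" using words_append[OF w corner_words[OF xy(1), of 1]] by simp
    have "corner 1 x @ corner (m - Suc k) x = corner (m - k) x"
      using m corner_append[of 1 "m - Suc k" x] by (simp add: Suc_diff_Suc)
    then show ?thesis using A_eq[OF m w1] A_eq[OF m(1) _ w] m by simp
  qed
  obtain r a where r: "strict_mono r" and lim: "\<And>w. (\<lambda>j. A (r j) w) \<longlonglongrightarrow> a w"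
    using bounded_functions_subsequence[where f = A, OF A01] by blast
  have large: "eventually (\<lambda>j. k0 \<le> r j \<and> k \<le> r j) sequentially" for k
  proof -
    have "k0 \<le> r j \<and> k \<le> r j" if "max k0 k \<le> j" for j using seq_suble[OF r, of j] that by auto
    then show ?thesis unfolding eventually_sequentially by blast
  qed
  have "0 \<le> a w \<and> a w \<le> 1" for w
    using A01 by (auto intro!: LIMSEQ_le_const[OF lim] LIMSEQ_le_const2[OF lim])
  moreover have "energy k a \<le> B / theta ^ k" for k
  proof (rule tendsto_upperbound)
    show "(\<lambda>j. energy k (A (r j))) \<longlonglongrightarrow> energy k a"
      unfolding energy_def
    proof (intro tendsto_sum)
      fix w v
      show "(\<lambda>j. eterm (A (r j)) w v) \<longlonglongrightarrow> eterm a w v"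
        unfolding eterm_def using p
        by (cases "adj w v") (auto intro!: tendsto_powr' tendsto_intros lim)
    qed
    show "eventually (\<lambda>j. energy k (A (r j)) \<le> B / theta ^ k) sequentially"
      using large[of k] by eventually_elim (use A_energy in auto)
  qed simp
  moreover have "a (corner k x) = 1" for k
  proof (rule LIMSEQ_unique[OF lim])
    have "eventually (\<lambda>j. A (r j) (corner k x) = 1) sequentially"
      using large[of k] by eventually_elim (use A_x in auto)
    then show "(\<lambda>j. A (r j) (corner k x)) \<longlonglongrightarrow> 1" by (rule tendsto_eventually)
  qed
  moreover have "\<bar>a (corner k y)\<bar> powr p \<le> B / theta ^ k" for k
  proof (rule tendsto_upperbound)
    show "(\<lambda>j. \<bar>A (r j) (corner k y)\<bar> powr p) \<longlonglongrightarrow> \<bar>a (corner k y)\<bar> powr p"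
      using p by (auto intro!: tendsto_powr' tendsto_intros lim)
    show "eventually (\<lambda>j. \<bar>A (r j) (corner k y)\<bar> powr p \<le> B / theta ^ k) sequentially"
      using large[of k] by eventually_elim (use A_y in auto)
  qed simp
  moreover have "a (w @ corner 1 x) = a w" if w: "w \<in> W k" for w k
  proof (rule LIMSEQ_unique[OF lim])
    have "eventually (\<lambda>j. A (r j) w = A (r j) (w @ corner 1 x)) sequentially"
      using large[of "Suc k"] by eventually_elim (use A_ext[OF _ _ w] in auto)
    from Lim_transform_eventually[OF lim this] show "(\<lambda>j. A (r j) (w @ corner 1 x)) \<longlonglongrightarrow> a w" .
  qed
  ultimately show ?thesis using xy B0 by (intro exI[of _ a] exI[of _ x] exI[of _ y] exI[of _ B]) auto
qed

text \<open>Single energy terms are at most B / theta^k, so the values of a on meeting cells, and on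
  parent and child, differ by order q^k with q = theta^(-1/p) < 1. Values along cells shrinking to a
  point converge uniformly, to a continuous u that is close to 1 near x and close to 0 near
  y.\<close>

lemma ex_Besov_nonconstant_gt_1:
  assumes th1: "1 < theta"
  shows "\<exists>u\<in>Besov_space mu p crit_sigma. \<not> ae_constant mu u"
proof -
  obtain a x y B where xy: "x \<in> V0" "y \<in> V0" and B: "0 \<le> B" and a01: "\<And>w. 0 \<le> a w \<and> a w \<le> 1"
    and aE: "\<And>k. energy k a \<le> B / theta ^ k" and ax: "\<And>k. a (corner k x) = 1"
    and ay: "\<And>k. \<bar>a (corner k y)\<bar> powr p \<le> B / theta ^ k"
    and ext: "\<And>k w. w \<in> W k \<Longrightarrow> a (w @ corner 1 x) = a w"
    using ex_limit_function by blast
  define q where "q = theta powr (- 1 / p)"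
  have q: "0 < q" "q < 1" using th1 p powr_less_mono[of "- 1 / p" 0 theta] by (auto simp: q_def)
  have qp: "(q ^ n) powr p = 1 / theta ^ n" for n
  proof -
    have "(q ^ n) powr p = (q powr p) ^ n" using q by (simp add: powr_powr powr_realpow[symmetric] mult.commute)
    also have "q powr p = theta powr (- 1)" unfolding q_def powr_powr using p by simp
    also have "\<dots> = 1 / theta" using th1 by (simp add: powr_minus_divide)
    finally show ?thesis by (simp add: power_divide)
  qed
  have root: "\<bar>t\<bar> \<le> e powr (1 / p) * q ^ n" if "\<bar>t\<bar> powr p \<le> e / theta ^ n" "0 \<le> e" for t e n
  proof (rule ccontr)
    assume "\<not> ?thesis"
    then have "(e powr (1 / p) * q ^ n) powr p < \<bar>t\<bar> powr p" using q p by (intro powr_less_mono2) auto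
    moreover have "(e powr (1 / p) * q ^ n) powr p = e / theta ^ n"
      using that(2) p q by (simp add: powr_mult powr_powr qp)
    ultimately show False using that(1) by simp
  qed
  obtain C1 where C1: "1 \<le> C1" "\<And>f w v. w \<in> W 1 \<Longrightarrow> v \<in> W 1 \<Longrightarrow> \<bar>f w - f v\<bar> powr p \<le> C1 * energy 1 f"
    using ex_level_one_bound by blast
  define c where "c = (C1 * B) powr (1 / p)"
  have c0: "0 \<le> c" by (simp add: c_def)
  have BC: "B \<le> C1 * B" using C1(1) B by (simp add: mult_le_cancel_right1)
  have a_adj: "\<bar>a w - a v\<bar> \<le> c * q ^ n" if wv: "w \<in> W n" "v \<in> W n" "adj w v" for n w v
  proof -
    have "\<bar>a w - a v\<bar> powr p \<le> B / theta ^ n" using adj_le_energy[OF wv, of a] aE[of n] by linarith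
    also have "\<dots> \<le> C1 * B / theta ^ n" using BC th1 by (intro divide_right_mono) auto
    finally show ?thesis unfolding c_def using C1 B by (intro root) auto
  qed
  have a_child: "\<bar>a v - a (take n v)\<bar> \<le> c * q ^ n" if v: "v \<in> W (Suc n)" for n v
  proof -
    define w where "w = take n v"
    have w: "w \<in> W n" unfolding w_def using take_words[OF v] by simp
    have dv: "drop n v \<in> W 1" using drop_words[OF v, of n] by simp
    have vw: "v = w @ drop n v" by (simp add: w_def)
    have "\<bar>a (w @ drop n v) - a (w @ corner 1 x)\<bar> powr p \<le> C1 * energy 1 (\<lambda>v. a (w @ v))"
      using C1(2)[OF dv corner_words[OF xy(1)], of "\<lambda>v. a (w @ v)"] .
    also have "energy 1 (\<lambda>v. a (w @ v)) \<le> energy (n + 1) a"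
      using block_self[OF w, of 1 a] block_le_energy[OF w w, of 1 a] by simp
    also have "\<dots> \<le> B / theta ^ (n + 1)" by (rule aE)
    also have "\<dots> \<le> B / theta ^ n" using B th1 by (intro divide_left_mono) auto
    finally have "\<bar>a v - a w\<bar> powr p \<le> C1 * B / theta ^ n"
      using C1(1) ext[OF w] by (simp add: mult_left_mono vw[symmetric])
    then show ?thesis unfolding c_def w_def using C1 B by (intro root) auto
  qed
  \<comment> \<open>The chosen cells need not be nested. Consecutive choices are linked through the
    prefix of the finer one, which also contains z; hence the constant 2 * c below.\<close>
  define sel where "sel n z = (SOME w. w \<in> W n \<and> z \<in> kcell w)" for n z
  have sel: "sel n z \<in> W n" "z \<in> kcell (sel n z)" if "z \<in> K" for n z
  proof -
    have "\<exists>w. w \<in> W n \<and> z \<in> kcell w" using ex_cell[OF that] by blast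
    then have "sel n z \<in> W n \<and> z \<in> kcell (sel n z)" unfolding sel_def by (rule someI_ex)
    then show "sel n z \<in> W n" "z \<in> kcell (sel n z)" by auto
  qed
  define u where "u z = lim (\<lambda>n. a (sel n z))" for z
  have inc: "\<bar>a (sel (Suc n) z) - a (sel n z)\<bar> \<le> 2 * c * q ^ n" if z: "z \<in> K" for n z
  proof -
    let ?v = "sel (Suc n) z"
    have "z \<in> kcell (take n ?v)" using cell_take[OF sel(1)[OF z]] sel(2)[OF z] by blast
    then have "\<bar>a (take n ?v) - a (sel n z)\<bar> \<le> c * q ^ n"
      using sel[OF z] take_words[OF sel(1)[OF z, of "Suc n"], of n] by (intro a_adj adjI) auto
    then show ?thesis using a_child[OF sel(1)[OF z, of "Suc n"]] by linarith
  qed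
  define c3 where "c3 = c + 2 * c / (1 - q)"
  have c30: "0 \<le> c3" using c0 q by (simp add: c3_def)
  have u_near: "\<bar>u z - a w\<bar> \<le> c3 * q ^ n" if z: "w \<in> W n" "z \<in> kcell w" for z w n
  proof -
    have zK: "z \<in> K" using z cell_subset_K by blast
    have "\<bar>u z - a (sel n z)\<bar> \<le> 2 * c * q ^ n / (1 - q)"
      unfolding u_def using geometric_increments_limit(1)[of q "\<lambda>n. a (sel n z)" "2 * c" n] q inc[OF zK] by simp
    moreover have "\<bar>a (sel n z) - a w\<bar> \<le> c * q ^ n" using sel[OF zK] z by (intro a_adj adjI) auto
    ultimately show ?thesis by (simp add: c3_def distrib_right)
  qed
  have u01: "\<bar>u z\<bar> \<le> 1" if z: "z \<in> K" for z
  proof -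
    have L: "(\<lambda>n. a (sel n z)) \<longlonglongrightarrow> u z"
      unfolding u_def using geometric_increments_limit(2)[of q "\<lambda>n. a (sel n z)" "2 * c"] q inc[OF z] by simp
    have "0 \<le> u z" "u z \<le> 1" using a01 by (auto intro!: LIMSEQ_le_const[OF L] LIMSEQ_le_const2[OF L])
    then show ?thesis by simp
  qed
  have qlim: "(\<lambda>n. q ^ n) \<longlonglongrightarrow> 0" using q by (intro LIMSEQ_power_zero) auto
  have q_small: "\<exists>n. d * q ^ n < e" if "0 < e" for d e :: real
  proof -
    have "(\<lambda>n. d * q ^ n) \<longlonglongrightarrow> d * 0" by (intro tendsto_mult tendsto_const qlim)
    then have "eventually (\<lambda>n. d * q ^ n < e) sequentially" using that by (intro order_tendstoD(2)) auto
    then show ?thesis by (auto simp: eventually_sequentially)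
  qed
  have cont: "continuous_on K u"
  proof (unfold continuous_on_iff, intro ballI allI impI)
    fix z e assume z: "z \<in> K" and e: "0 < (e::real)"
    obtain n where n: "(2 * c3 + c) * q ^ n < e" using q_small[OF e] by blast
    show "\<exists>d>0. \<forall>z'\<in>K. dist z' z < d \<longrightarrow> dist (u z') (u z) < e"
    proof (intro exI[of _ "gap * \<rho> ^ n"] conjI ballI impI)
      show "0 < gap * \<rho> ^ n" using gap(1) rho by simp
      fix z' assume z': "z' \<in> K" "dist z' z < gap * \<rho> ^ n"
      have "adj (sel n z') (sel n z)" using sel[OF z] sel[OF z'(1)] z'(2) by (intro gap(3)[of _ n _ z' z]) auto
      then have "\<bar>a (sel n z') - a (sel n z)\<bar> \<le> c * q ^ n" using sel[OF z] sel[OF z'(1)] by (intro a_adj) auto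
      moreover have "\<bar>u z - a (sel n z)\<bar> \<le> c3 * q ^ n" "\<bar>u z' - a (sel n z')\<bar> \<le> c3 * q ^ n"
        using u_near sel z z'(1) by blast+
      ultimately have "\<bar>u z' - u z\<bar> \<le> (2 * c3 + c) * q ^ n" by (simp add: distrib_right)
      then show "dist (u z') (u z) < e" using n by (simp add: dist_real_def)
    qed
  qed
  have um: "u \<in> borel_measurable mu"
  proof -
    have "sets mu = sets (restrict_space borel K)"
      unfolding mu_def by (intro sets_restrict_space_cong) simp
    then show ?thesis using borel_measurable_continuous_on_restrict[OF cont] measurable_cong_sets by blast
  qed
  obtain C where C: "1 \<le> C" "\<And>n k f. osc_energy n u \<le> ennreal C *
     (ennreal (1 / real N ^ k) * dev_energy (n + k) u f + ennreal (theta ^ k * energy (n + k) f))"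
    using ex_osc_energy_le um by blast
  have dev_energy: "dev_energy m u a \<le> ennreal (real N ^ m * (c3 powr p / theta ^ m))" for m
  proof -
    have "cell_dev u w (a w) \<le> ennreal (c3 powr p / theta ^ m * (1 / real N ^ m))" if w: "w \<in> W m" for w
    proof -
      have "cell_dev u w (a w) \<le> (\<integral>\<^sup>+z. ennreal (c3 powr p / theta ^ m) * indicator (kcell w) z \<partial>mu)"
        unfolding cell_dev_def
      proof (rule nn_integral_mono)
        fix z
        show "ennreal (\<bar>u z - a w\<bar> powr p) * indicator (kcell w) z \<le> ennreal (c3 powr p / theta ^ m) * indicator (kcell w) z"
        proof (cases "z \<in> kcell w")
          case True
          have "\<bar>u z - a w\<bar> powr p \<le> (c3 * q ^ m) powr p" using u_near[OF w True] p by (intro powr_mono2) auto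
          also have "\<dots> = c3 powr p / theta ^ m" using c30 q by (simp add: powr_mult qp)
          finally show ?thesis using True by (simp add: ennreal_leI)
        qed simp
      qed
      also have "\<dots> = ennreal (c3 powr p / theta ^ m) * emeasure mu (kcell w)"
        using cell_sets[OF w] by (rule nn_integral_cmult_indicator)
      also have "\<dots> \<le> ennreal (c3 powr p / theta ^ m) * ennreal (1 / real N ^ m)"
        by (intro mult_left_mono mu_cell_le w) auto
      finally show ?thesis using th1 by (simp add: ennreal_mult[symmetric])
    qed
    then have "dev_energy m u a \<le> ennreal (real N ^ m) * (\<Sum>w\<in>W m. ennreal (c3 powr p / theta ^ m * (1 / real N ^ m)))"
      unfolding dev_energy_def by (intro mult_left_mono sum_mono) auto
    also have "(\<Sum>w\<in>W m. ennreal (c3 powr p / theta ^ m * (1 / real N ^ m))) = ennreal (c3 powr p / theta ^ m)"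
    proof -
      have "(\<Sum>w\<in>W m. ennreal (c3 powr p / theta ^ m * (1 / real N ^ m)))
          = ennreal (\<Sum>w\<in>W m. c3 powr p / theta ^ m * (1 / real N ^ m))"
        using th1 by (intro sum_ennreal) auto
      also have "(\<Sum>w\<in>W m. c3 powr p / theta ^ m * (1 / real N ^ m)) = c3 powr p / theta ^ m"
        using N_ge_2 by (simp add: card_words)
      finally show ?thesis .
    qed
    finally show ?thesis using th1 by (simp add: ennreal_mult[symmetric])
  qed
  have "osc_energy n u \<le> ennreal (C * B / theta ^ n)" for n
  proof -
    \<comment> \<open>The deviation term carries (1 / theta)^k and disappears as k grows; the energy
      term does not depend on k.\<close>
    have le: "osc_energy n u \<le> ennreal (C * (real N ^ n * (c3 powr p / theta ^ n) * (1 / theta) ^ k + B / theta ^ n))" for k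
    proof -
      have "ennreal (1 / real N ^ k) * dev_energy (n + k) u a
          \<le> ennreal (1 / real N ^ k) * ennreal (real N ^ (n + k) * (c3 powr p / theta ^ (n + k)))"
        by (intro mult_left_mono dev_energy) auto
      also have "\<dots> = ennreal (real N ^ n * (c3 powr p / theta ^ n) * (1 / theta) ^ k)"
        using th1 N_ge_2 by (simp add: ennreal_mult[symmetric] power_add power_divide)
      finally have 1: "ennreal (1 / real N ^ k) * dev_energy (n + k) u a \<le> ennreal (real N ^ n * (c3 powr p / theta ^ n) * (1 / theta) ^ k)" .
      have "theta ^ k * energy (n + k) a \<le> theta ^ k * (B / theta ^ (n + k))"
        using aE[of "n + k"] th1 by (intro mult_left_mono) auto
      also have "\<dots> = B / theta ^ n" using th1 by (simp add: power_add)
      finally have 2: "ennreal (theta ^ k * energy (n + k) a) \<le> ennreal (B / theta ^ n)" by (rule ennreal_leI)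
      have "osc_energy n u \<le> ennreal C * (ennreal (real N ^ n * (c3 powr p / theta ^ n) * (1 / theta) ^ k) + ennreal (B / theta ^ n))"
        by (intro order_trans[OF C(2)[of n k a]] mult_left_mono add_mono 1 2) auto
      also have "\<dots> = ennreal (C * (real N ^ n * (c3 powr p / theta ^ n) * (1 / theta) ^ k + B / theta ^ n))"
        using C(1) B th1 by (simp add: ennreal_mult[symmetric] ennreal_plus[symmetric] del: ennreal_plus)
      finally show ?thesis .
    qed
    have "(\<lambda>k. (1 / theta) ^ k) \<longlonglongrightarrow> 0" using th1 by (intro LIMSEQ_power_zero) auto
    then have "(\<lambda>k. C * (real N ^ n * (c3 powr p / theta ^ n) * (1 / theta) ^ k + B / theta ^ n))
        \<longlonglongrightarrow> C * (real N ^ n * (c3 powr p / theta ^ n) * 0 + B / theta ^ n)"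
      by (intro tendsto_mult tendsto_add tendsto_const)
    then have "(\<lambda>k. ennreal (C * (real N ^ n * (c3 powr p / theta ^ n) * (1 / theta) ^ k + B / theta ^ n)))
        \<longlonglongrightarrow> ennreal (C * B / theta ^ n)"
      by (intro tendsto_ennrealI) simp
    then show ?thesis using le by (intro LIMSEQ_le_const) auto
  qed
  then have "u \<in> Besov_space mu p crit_sigma"
    using B C(1) by (intro Besov_sig0I[OF um u01, of "C * B"]) auto
  moreover have "\<not> ae_constant mu u"
  proof -
    obtain n where n: "(c3 + B powr (1 / p)) * q ^ n < 1 / 2" using q_small[of "1/2"] by auto
    have c3n: "c3 * q ^ n < 1 / 2" "B powr (1 / p) * q ^ n + c3 * q ^ n < 1 / 2"
    proof -
      show "B powr (1 / p) * q ^ n + c3 * q ^ n < 1 / 2" using n by (simp add: distrib_right)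
      moreover have "0 \<le> B powr (1 / p) * q ^ n" using q by simp
      ultimately show "c3 * q ^ n < 1 / 2" by linarith
    qed
    have P: "1 / 2 < u z" if "z \<in> kcell (corner n x)" for z
      using u_near[OF corner_words[OF xy(1)] that] ax[of n] c3n(1) by linarith
    have Q: "u z < 1 / 2" if "z \<in> kcell (corner n y)" for z
      using u_near[OF corner_words[OF xy(2)] that] root[OF ay[of n] B] c3n(2) by linarith
    show ?thesis
      by (rule not_ae_constantI[OF corner_words[OF xy(1)] corner_words[OF xy(2)],
            where P = "\<lambda>z. 1 / 2 < u z" and Q = "\<lambda>z. u z < 1 / 2"])
         (use P Q in auto)
  qed
  ultimately show ?thesis by blast
qed

text \<open>The supremum is a maximum: a nonconstant function exists at \<open>crit_sigma\<close>
  itself, and none above it.\<close>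

lemma critical_exponent_eq: "critical_exponent mu p = crit_sigma"
  unfolding critical_exponent_def
proof (rule cSup_eq_maximum)
  have "\<exists>u\<in>Besov_space mu p crit_sigma. \<not> ae_constant mu u"
    using ex_Besov_nonconstant_1 ex_Besov_nonconstant_gt_1 theta_ge_1 by (cases "theta = 1") auto
  then show "crit_sigma \<in> {\<sigma>. 0 < \<sigma> \<and> (\<exists>u\<in>Besov_space mu p \<sigma>. \<not> ae_constant mu u)}"
    using crit_sigma_pos by simp
  show "\<sigma> \<le> crit_sigma" if "\<sigma> \<in> {\<sigma>. 0 < \<sigma> \<and> (\<exists>u\<in>Besov_space mu p \<sigma>. \<not> ae_constant mu u)}" for \<sigma>
    using that Besov_exponent_le by blast
qed

end

theorem theorem2p3:
  fixes K :: "'a::euclidean_space set"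
    and F :: "nat \<Rightarrow> 'a \<Rightarrow> 'a"
    and N :: nat
    and p :: real
  defines "\<mu> \<equiv> restrict_space (hausdorff_measure (hausdorff_dim K)) K"
  assumes "nested_fractal N F K"
    and "connected K"
    and "diameter K = 1"
    and "1 < p"
  shows "property_NE \<mu> p (critical_exponent \<mu> p)"
proof -
  obtain \<rho> b where "0 < \<rho>" "\<rho> < 1" "\<forall>i\<in>{1..N}. \<forall>x. F i x = \<rho> *\<^sub>R (x - b i) + b i"
    using assms(2) unfolding nested_fractal_def homogeneous_ifs_def by blast
  then interpret nested_fractal_energy N F K \<rho> b p
    using assms(2-5) unfolding nested_fractal_def by unfold_locales auto
  have "\<mu> = mu" unfolding \<mu>_def mu_def hausdorff_dim_K ..
  then show ?thesis using property_NE_crit_sigma critical_exponent_eq by simp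
qed

end
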